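(* One has $$\mathcal M(\Gamma(9))_{\frac13\mathbb M}=\mathcal M(9)_{\langle\frac13,\chi_9\rangle}=\bigoplus_{a,b\in\{0,1,2\}}\mathcal M(3)_{\langle\frac13,\chi_9\rangle}\,\Big(\sqrt[3]{\eta^{\bot}}\Big)^a\Big(\sqrt[3]{\eta^{\top}}\Big)^b,$$ $$\mathcal S(\Gamma(9))_{\frac13\mathbb M}=\mathcal M(\Gamma(9))_{\frac13\mathbb M}\,\eta^{8/3}.$$ Here the sums are internal direct sums, and the first equality means $\mathcal M(\Gamma(9))_{k/3}=\bigoplus_{j=0}^{5}\mathcal M(9)_{(k/3,\chi_9^j)}$ for every integer $k\ge0$.
   Context: $\mathbb M=\{0,1,2,\dots\}$; $\mathcal H$ is the upper half plane, $q^r=e^{2\pi i r\tau}$. $\Gamma(N)$ is the principal congruence subgroup; $\Gamma_0(N)$ (resp. $\Gamma^0(N)$) is the group of $\begin{pmatrix}a&b\\c&d\end{pmatrix}\in\mathrm{SL}_2(\mathbb Z)$ with $N\mid c$ (resp. $N\mid b$). $\eta=q^{1/24}\prod_{n\ge1}(1-q^n)$, and $\eta^r=q^{r/24}\prod_{n\ge1}(1-q^n)^r$ (principal branches) for real $r$. For $\gamma=\begin{pmatrix}a&b\\c&d\end{pmatrix}\in\Gamma_0(3)\cap\Gamma^0(3)$ let $b_9(\gamma)=e^{2\pi i bd/9}$, $c_9(\gamma)=e^{-2\pi i cd/9}$. The weight $\frac43$ automorphy factor on $\Gamma_0(3)\cap\Gamma^0(3)$ is defined by $J_{4/3}(\gamma,\tau)=\big(c_9(\gamma)b_9(\gamma)\big)^{-1}\eta^{8/3}(\gamma\tau)/\eta^{8/3}(\tau)$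 (on $\Gamma(9)$ the factor $c_9b_9$ is trivial), the weight 1 factor is $c\tau+d$, and factors multiply when weights add; thus $J_{k/3}=J_{1/3}^k$ with $J_{1/3}(\gamma,\tau)=J_{4/3}(\gamma,\tau)/(c\tau+d)$. For a congruence subgroup $\varGamma\subset\Gamma_0(3)\cap\Gamma^0(3)$ and $\chi:\varGamma\to\mathbb C^\times$, $\mathcal M(\varGamma)_{(k/3,\chi)}$ is the space of holomorphic $f$ on $\mathcal H$ with $f(\gamma\tau)=\chi(\gamma)J_{k/3}(\gamma,\tau)f(\tau)$ for all $\gamma\in\varGamma$ and holomorphic at the cusps, i.e. $|c\tau+d|^{-k/3}\big|f\big(\frac{a\tau+b}{c\tau+d}\big)\big|$ is bounded as $\operatorname{Im}\tau\to\infty$ for every $\begin{pmatrix}a&b\\c&d\end{pmatrix}\in\mathrm{SL}_2(\mathbb Z)$; $\mathcal S(\varGamma)_{(k/3,\chi)}$ is the subspace where these all tend to $0$. $\mathcal M(\varGamma)_{k/3}$, $\mathcal S(\varGamma)_{k/3}$ are the case $\chi=1$; $\mathcal M(\varGamma)_{\frac13\mathbb M}=\bigoplus_{k\in\mathbb M}\mathcal M(\varGamma)_{k/3}$, similarly $\mathcal S$. $\chi_9$ is the character of $(\mathbb Z/9\mathbb Z)^\times$ with $\chi_9(2)=e^{2\pi i/6}$, regarded as a function of $\gamma$ through its lower right entry $d$. $\mathcal M(N)$ abbreviates $\mathcal M(\Gamma_0(N)\cap\Gamma^0(N))$, and for $N=3,9$, $\mathcal M(N)_{\langle\frac13,\chi_9\rangle}=\bigoplus_{k\in\mathbb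 M}\bigoplus_{j=0}^{5}\mathcal M(N)_{(k/3,\chi_9^j)}$. $\sqrt[3]{\eta^{\bot}}=\eta(\tau/3)\,\eta(\tau)^{-1/3}$ and $\sqrt[3]{\eta^{\top}}=\eta(3\tau)\,\eta(\tau)^{-1/3}$. *)

theory Defs
  imports
    "HOL-Analysis.Analysis"
    "HOL-Number_Theory.Cong"
    "HOL-Library.Function_Algebras"
begin

section \<open>Sums of subspaces\<close>

text \<open>
  The indexed spaces below are additive subgroups of the ambient group, so it suffices to
  require uniqueness of the decomposition of \<open>0\<close>.
\<close>

definition subspace_sum :: "'i set \<Rightarrow> ('i \<Rightarrow> 'v::ab_group_add set) \<Rightarrow> 'v set" where
  "subspace_sum I V = {\<Sum>i\<in>F. v i | F v. finite F \<and> F \<subseteq> I \<and> (\<forall>i\<in>F. v i \<in> V i)}"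

definition independent_subspaces :: "'i set \<Rightarrow> ('i \<Rightarrow> 'v::ab_group_add set) \<Rightarrow> bool" where
  "independent_subspaces I V \<longleftrightarrow>
     (\<forall>F v. finite F \<longrightarrow> F \<subseteq> I \<longrightarrow> (\<forall>i\<in>F. v i \<in> V i) \<longrightarrow> (\<Sum>i\<in>F. v i) = 0 \<longrightarrow> (\<forall>i\<in>F. v i = 0))"

definition is_internal_direct_sum :: "'v::ab_group_add set \<Rightarrow> 'i set \<Rightarrow> ('i \<Rightarrow> 'v set) \<Rightarrow> bool" where
  "is_internal_direct_sum W I V \<longleftrightarrow> W = subspace_sum I V \<and> independent_subspaces I V"

lemma sum_fun_apply: "(\<Sum>i\<in>F. v i) x = (\<Sum>i\<in>F. v i x)"
  for v :: "'i \<Rightarrow> 'a \<Rightarrow> 'b::comm_monoid_add"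
  by (induction F rule: infinite_finite_induct) auto

lemma power_fun_apply: "(f ^ n) x = f x ^ n"
  for f :: "'a \<Rightarrow> 'b::comm_monoid_mult"
  by (induction n) auto


section \<open>The upper half plane and congruence subgroups\<close>

definition upper_half_plane :: "complex set" ("\<H>") where
  "\<H> = {\<tau>. Im \<tau> > 0}"

type_synonym mat2 = "int ^ 2 ^ 2"

definition SL2Z :: "mat2 set" where
  "SL2Z = {\<gamma>. det \<gamma> = 1}"

definition principal_congruence_subgroup :: "int \<Rightarrow> mat2 set" where
  "principal_congruence_subgroup N =
     {\<gamma> \<in> SL2Z. [\<gamma>$1$1 = 1] (mod N) \<and> [\<gamma>$1$2 = 0] (mod N) \<and>
                [\<gamma>$2$1 = 0] (mod N) \<and> [\<gamma>$2$2 = 1] (mod N)}"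

definition Gamma_lower0 :: "int \<Rightarrow> mat2 set" ("\<Gamma>\<^sub>0") where
  "\<Gamma>\<^sub>0 N = {\<gamma> \<in> SL2Z. N dvd \<gamma>$2$1}"

definition Gamma_upper0 :: "int \<Rightarrow> mat2 set" ("\<Gamma>\<^sup>0") where
  "\<Gamma>\<^sup>0 N = {\<gamma> \<in> SL2Z. N dvd \<gamma>$1$2}"

definition act :: "mat2 \<Rightarrow> complex \<Rightarrow> complex" where
  "act \<gamma> \<tau> = (of_int (\<gamma>$1$1) * \<tau> + of_int (\<gamma>$1$2)) / (of_int (\<gamma>$2$1) * \<tau> + of_int (\<gamma>$2$2))"

definition denom :: "mat2 \<Rightarrow> complex \<Rightarrow> complex" where
  "denom \<gamma> \<tau> = of_int (\<gamma>$2$1) * \<tau> + of_int (\<gamma>$2$2)"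


section \<open>Real powers of the eta function\<close>

definition qpow :: "real \<Rightarrow> complex \<Rightarrow> complex" where
  "qpow r \<tau> = exp (2 * of_real pi * \<i> * of_real r * \<tau>)"

text \<open>The factor for \<open>n \<ge> 1\<close> of the product is indexed by \<open>n - 1\<close>.\<close>

definition eta :: "complex \<Rightarrow> complex" where
  "eta \<tau> = qpow (1/24) \<tau> * (\<Prod>n. 1 - qpow (real (Suc n)) \<tau>)"

definition eta_pow :: "real \<Rightarrow> complex \<Rightarrow> complex" where
  "eta_pow r \<tau> = qpow (r/24) \<tau> * (\<Prod>n. (1 - qpow (real (Suc n)) \<tau>) powr of_real r)"

definition cbrt_eta_bot :: "complex \<Rightarrow> complex" where
  "cbrt_eta_bot \<tau> = eta (\<tau> / 3) * eta_pow (-1/3) \<tau>"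

definition cbrt_eta_top :: "complex \<Rightarrow> complex" where
  "cbrt_eta_top \<tau> = eta (3 * \<tau>) * eta_pow (-1/3) \<tau>"


section \<open>Automorphy factors\<close>

definition b9 :: "mat2 \<Rightarrow> complex" where
  "b9 \<gamma> = exp (2 * of_real pi * \<i> * of_int (\<gamma>$1$2 * \<gamma>$2$2) / 9)"

definition c9 :: "mat2 \<Rightarrow> complex" where
  "c9 \<gamma> = exp (- 2 * of_real pi * \<i> * of_int (\<gamma>$2$1 * \<gamma>$2$2) / 9)"

definition J_four_thirds :: "mat2 \<Rightarrow> complex \<Rightarrow> complex" where
  "J_four_thirds \<gamma> \<tau> = inverse (c9 \<gamma> * b9 \<gamma>) * (eta_pow (8/3) (act \<gamma> \<tau>) / eta_pow (8/3) \<tau>)"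

definition J_one_third :: "mat2 \<Rightarrow> complex \<Rightarrow> complex" where
  "J_one_third \<gamma> \<tau> = J_four_thirds \<gamma> \<tau> / denom \<gamma> \<tau>"

text \<open>\<open>J_thirds k\<close> is the factor of weight \<open>k/3\<close>; likewise, the argument \<open>k\<close> of the spaces
  defined below stands for the weight \<open>k/3\<close>.\<close>

definition J_thirds :: "nat \<Rightarrow> mat2 \<Rightarrow> complex \<Rightarrow> complex" where
  "J_thirds k \<gamma> \<tau> = J_one_third \<gamma> \<tau> ^ k"


section \<open>The character \<open>\<chi>\<^sub>9\<close>\<close>

text \<open>As \<open>2\<close> generates the units modulo \<open>9\<close>, the value at \<open>2\<close> determines the character.\<close>

definition chi9_unit :: "int \<Rightarrow> complex" where
  "chi9_unit d =
     (if coprime d 9 then exp (2 * of_real pi * \<i> / 6) ^ (LEAST n. [2 ^ n = d] (mod 9)) else 0)"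

definition chi9 :: "mat2 \<Rightarrow> complex" where
  "chi9 \<gamma> = chi9_unit (\<gamma>$2$2)"


section \<open>Modular forms and cusp forms\<close>

definition cusp_growth :: "nat \<Rightarrow> (complex \<Rightarrow> complex) \<Rightarrow> mat2 \<Rightarrow> complex \<Rightarrow> real" where
  "cusp_growth k f \<gamma> \<tau> = norm (denom \<gamma> \<tau>) powr (- real k / 3) * norm (f (act \<gamma> \<tau>))"

text \<open>
  A function on \<open>\<H>\<close> is represented by its extension by \<open>0\<close> to the complex plane, so that
  equality of functions on \<open>\<H>\<close> is equality in HOL. The filter \<open>filtercomap Im at_top\<close>
  expresses \<open>Im \<tau> \<rightarrow> \<infinity>\<close> (uniformly in the real part).
\<close>

definition modular_forms :: "mat2 set \<Rightarrow> nat \<Rightarrow> (mat2 \<Rightarrow> complex) \<Rightarrow> (complex \<Rightarrow> complex) set" where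
  "modular_forms G k \<psi> =
     {f. (\<forall>\<tau>. \<tau> \<notin> \<H> \<longrightarrow> f \<tau> = 0) \<and> f holomorphic_on \<H> \<and>
         (\<forall>\<gamma>\<in>G. \<forall>\<tau>\<in>\<H>. f (act \<gamma> \<tau>) = \<psi> \<gamma> * J_thirds k \<gamma> \<tau> * f \<tau>) \<and>
         (\<forall>\<gamma>\<in>SL2Z. Bfun (cusp_growth k f \<gamma>) (filtercomap Im at_top))}"

definition cusp_forms :: "mat2 set \<Rightarrow> nat \<Rightarrow> (mat2 \<Rightarrow> complex) \<Rightarrow> (complex \<Rightarrow> complex) set" where
  "cusp_forms G k \<psi> =
     {f \<in> modular_forms G k \<psi>.
        \<forall>\<gamma>\<in>SL2Z. (cusp_growth k f \<gamma> \<longlongrightarrow> 0) (filtercomap Im at_top)}"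

abbreviation modular_forms_triv :: "mat2 set \<Rightarrow> nat \<Rightarrow> (complex \<Rightarrow> complex) set" where
  "modular_forms_triv G k \<equiv> modular_forms G k (\<lambda>_. 1)"

abbreviation cusp_forms_triv :: "mat2 set \<Rightarrow> nat \<Rightarrow> (complex \<Rightarrow> complex) set" where
  "cusp_forms_triv G k \<equiv> cusp_forms G k (\<lambda>_. 1)"

definition graded_modular_forms :: "mat2 set \<Rightarrow> (complex \<Rightarrow> complex) set" where
  "graded_modular_forms G = subspace_sum UNIV (modular_forms_triv G)"

definition graded_cusp_forms :: "mat2 set \<Rightarrow> (complex \<Rightarrow> complex) set" where
  "graded_cusp_forms G = subspace_sum UNIV (cusp_forms_triv G)"

definition modular_forms_level :: "int \<Rightarrow> nat \<Rightarrow> nat \<Rightarrow> (complex \<Rightarrow> complex) set" where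
  "modular_forms_level N k j = modular_forms (\<Gamma>\<^sub>0 N \<inter> \<Gamma>\<^sup>0 N) k (chi9 ^ j)"

definition graded_modular_forms_level :: "int \<Rightarrow> (complex \<Rightarrow> complex) set" where
  "graded_modular_forms_level N =
     subspace_sum (UNIV \<times> {0..5}) (\<lambda>(k, j). modular_forms_level N k j)"


section \<open>Consistency of the definitions\<close>

lemma pow2_mod_9_period: "(2::int) ^ (6 * m) mod 9 = 1"
  by (induction m) (simp_all add: power_add mod_mult_right_eq[symmetric])

lemma ex_pow2_cong_9:
  assumes "coprime (d::int) 9"
  shows "\<exists>n. [2 ^ n = d] (mod 9)"
proof -
  have "\<not> 3 dvd d"
    using assms not_coprimeI[of 3 d 9] by auto
  then have "d mod 9 = 1 \<or> d mod 9 = 2 \<or> d mod 9 = 4 \<or> d mod 9 = 8 \<or> d mod 9 = 7 \<or> d mod 9 = 5"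
    by presburger
  then have "[2 ^ 0 = d] (mod 9) \<or> [2 ^ 1 = d] (mod 9) \<or> [2 ^ 2 = d] (mod 9) \<or>
             [2 ^ 3 = d] (mod 9) \<or> [2 ^ 4 = d] (mod 9) \<or> [2 ^ 5 = d] (mod 9)"
    unfolding cong_def by auto
  then show ?thesis by blast
qed

lemma pow2_mod_9: "(2::int) ^ n mod 9 = 2 ^ (n mod 6) mod 9"
proof -
  have "(2::int) ^ n mod 9 = (2 ^ (6 * (n div 6)) * 2 ^ (n mod 6)) mod 9"
    by (simp flip: power_add)
  also have "\<dots> = (2 ^ (6 * (n div 6)) mod 9 * 2 ^ (n mod 6)) mod 9"
    by (simp only: mod_mult_left_eq)
  finally show ?thesis by (simp only: pow2_mod_9_period) simp
qed

lemma pow2_cong_9_iff: "[(2::int) ^ m = 2 ^ n] (mod 9) \<longleftrightarrow> m mod 6 = n mod 6"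
proof -
  have "r < 6 \<Longrightarrow> r = 0 \<or> r = 1 \<or> r = 2 \<or> r = 3 \<or> r = 4 \<or> r = 5" for r :: nat
    by linarith
  from this[of "m mod 6"] this[of "n mod 6"] show ?thesis
    unfolding cong_def pow2_mod_9[of m] pow2_mod_9[of n] by auto
qed

lemma chi9_unit_pow2:
  assumes "[2 ^ n = d] (mod 9)"
  shows "chi9_unit d = exp (2 * of_real pi * \<i> / 6) ^ n"
proof -
  define z where "z = exp (2 * of_real pi * \<i> / 6 :: complex)"
  define m where "m = (LEAST n. [2 ^ n = d] (mod 9))"
  have "coprime (2 ^ n) (9::int)"
    using coprime_power_left_iff[of "2::int" n 9] by simp
  then have cop: "coprime d 9"
    using cong_imp_coprime[OF assms] by simp
  have "[2 ^ m = d] (mod 9)"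
    unfolding m_def by (rule LeastI, rule assms)
  then have "m mod 6 = n mod 6"
    using assms pow2_cong_9_iff cong_sym cong_trans by blast
  moreover have "z ^ 6 = 1"
    by (simp add: z_def exp_double flip: exp_of_nat_mult)
  then have "z ^ k = z ^ (k mod 6)" for k
    by (metis div_mult_mod_eq mult.commute mult_1 power_add power_mult power_one)
  ultimately have "z ^ m = z ^ n" by metis
  then show ?thesis using cop by (simp add: chi9_unit_def z_def m_def)
qed

lemma chi9_unit_2: "chi9_unit 2 = exp (2 * of_real pi * \<i> / 6)"
  using chi9_unit_pow2[of 1 2] by simp

lemma chi9_unit_mult: "chi9_unit (d * e) = chi9_unit d * chi9_unit e"
proof (cases "coprime d 9 \<and> coprime e 9")
  case True
  then obtain m n where mn: "[2 ^ m = d] (mod 9)" "[2 ^ n = e] (mod 9)"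
    using ex_pow2_cong_9 by blast
  then have "[2 ^ (m + n) = d * e] (mod 9)"
    by (simp add: power_add cong_mult)
  from chi9_unit_pow2[OF this] chi9_unit_pow2[OF mn(1)] chi9_unit_pow2[OF mn(2)]
  show ?thesis by (simp only: power_add)
next
  case False
  then show ?thesis by (auto simp: chi9_unit_def)
qed

lemma chi9_unit_cong: "[d = e] (mod 9) \<Longrightarrow> chi9_unit d = chi9_unit e"
  by (metis chi9_unit_def chi9_unit_pow2 cong_imp_coprime cong_sym cong_trans ex_pow2_cong_9)

lemma cusp_growth_0: "cusp_growth k 0 \<gamma> = (\<lambda>_. 0)"
  by (simp add: fun_eq_iff cusp_growth_def)

lemma cusp_growth_uminus: "cusp_growth k (- f) \<gamma> = cusp_growth k f \<gamma>"
  by (simp add: fun_eq_iff cusp_growth_def)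

lemma zero_in_modular_forms: "0 \<in> modular_forms G k \<psi>"
proof -
  have "(0 :: complex \<Rightarrow> complex) holomorphic_on \<H>"
    by (simp add: zero_fun_def)
  then show ?thesis
    by (simp add: modular_forms_def cusp_growth_0)
qed

lemma zero_in_cusp_forms: "0 \<in> cusp_forms G k \<psi>"
  by (simp add: cusp_forms_def cusp_growth_0 zero_in_modular_forms)

lemma modular_forms_add:
  assumes "f \<in> modular_forms G k \<psi>" "g \<in> modular_forms G k \<psi>"
  shows "f + g \<in> modular_forms G k \<psi>"
proof -
  have "Bfun (cusp_growth k (f + g) \<gamma>) (filtercomap Im at_top)" if "\<gamma> \<in> SL2Z" for \<gamma>
  proof -
    from assms that obtain A B
      where A: "eventually (\<lambda>\<tau>. norm (cusp_growth k f \<gamma> \<tau>) \<le> A) (filtercomap Im at_top)"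
        and B: "eventually (\<lambda>\<tau>. norm (cusp_growth k g \<gamma> \<tau>) \<le> B) (filtercomap Im at_top)"
      unfolding modular_forms_def Bfun_def by blast
    show ?thesis
    proof (rule BfunI)
      show "eventually (\<lambda>\<tau>. norm (cusp_growth k (f + g) \<gamma> \<tau>) \<le> A + B) (filtercomap Im at_top)"
        using A B
      proof eventually_elim
        case (elim \<tau>)
        have "cusp_growth k (f + g) \<gamma> \<tau> \<le> cusp_growth k f \<gamma> \<tau> + cusp_growth k g \<gamma> \<tau>"
          unfolding cusp_growth_def
          by (simp add: norm_triangle_ineq mult_left_mono flip: distrib_left)
        moreover have "cusp_growth k (f + g) \<gamma> \<tau> \<ge> 0" by (simp add: cusp_growth_def)
        ultimately show ?case using elim by simp
      qed
    qed
  qed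
  with assms show ?thesis
    by (auto simp: modular_forms_def plus_fun_def algebra_simps intro!: holomorphic_intros)
qed

lemma modular_forms_uminus:
  assumes "f \<in> modular_forms G k \<psi>"
  shows "- f \<in> modular_forms G k \<psi>"
proof -
  have "(- f) holomorphic_on \<H>"
    using assms by (auto simp: modular_forms_def fun_Compl_def intro!: holomorphic_intros)
  with assms show ?thesis
    by (simp add: modular_forms_def cusp_growth_uminus)
qed

lemma cusp_forms_add:
  assumes "f \<in> cusp_forms G k \<psi>" "g \<in> cusp_forms G k \<psi>"
  shows "f + g \<in> cusp_forms G k \<psi>"
proof -
  have "(cusp_growth k (f + g) \<gamma> \<longlongrightarrow> 0) (filtercomap Im at_top)" if "\<gamma> \<in> SL2Z" for \<gamma>
  proof (rule tendsto_sandwich)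
    have "cusp_growth k (f + g) \<gamma> \<tau> \<le> cusp_growth k f \<gamma> \<tau> + cusp_growth k g \<gamma> \<tau>" for \<tau>
      unfolding cusp_growth_def
      by (simp add: norm_triangle_ineq mult_left_mono flip: distrib_left)
    then show "\<forall>\<^sub>F \<tau> in filtercomap Im at_top.
        cusp_growth k (f + g) \<gamma> \<tau> \<le> cusp_growth k f \<gamma> \<tau> + cusp_growth k g \<gamma> \<tau>"
      by simp
    show "\<forall>\<^sub>F \<tau> in filtercomap Im at_top. 0 \<le> cusp_growth k (f + g) \<gamma> \<tau>"
      by (simp add: cusp_growth_def)
    show "((\<lambda>\<tau>. cusp_growth k f \<gamma> \<tau> + cusp_growth k g \<gamma> \<tau>) \<longlongrightarrow> 0) (filtercomap Im at_top)"
      using assms that tendsto_add[of "cusp_growth k f \<gamma>" 0 _ "cusp_growth k g \<gamma>" 0]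
      by (auto simp: cusp_forms_def)
  qed simp
  with assms show ?thesis
    by (simp add: cusp_forms_def modular_forms_add)
qed

lemma cusp_forms_uminus:
  assumes "f \<in> cusp_forms G k \<psi>"
  shows "- f \<in> cusp_forms G k \<psi>"
  using assms by (simp add: cusp_forms_def modular_forms_uminus cusp_growth_uminus)

end

theory Submission
  imports Defs "HOL-Complex_Analysis.Complex_Analysis" "HOL-Real_Asymp.Real_Asymp"
begin

text \<open>
  Everything is compared through one cocycle, the quotient of \<open>\<eta>\<^sup>8\<^sup>/\<^sup>3(\<gamma>\<tau>) / \<eta>\<^sup>8\<^sup>/\<^sup>3(\<tau>)\<close> by \<open>c\<tau> + d\<close>
  (\<open>third_factor\<close>). It is defined on all of \<open>SL\<^sub>2(\<int>)\<close>, has absolute value \<open>|c\<tau> + d|\<^sup>1\<^sup>/\<^sup>3\<close>, and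
  differs from the automorphy factor of weight \<open>1/3\<close> by the characters \<open>c9\<close> and \<open>b9\<close> only. With the
  slash operation of this cocycle every space of the theorem consists of the forms with a certain
  multiplier on a certain group (\<open>forms\<close>), and holomorphy or vanishing at the cusps becomes boundedness
  or vanishing of the slashed functions.

  The direct sums come from characters. On \<open>\<Gamma>\<^sub>0(3) \<inter> \<Gamma>\<^sup>0(3)\<close> the maps \<open>b9\<close> and \<open>c9\<close> are characters of
  order \<open>3\<close> with common kernel \<open>\<Gamma>\<^sub>0(9) \<inter> \<Gamma>\<^sup>0(9)\<close>, and on the latter group \<open>\<chi>\<^sub>9\<close> is a character of order
  \<open>6\<close> with kernel \<open>\<Gamma>(9)\<close>. The forms on the kernel of a character of finite order are the direct sum
  of the eigenspaces of the larger group (\<open>cyclic_decomposition\<close>). Thus the forms on \<open>\<Gamma>(9)\<close> split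
  according to \<open>\<chi>\<^sub>9\<^sup>j\<close>, and the forms of level \<open>9\<close> split into nine pieces on which the multiplier of level
  \<open>3\<close> is twisted by \<open>c9\<^sup>a b9\<^sup>b\<close> (\<open>character_forms\<close>). Different weights are independent because the
  cocycle takes infinitely many values at each point (\<open>independent_weights\<close>).

  The two cube roots have weight \<open>1/3\<close> and multipliers \<open>\<chi>\<^sub>9\<^sup>3 / b9\<close> and \<open>\<chi>\<^sub>9\<^sup>3 / c9\<close>. Since the weight
  \<open>(a + b)/3\<close> contributes \<open>(c9 b9)\<^sup>-\<^sup>a\<^sup>-\<^sup>b\<close>, their monomial with exponents \<open>a\<close> and \<open>b\<close> carries exactly the
  twist \<open>c9\<^sup>a b9\<^sup>b\<close>, up to a power of \<open>\<chi>\<^sub>9\<close>; so multiplication by it maps the forms of level \<open>3\<close> to the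
  piece of \<open>(a, b)\<close>. The point is that this map is onto. The monomial has no zeros in the half plane.
  At the cusp \<open>\<gamma>\<infinity>\<close>, for \<open>\<gamma>\<close> with first column \<open>(\<alpha>, \<kappa>)\<close>, \<open>cbrt_eta_bot\<close> has order \<open>1/9\<close> if \<open>3\<close>
  divides \<open>\<alpha>\<close> and order \<open>0\<close> otherwise, and \<open>cbrt_eta_top\<close> has order \<open>1/9\<close> if \<open>3\<close> divides \<open>\<kappa>\<close> and order
  \<open>0\<close> otherwise (\<open>slash_cbrt_eta_growth\<close>). A form of the piece \<open>(a, b)\<close> vanishes there at least as much,
  because the twist prescribes its behaviour under a translation by \<open>3\<close> and thereby the fractional part
  of the exponents in its \<open>q\<close>-expansion (\<open>character_forms_decay\<close>). So the quotient is again holomorphic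
  at the cusps. If its weight is negative it is zero (\<open>negative_weight_vanishes\<close>).

  For cusp forms the same division works with \<open>\<eta>\<^sup>8\<^sup>/\<^sup>3\<close>, which has order exactly \<open>1/9\<close> at every cusp: all
  cusps of \<open>\<Gamma>(9)\<close> have width \<open>9\<close>, hence \<open>1/9\<close> is the least order with which a cusp form can vanish.

  The analytic input is the behaviour of \<open>\<eta>\<close> under \<open>SL\<^sub>2(\<int>)\<close>. It is obtained for a holomorphic logarithm
  \<open>log_eta\<close>, which settles all real powers at once: the inversion formula \<open>log_eta_inversion\<close> is proved
  at
  imaginary points of rational height by summing a double series in two orders, and extends by the identity theorem. The multipliers of the cube roots are inverse to those of
  \<open>\<eta>(3\<tau>)\<^sup>3 / \<eta>(\<tau>)\<close> and \<open>\<eta>(\<tau>)\<^sup>3 / \<eta>(3\<tau>)\<close> and are computed on generators of \<open>\<Gamma>\<^sub>0(3)\<close>.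
\<close>

(* The dollar sign denotes components of vectors throughout. *)
no_notation fps_nth (infixl \<open>$\<close> 75)

section \<open>The logarithm of the eta function\<close>

lemma in_upper_half_plane [simp]: "\<tau> \<in> \<H> \<longleftrightarrow> Im \<tau> > 0"
  by (simp add: upper_half_plane_def)

lemma open_upper_half_plane: "open \<H>"
  unfolding upper_half_plane_def by (simp add: open_halfspace_Im_gt)

lemma connected_upper_half_plane: "connected \<H>"
  unfolding upper_half_plane_def by (intro convex_connected convex_halfspace_Im_gt)

lemma norm_qpow: "norm (qpow r \<tau>) = exp (- 2 * pi * r * Im \<tau>)"
  by (simp add: qpow_def)

lemma qpow_Suc_shift: "qpow (real (Suc n)) (\<tau> + 1) = qpow (real (Suc n)) \<tau>"
proof -
  have "qpow (real (Suc n)) (\<tau> + 1) = qpow (real (Suc n)) \<tau> * exp (\<i> * (of_nat (Suc n) * (of_real pi * 2)))"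
    by (simp only: qpow_def exp_add[symmetric]) (simp add: algebra_simps)
  then show ?thesis by (simp only: exp_2pi_1_nat mult_1_right)
qed

lemma norm_Ln_1_plus_le:
  fixes z :: complex
  assumes "norm z < 1"
  shows "norm (Ln (1 + z)) \<le> norm z / (1 - norm z)"
proof -
  have s: "(\<lambda>n. - ((-z) ^ n) / of_nat n) sums Ln (1 + z)"
    by (rule Ln_series') fact
  then have s': "(\<lambda>n. - ((-z) ^ Suc n) / of_nat (Suc n)) sums Ln (1 + z)"
    by (subst sums_Suc_iff) simp
  have g: "(\<lambda>n. norm z * norm z ^ n) sums (norm z * (1 / (1 - norm z)))"
    by (intro sums_mult geometric_sums) (use assms in auto)
  have "norm (- ((-z) ^ Suc n) / of_nat (Suc n)) \<le> norm z * norm z ^ n" for n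
  proof -
    have "norm z * norm z ^ n / real (Suc n) \<le> norm z * norm z ^ n / 1"
      by (intro divide_left_mono) auto
    then show ?thesis by (simp add: norm_divide norm_mult norm_power del: of_nat_Suc)
  qed
  from norm_sums_le[OF s' g this] show ?thesis by simp
qed

text \<open>
  A holomorphic logarithm of \<open>\<eta>\<close>. With it every real power is \<open>\<eta>\<^sup>r = exp (r log \<eta>)\<close>, and the
  transformation formulas below, being exact equations between logarithms, hold for all powers without
  a choice of branches.
\<close>

definition log_eta :: "complex \<Rightarrow> complex" where
  "log_eta \<tau> = 2 * of_real pi * \<i> * \<tau> / 24 + (\<Sum>n. Ln (1 - qpow (real (Suc n)) \<tau>))"

lemma norm_Ln_eta_factor_le:
  assumes "\<delta> > 0" "Im \<tau> \<ge> \<delta>"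
  shows "norm (Ln (1 - qpow (real (Suc n)) \<tau>)) \<le> exp (- 2 * pi * \<delta>) ^ Suc n / (1 - exp (- 2 * pi * \<delta>))"
proof -
  let ?x = "norm (qpow (real (Suc n)) \<tau>)"
  have "?x = exp (- (2 * pi * real (Suc n) * Im \<tau>))" by (simp add: norm_qpow)
  also have "\<dots> \<le> exp (- (2 * pi * real (Suc n) * \<delta>))"
    using assms by (simp del: of_nat_Suc)
  also have "\<dots> = exp (- 2 * pi * \<delta>) ^ Suc n"
    by (simp only: exp_of_nat_mult[symmetric]) (simp add: mult_ac)
  finally have 1: "?x \<le> exp (- 2 * pi * \<delta>) ^ Suc n" .
  also have "\<dots> \<le> exp (- 2 * pi * \<delta>) ^ 1"
    using assms by (intro power_decreasing) auto
  finally have 2: "?x \<le> exp (- 2 * pi * \<delta>)" by simp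
  have 3: "exp (- 2 * pi * \<delta>) < 1" using assms by simp
  have "norm (Ln (1 + - qpow (real (Suc n)) \<tau>)) \<le> ?x / (1 - ?x)"
    using norm_Ln_1_plus_le[of "- qpow (real (Suc n)) \<tau>"] order_le_less_trans[OF 2 3]
    by (simp only: norm_minus_cancel)
  also have "\<dots> \<le> exp (- 2 * pi * \<delta>) ^ Suc n / (1 - exp (- 2 * pi * \<delta>))"
    by (intro frac_le) (use 1 2 3 in auto)
  finally show ?thesis by simp
qed

lemma summable_eta_majorant:
  assumes "\<delta> > 0"
  shows "summable (\<lambda>n. exp (- 2 * pi * \<delta>) ^ Suc n / (1 - exp (- 2 * pi * \<delta>)))"
  using assms by (intro summable_divide) (simp add: summable_mult summable_geometric)

lemma summable_log_eta:
  assumes "Im \<tau> > 0"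
  shows "summable (\<lambda>n. Ln (1 - qpow (real (Suc n)) \<tau>))"
  by (rule summable_comparison_test'[OF summable_eta_majorant[OF assms], of 0])
     (rule norm_Ln_eta_factor_le[OF assms order_refl])

lemma one_minus_qpow_nonzero:
  assumes "Im \<tau> > 0"
  shows "1 - qpow (real (Suc n)) \<tau> \<noteq> 0"
proof -
  have "norm (qpow (real (Suc n)) \<tau>) < 1"
    using assms by (simp add: norm_qpow del: of_nat_Suc)
  then show ?thesis by auto
qed

lemma eta_pow_conv_log_eta:
  assumes "Im \<tau> > 0"
  shows "eta_pow r \<tau> = exp (of_real r * log_eta \<tau>)"
proof -
  have "(\<Prod>n. (1 - qpow (real (Suc n)) \<tau>) powr of_real r) =
        (\<Prod>n. exp (of_real r * Ln (1 - qpow (real (Suc n)) \<tau>)))"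
    using one_minus_qpow_nonzero[OF assms] by (simp only: powr_def) simp
  also have "\<dots> = exp (\<Sum>n. of_real r * Ln (1 - qpow (real (Suc n)) \<tau>))"
    by (intro prodinf_exp summable_mult summable_log_eta assms)
  also have "(\<Sum>n. of_real r * Ln (1 - qpow (real (Suc n)) \<tau>)) =
             of_real r * (\<Sum>n. Ln (1 - qpow (real (Suc n)) \<tau>))"
    by (intro suminf_mult summable_log_eta assms)
  finally show ?thesis
    by (simp add: eta_pow_def log_eta_def qpow_def exp_add ring_distribs mult_ac)
qed

lemma eta_conv_log_eta:
  assumes "Im \<tau> > 0"
  shows "eta \<tau> = exp (log_eta \<tau>)"
proof -
  have "(1 - qpow (real (Suc n)) \<tau>) powr of_real 1 = 1 - qpow (real (Suc n)) \<tau>" for n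
    using one_minus_qpow_nonzero[OF assms] by simp
  then have "eta \<tau> = eta_pow 1 \<tau>"
    by (simp only: eta_def eta_pow_def)
  then show ?thesis using eta_pow_conv_log_eta[OF assms, of 1] by simp
qed

lemma holomorphic_log_eta: "log_eta holomorphic_on \<H>"
proof -
  have "(\<lambda>\<tau>. \<Sum>n. Ln (1 - qpow (real (Suc n)) \<tau>)) holomorphic_on \<H>"
  proof (rule holomorphic_uniform_sequence[OF open_upper_half_plane])
    fix n
    show "(\<lambda>\<tau>. \<Sum>i<n. Ln (1 - qpow (real (Suc i)) \<tau>)) holomorphic_on \<H>"
    proof (intro holomorphic_on_sum holomorphic_on_Ln')
      fix i
      show "(\<lambda>\<tau>. 1 - qpow (real (Suc i)) \<tau>) holomorphic_on \<H>"
        unfolding qpow_def by (intro holomorphic_intros)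
      fix \<tau> assume "\<tau> \<in> \<H>"
      then have "norm (qpow (real (Suc i)) \<tau>) < 1"
        by (simp add: norm_qpow del: of_nat_Suc)
      then have "Re (1 - qpow (real (Suc i)) \<tau>) > 0"
        using complex_Re_le_cmod[of "qpow (real (Suc i)) \<tau>"] by simp
      then show "1 - qpow (real (Suc i)) \<tau> \<notin> \<real>\<^sub>\<le>\<^sub>0"
        by (auto simp: complex_nonpos_Reals_iff)
    qed
  next
    fix x assume "x \<in> \<H>"
    define \<delta> where "\<delta> = Im x / 2"
    have \<delta>: "\<delta> > 0" using \<open>x \<in> \<H>\<close> by (simp add: \<delta>_def)
    have im: "Im z \<ge> \<delta>" if "z \<in> cball x \<delta>" for z
    proof -
      have "\<bar>Im (x - z)\<bar> \<le> \<delta>"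
        using that abs_Im_le_cmod[of "x - z"] by (simp add: dist_norm)
      then have "\<bar>Im x - Im z\<bar> \<le> \<delta>" by simp
      moreover have "Im x = 2 * \<delta>" by (simp add: \<delta>_def)
      ultimately show ?thesis by linarith
    qed
    have "uniform_limit (cball x \<delta>) (\<lambda>n \<tau>. \<Sum>i<n. Ln (1 - qpow (real (Suc i)) \<tau>))
      (\<lambda>\<tau>. \<Sum>n. Ln (1 - qpow (real (Suc n)) \<tau>)) sequentially"
      by (rule Weierstrass_m_test[OF _ summable_eta_majorant[OF \<delta>]])
         (use im norm_Ln_eta_factor_le[OF \<delta>] in blast)
    then show "\<exists>d>0. cball x d \<subseteq> \<H> \<and> uniform_limit (cball x d)
        (\<lambda>n \<tau>. \<Sum>i<n. Ln (1 - qpow (real (Suc i)) \<tau>))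
        (\<lambda>\<tau>. \<Sum>n. Ln (1 - qpow (real (Suc n)) \<tau>)) sequentially"
      using \<delta> im by (intro exI[of _ \<delta>]) fastforce
  qed
  then show ?thesis
    unfolding log_eta_def by (intro holomorphic_intros) auto
qed

lemma log_eta_shift: "log_eta (\<tau> + 1) = log_eta \<tau> + 2 * of_real pi * \<i> / 24"
  by (simp only: log_eta_def qpow_Suc_shift) (simp add: field_simps)

text \<open>
  The factors of the product tend to \<open>1\<close> uniformly, so the size of \<open>\<eta>\<close> near infinity is that of
  \<open>q\<^sup>1\<^sup>/\<^sup>2\<^sup>4\<close>. All orders at cusps are read off from this estimate.
\<close>

lemma log_eta_growth:
  "\<exists>C. \<forall>\<tau>. Im \<tau> \<ge> 1 \<longrightarrow> \<bar>Re (log_eta \<tau>) + pi * Im \<tau> / 12\<bar> \<le> C"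
proof (intro exI allI impI)
  fix \<tau> assume "Im \<tau> \<ge> 1"
  let ?S = "\<Sum>n. Ln (1 - qpow (real (Suc n)) \<tau>)"
  have "norm ?S \<le> (\<Sum>n. exp (- 2 * pi * 1) ^ Suc n / (1 - exp (- 2 * pi * 1)))"
    by (rule norm_suminf_le[OF _ summable_eta_majorant]) (use norm_Ln_eta_factor_le[of 1, OF _ \<open>Im \<tau> \<ge> 1\<close>] in auto)
  moreover have "Re (log_eta \<tau>) + pi * Im \<tau> / 12 = Re ?S"
    by (simp add: log_eta_def)
  ultimately show "\<bar>Re (log_eta \<tau>) + pi * Im \<tau> / 12\<bar> \<le>
      (\<Sum>n. exp (- 2 * pi * 1) ^ Suc n / (1 - exp (- 2 * pi * 1)))"
    using abs_Re_le_cmod[of ?S] by linarith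
qed

section \<open>The inversion formula\<close>

text \<open>
  The partial fraction expansion of \<open>coth\<close>, from the logarithmic derivative of the reflection formula
  of the Gamma function and the series of the Digamma function.
\<close>

lemma coth_partial_fractions:
  fixes x :: real
  assumes "x > 0"
  shows "(\<lambda>k. 1 / (x\<^sup>2 + (real (Suc k))\<^sup>2)) sums
           (pi / x * (1 / (exp (2 * pi * x) - 1) + 1 / 2 - 1 / (2 * pi * x)))"
proof -
  \<comment> \<open>The partial fractions come from \<open>\<pi> cot (\<pi> z)\<close> at the imaginary point \<open>z = i x\<close>.\<close>
  define z where "z = \<i> * of_real x"
  have zZ: "z \<notin> \<int>" "1 - z \<notin> \<int>"
    using assms by (auto simp: z_def complex_eq_iff elim!: Ints_cases)
  then have nonpos: "z \<notin> \<int>\<^sub>\<le>\<^sub>0" "1 - z \<notin> \<int>\<^sub>\<le>\<^sub>0" by (auto dest: nonpos_Ints_Int)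
  define E :: complex where "E = of_real (exp (2 * pi * x))"
  have "exp (2 * pi * x) \<noteq> 1" using assms by simp
  then have E: "E \<noteq> 1" "E \<noteq> 0" by (simp_all only: E_def of_real_eq_1_iff of_real_eq_0_iff exp_not_eq_zero not_False_eq_True)
  have e1: "exp (\<i> * (of_real pi * z)) = of_real (exp (- pi * x))"
    by (simp add: z_def exp_of_real[symmetric] mult_ac)
  have e2: "exp (- (\<i> * (of_real pi * z))) = of_real (exp (pi * x))"
    by (simp add: z_def exp_of_real[symmetric] mult_ac)
  have Ee: "E = of_real (exp (pi * x)) * of_real (exp (pi * x))"
    by (simp add: E_def flip: of_real_mult exp_add)
  have ee: "of_real (exp (- pi * x)) * of_real (exp (pi * x)) = (1::complex)"
    by (simp flip: of_real_mult exp_add)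
  define s where "s = of_real (exp (pi * x)) * sin (of_real pi * z) * 2 * \<i>"
  define c where "c = of_real (exp (pi * x)) * cos (of_real pi * z) * 2"
  have s: "s = 1 - E" unfolding s_def sin_exp_eq e1 e2 Ee using ee by (simp add: field_simps)
  have c: "c = 1 + E" unfolding c_def cos_exp_eq e1 e2 Ee using ee by (simp add: field_simps)
  have sin0: "sin (of_real pi * z) \<noteq> 0" using s E by (auto simp: s_def)
  have cot: "cos (of_real pi * z) / sin (of_real pi * z) = \<i> * ((1 + E) / (1 - E))"
    unfolding s[symmetric] c[symmetric] s_def c_def using sin0 by (simp add: field_simps)

  \<comment> \<open>The logarithmic derivative of the reflection formula.\<close>
  have d1: "((\<lambda>w. Gamma w * Gamma (1 - w)) has_field_derivative
          (Gamma z * Digamma z * Gamma (1 - z) - Gamma z * (Gamma (1 - z) * Digamma (1 - z)))) (at z)"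
    using nonpos by (auto intro!: derivative_eq_intros)
  have d2: "((\<lambda>w. of_real pi / sin (of_real pi * w)) has_field_derivative
          (- (of_real pi * (of_real pi * cos (of_real pi * z))) / (sin (of_real pi * z))\<^sup>2)) (at z)"
    using sin0 by (auto intro!: derivative_eq_intros simp: power2_eq_square)
  have "(Gamma z * Digamma z * Gamma (1 - z) - Gamma z * (Gamma (1 - z) * Digamma (1 - z))) =
     (- (of_real pi * (of_real pi * cos (of_real pi * z))) / (sin (of_real pi * z))\<^sup>2)"
    using DERIV_unique[OF d1] d2 by (simp add: Gamma_reflection_complex)
  then have eq: "(Gamma z * Gamma (1 - z)) * (Digamma z - Digamma (1 - z)) =
     (- (of_real pi * (of_real pi * cos (of_real pi * z))) / (sin (of_real pi * z))\<^sup>2)"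
    by (simp add: algebra_simps)
  then have "Digamma (1 - z) - Digamma z = of_real pi * (cos (of_real pi * z) / sin (of_real pi * z))"
  proof -
    have "b - a = p * (c / s)" if "p / s * (a - b) = - (p * (p * c)) / s\<^sup>2" "p \<noteq> 0" "s \<noteq> 0"
      for a b c p s :: complex
    proof -
      have "p / s * (a - b) = p / s * (- (p * c) / s)" using that by (simp add: power2_eq_square)
      then have "a - b = - (p * c) / s" using that by (simp only: mult_cancel_left) simp
      then show ?thesis by (simp add: algebra_simps)
    qed
    from this[OF eq[unfolded Gamma_reflection_complex]] sin0 show ?thesis by simp
  qed
  then have D: "Digamma (1 - z) - Digamma (z + 1) = of_real pi * (\<i> * ((1 + E) / (1 - E))) - 1 / z"
  proof -
    have "z \<noteq> 0" using zZ by auto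
    then have "Digamma (z + 1) = Digamma z + 1 / z" by (rule Digamma_plus1)
    with \<open>_ = of_real pi * (cos _ / sin _)\<close> show ?thesis unfolding cot by simp
  qed

  have "(\<lambda>n. (inverse (of_nat (Suc n)) - inverse (1 - z + of_nat n)) -
             (inverse (of_nat (Suc n)) - inverse (z + 1 + of_nat n)))
         sums ((Digamma (1 - z) + euler_mascheroni) - (Digamma (z + 1) + euler_mascheroni))"
  proof (intro sums_diff)
    have "1 - z \<noteq> 0" "z + 1 \<noteq> 0" using assms by (auto simp: z_def complex_eq_iff)
    then show "(\<lambda>n. (inverse (of_nat (Suc n)) - inverse (1 - z + of_nat n))) sums (Digamma (1 - z) + euler_mascheroni)"
      "(\<lambda>n. (inverse (of_nat (Suc n)) - inverse (z + 1 + of_nat n))) sums (Digamma (z + 1) + euler_mascheroni)"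
      by (simp_all only: Digamma_def diff_add_cancel) (rule summable_sums[OF summable_Digamma], assumption)+
  qed
  also have "(\<lambda>n. (inverse (of_nat (Suc n)) - inverse (1 - z + of_nat n)) -
             (inverse (of_nat (Suc n)) - inverse (z + 1 + of_nat n))) =
             (\<lambda>n. - 2 * z * of_real (1 / (x\<^sup>2 + (real (Suc n))\<^sup>2)))"
  proof
    fix n :: nat
    define k :: complex where "k = of_nat (Suc n)"
    have k: "k - z \<noteq> 0" "k + z \<noteq> 0" using assms by (auto simp: z_def k_def complex_eq_iff)
    have "inverse (z + 1 + of_nat n) - inverse (1 - z + of_nat n) = inverse (k + z) - inverse (k - z)"
      by (simp add: k_def algebra_simps)
    also have "\<dots> = - 2 * z * (1 / (k\<^sup>2 - z\<^sup>2))"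
    proof -
      have "k\<^sup>2 - z\<^sup>2 = (k - z) * (k + z)" by (simp add: power2_eq_square algebra_simps)
      then show ?thesis using k by (simp add: field_simps)
    qed
    also have "k\<^sup>2 - z\<^sup>2 = of_real (x\<^sup>2 + (real (Suc n))\<^sup>2)"
      by (simp add: k_def z_def power_mult_distrib)
    finally show "(inverse (of_nat (Suc n)) - inverse (1 - z + of_nat n)) -
             (inverse (of_nat (Suc n)) - inverse (z + 1 + of_nat n)) =
             - 2 * z * of_real (1 / (x\<^sup>2 + (real (Suc n))\<^sup>2))"
      by simp
  qed
  finally have "(\<lambda>n. - 2 * z * of_real (1 / (x\<^sup>2 + (real (Suc n))\<^sup>2))) sums
     (of_real pi * (\<i> * ((1 + E) / (1 - E))) - 1 / z)" using D by simp
  then have "(\<lambda>n. (- 2 * z) * of_real (1 / (x\<^sup>2 + (real (Suc n))\<^sup>2)) / (- 2 * z)) sums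
     ((of_real pi * (\<i> * ((1 + E) / (1 - E))) - 1 / z) / (- 2 * z))"
    by (rule sums_divide)
  moreover have "z \<noteq> 0" using assms by (simp add: z_def)
  ultimately have "(\<lambda>n. of_real (1 / (x\<^sup>2 + (real (Suc n))\<^sup>2))) sums
     ((of_real pi * (\<i> * ((1 + E) / (1 - E))) - 1 / z) / (- 2 * z))" by simp
  also have "(of_real pi * (\<i> * ((1 + E) / (1 - E))) - 1 / z) / (- 2 * z) =
     of_real (pi / x * (1 / (exp (2 * pi * x) - 1) + 1 / 2 - 1 / (2 * pi * x)))"
  proof -
    have Er: "of_real (exp (2 * pi * x)) = E" by (simp add: E_def)
    have "E - 1 \<noteq> 0" "1 - E \<noteq> 0" using E by auto
    then show ?thesis using assms
      by (simp only: of_real_mult of_real_divide of_real_add of_real_diff of_real_1 Er z_def of_real_numeral)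
         (simp add: divide_simps, simp add: algebra_simps)
  qed
  finally show ?thesis
    by (simp only: sums_of_real_iff)
qed

text \<open>
  The sum is compared with the integral of the decreasing function \<open>1 / (a\<^sup>2 + v\<^sup>2)\<close>, whose
  antiderivative is \<open>arctan (v / a) / a\<close>.
\<close>

lemma tail_sum_arctan:
  fixes a :: real
  assumes a: "a > 0" and K: "K > 0" and T: "(\<lambda>k. 1 / (a\<^sup>2 + (real (Suc k))\<^sup>2)) sums T"
  defines "R \<equiv> T - (\<Sum>k<K. 1 / (a\<^sup>2 + (real (Suc k))\<^sup>2))"
  shows "R \<le> arctan (a / K) / a" "R \<ge> arctan (a / K) / a - 1 / (real K)\<^sup>2"
proof -
  define A where "A v = arctan (v / a) / a" for v
  have dA: "(A has_real_derivative 1 / (a\<^sup>2 + v\<^sup>2)) (at v)" for v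
  proof -
    have "(A has_real_derivative inverse (1 + (v / a)\<^sup>2) * (1 / a) / a) (at v)"
      unfolding A_def using a by (auto intro!: derivative_eq_intros)
    also have "inverse (1 + (v / a)\<^sup>2) * (1 / a) / a = 1 / (a\<^sup>2 + v\<^sup>2)"
      using a by (simp add: field_simps power2_eq_square add_nonneg_eq_0_iff)
    finally show ?thesis .
  qed
  have step: "1 / (a\<^sup>2 + (v + 1)\<^sup>2) \<le> A (v + 1) - A v \<and> A (v + 1) - A v \<le> 1 / (a\<^sup>2 + v\<^sup>2)" if "v \<ge> 0" for v
  proof -
    obtain \<xi> where \<xi>: "v < \<xi>" "\<xi> < v + 1" "A (v + 1) - A v = (v + 1 - v) * (1 / (a\<^sup>2 + \<xi>\<^sup>2))"
      using MVT2[of v "v + 1" A "\<lambda>v. 1 / (a\<^sup>2 + v\<^sup>2)"] dA by auto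
    have "v\<^sup>2 \<le> \<xi>\<^sup>2" "\<xi>\<^sup>2 \<le> (v + 1)\<^sup>2" using \<xi> that by (auto intro!: power_mono)
    moreover have "a\<^sup>2 > 0" "v\<^sup>2 \<ge> 0" using a by auto
    ultimately show ?thesis unfolding \<xi>(3)
      by (auto intro!: divide_left_mono mult_pos_pos add_pos_nonneg)
  qed
  have limA: "((\<lambda>n. A (real (n + m))) \<longlonglongrightarrow> (pi / 2) / a)" for m
  proof -
    have "filterlim (\<lambda>n. real (n + m) / a) at_top sequentially"
      using a by real_asymp
    from filterlim_compose[OF tendsto_arctan_at_top this]
    show ?thesis unfolding A_def by (intro tendsto_divide tendsto_const) (use a in auto)
  qed
  have tel: "(\<lambda>k. A (real (k + Suc m)) - A (real (k + m))) sums (pi / 2 / a - A (real m))" for m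
    using telescope_sums[OF limA[of m]] by simp
  have Rs: "(\<lambda>k. 1 / (a\<^sup>2 + (real (k + Suc K))\<^sup>2)) sums R"
    using sums_split_initial_segment[OF T, of K] by (simp add: R_def add_ac)
  have AK: "pi / 2 / a - A (real K) = arctan (a / K) / a"
  proof -
    have "arctan (1 / (real K / a)) = pi / 2 - arctan (real K / a)"
      using arctan_inverse[of "real K / a"] a K by (simp add: sgn_if)
    then show ?thesis by (simp add: A_def diff_divide_distrib)
  qed
  have "R \<le> pi / 2 / a - A (real K)"
  proof (rule sums_le[OF _ Rs tel[of K]])
    show "1 / (a\<^sup>2 + (real (k + Suc K))\<^sup>2) \<le> A (real (k + Suc K)) - A (real (k + K))" for k
      using step[of "real (k + K)"] by (simp add: add_ac)
  qed
  then show "R \<le> arctan (a / K) / a" by (simp only: AK)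
  have "pi / 2 / a - A (real (Suc K)) \<le> R"
  proof (rule sums_le[OF _ tel[of "Suc K"] Rs])
    show "A (real (k + Suc (Suc K))) - A (real (k + Suc K)) \<le> 1 / (a\<^sup>2 + (real (k + Suc K))\<^sup>2)" for k
      using step[of "real (k + Suc K)"] by (simp add: add_ac)
  qed
  moreover have "A (real K + 1) - A (real K) \<le> 1 / (a\<^sup>2 + (real K)\<^sup>2)" using step by simp
  moreover have "1 / (a\<^sup>2 + (real K)\<^sup>2) \<le> 1 / (real K)\<^sup>2"
    using K by (intro divide_left_mono) (auto intro!: mult_pos_pos add_nonneg_pos)
  ultimately show "R \<ge> arctan (a / K) / a - 1 / (real K)\<^sup>2"
    using AK by (simp add: add_ac)
qed

lemma riemann_sum_tendsto:
  fixes g :: "real \<Rightarrow> real"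
  assumes "continuous_on {0..1} g"
  shows "(\<lambda>n. (\<Sum>m<n. g (real (Suc m) / n)) / n) \<longlonglongrightarrow> integral {0..1} g"
proof (rule LIMSEQ_I)
  fix e :: real assume "e > 0"
  have "uniformly_continuous_on {0..1} g"
    using assms compact_uniformly_continuous by blast
  from this[unfolded uniformly_continuous_on_def, rule_format, of "e / 2"] \<open>e > 0\<close>
  obtain d where d: "d > 0"
    "\<And>s t. s \<in> {0..1} \<Longrightarrow> t \<in> {0..1} \<Longrightarrow> dist t s < d \<Longrightarrow> dist (g t) (g s) < e / 2"
    by auto
  define G where "G x = integral {0..x} g" for x
  have dG: "(G has_real_derivative g x) (at x within {0..1})" if "x \<in> {0..1}" for x
    unfolding G_def using integral_has_real_derivative[OF assms that] .
  obtain N :: nat where N: "1 / d < real N" using reals_Archimedean2 by blast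
  show "\<exists>no. \<forall>n\<ge>no. norm ((\<Sum>m<n. g (real (Suc m) / n)) / n - integral {0..1} g) < e"
  proof (intro exI allI impI)
    fix n assume "n \<ge> Suc N"
    then have "n > 0" "1 / d < real n" using N by linarith+
    then have n: "n > 0" "1 / real n < d" using d(1) by (auto simp: field_simps)
    have cell: "\<bar>G (real (Suc m) / n) - G (real m / n) - g (real (Suc m) / n) / n\<bar> \<le> e / 2 / n" if "m < n" for m
    proof -
      let ?a = "real m / n" and ?b = "real (Suc m) / n"
      have ab: "?a < ?b" "0 \<le> ?a" "?b \<le> 1" "?b - ?a = 1 / n" using n that by (auto simp: field_simps)
      have "\<exists>\<xi>\<in>{?a<..<?b}. G ?b - G ?a = g \<xi> * (?b - ?a)"
      proof (rule mvt_simple[OF ab(1)])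
        fix x assume "?a \<le> x" "x \<le> ?b"
        moreover have "0 \<le> x" by (rule order_trans[OF ab(2)]) fact
        moreover have "x \<le> 1" by (rule order_trans[OF _ ab(3)]) fact
        moreover have "{?a..?b} \<subseteq> {0..1}" using ab(2,3) by (auto simp only: atLeastatMost_subset_iff)
        ultimately have "x \<in> {0..1}" "{?a..?b} \<subseteq> {0..1}" by auto
        then have "(G has_real_derivative g x) (at x within {?a..?b})"
          by (intro has_field_derivative_subset[OF dG])
        then show "(G has_derivative (*) (g x)) (at x within {?a..?b})"
          by (simp add: has_field_derivative_def)
      qed
      then obtain \<xi> where \<xi>: "?a < \<xi>" "\<xi> < ?b" "G ?b - G ?a = g \<xi> * (?b - ?a)" by auto
      have "dist (g \<xi>) (g ?b) < e / 2"
      proof (rule d(2))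
        have "0 \<le> \<xi>" by (rule order_trans[OF ab(2)]) (use \<xi> in simp)
        moreover have "\<xi> \<le> 1" by (rule order_trans[OF _ ab(3)]) (use \<xi> in simp)
        moreover have "0 \<le> ?b" by (rule order_trans[OF ab(2)]) (use ab in simp)
        ultimately show "?b \<in> {0..1}" "\<xi> \<in> {0..1}" using ab by auto
        show "dist \<xi> ?b < d" using \<xi> ab(4) n unfolding dist_real_def by linarith
      qed
      moreover have "G ?b - G ?a - g ?b / n = (g \<xi> - g ?b) / n"
        using \<xi>(3) ab(4) by (simp add: diff_divide_distrib)
      ultimately show ?thesis
      proof -
        have "\<bar>g \<xi> - g ?b\<bar> / n \<le> e / 2 / n"
          by (rule divide_right_mono) (use \<open>dist (g \<xi>) (g ?b) < e / 2\<close> in \<open>auto simp: dist_real_def\<close>)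
        then show ?thesis unfolding \<open>_ = (g \<xi> - g ?b) / n\<close> by (simp only: abs_divide abs_of_nat)
      qed
    qed
    have "(\<Sum>m<n. G (real (Suc m) / n) - G (real m / n)) = G (real n / n) - G (real 0 / n)"
      by (rule sum_lessThan_telescope)
    then have "integral {0..1} g = (\<Sum>m<n. G (real (Suc m) / n) - G (real m / n))"
      using n by (simp add: G_def)
    then have "norm ((\<Sum>m<n. g (real (Suc m) / n)) / n - integral {0..1} g) =
        \<bar>\<Sum>m<n. G (real (Suc m) / n) - G (real m / n) - g (real (Suc m) / n) / n\<bar>"
      by (simp add: sum_subtractf sum_divide_distrib)
    also have "\<dots> \<le> (\<Sum>m<n. e / 2 / n)"
      by (rule order_trans[OF sum_abs]) (intro sum_mono cell, auto)
    also have "\<dots> < e" using n \<open>e > 0\<close> by simp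
    finally show "norm ((\<Sum>m<n. g (real (Suc m) / n)) / n - integral {0..1} g) < e" .
  qed
qed

lemma sums_swap_nonneg:
  fixes f :: "nat \<Rightarrow> nat \<Rightarrow> real"
  assumes "\<And>m n. f m n \<ge> 0" "\<And>m. f m sums a m" "\<And>n. (\<lambda>m. f m n) sums b n" "a sums A"
  shows "b sums A"
proof -
  have a0: "a m \<ge> 0" for m using assms(1) sums_le[OF _ sums_zero assms(2)] by blast
  have r: "((\<lambda>n. (\<lambda>(m, n). f m n) (m, n)) has_sum a m) UNIV" for m
    using sums_nonneg_imp_has_sum[OF assms(2) assms(1)] by simp
  have A: "(a has_sum A) UNIV" by (rule sums_nonneg_imp_has_sum[OF assms(4) a0])
  then have "(\<lambda>(m, n). f m n) summable_on (UNIV \<times> UNIV)"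
    by (intro summable_on_SigmaI[OF r]) (use assms(1) in \<open>auto simp: summable_on_def\<close>)
  from has_sum_SigmaI[OF r A this] have "((\<lambda>(m, n). f m n) has_sum A) (UNIV \<times> UNIV)" .
  then have "((\<lambda>(n, m). f m n) has_sum A) (UNIV \<times> UNIV)"
    by (subst (asm) has_sum_swap) simp
  then have "(b has_sum A) UNIV"
    by (rule has_sum_SigmaD) (use sums_nonneg_imp_has_sum[OF assms(3) assms(1)] in simp)
  then show ?thesis by (rule has_sum_imp_sums)
qed

text \<open>
  The logarithm of \<open>\<Prod> 1 / (1 - exp (- 2 \<pi> n y))\<close> with the order of summation exchanged, a Lambert series.
\<close>

definition lambert_sum :: "real \<Rightarrow> real" where
  "lambert_sum y = (\<Sum>m. 1 / (real (Suc m) * (exp (2 * pi * real (Suc m) * y) - 1)))"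

lemma log_eta_imaginary_axis:
  assumes y: "y > 0"
  shows "(\<lambda>m. 1 / (real (Suc m) * (exp (2 * pi * real (Suc m) * y) - 1))) sums lambert_sum y"
    and "log_eta (\<i> * of_real y) = of_real (- pi * y / 12 - lambert_sum y)"
proof -
  define x where "x = exp (- 2 * pi * y)"
  have x: "0 < x" "x < 1" using y by (auto simp: x_def)
  have xp: "0 < x ^ Suc n" "x ^ Suc n < 1" for n
    using x power_Suc_less_one[of x n] by (auto simp del: power_Suc)
  have q: "qpow (real (Suc n)) (\<i> * of_real y) = of_real (x ^ Suc n)" for n
  proof -
    have "qpow (real (Suc n)) (\<i> * of_real y) = exp (of_real (real (Suc n) * (- 2 * pi * y)))"
      by (simp add: qpow_def algebra_simps)
    also have "\<dots> = of_real (x ^ Suc n)"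
      unfolding x_def by (simp only: exp_of_real exp_of_nat_mult)
    finally show ?thesis .
  qed
  have Ln: "Ln (1 - qpow (real (Suc n)) (\<i> * of_real y)) = of_real (ln (1 - x ^ Suc n))" for n
  proof -
    have "1 - qpow (real (Suc n)) (\<i> * of_real y) = of_real (1 - x ^ Suc n)" unfolding q by simp
    then show ?thesis using Ln_of_real[of "1 - x ^ Suc n"] xp[of n] by simp
  qed
  have sl: "(\<lambda>n. of_real (ln (1 - x ^ Suc n)) :: complex) sums
      (\<Sum>n. Ln (1 - qpow (real (Suc n)) (\<i> * of_real y)))"
    using summable_sums[OF summable_log_eta[of "\<i> * of_real y"]] y unfolding Ln by simp
  then have "summable (\<lambda>n. ln (1 - x ^ Suc n))"
    by (subst summable_of_real_iff[symmetric]) (rule sums_summable)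
  then obtain S where S: "(\<lambda>n. ln (1 - x ^ Suc n)) sums S" by (auto simp: summable_def)
  have SS: "(\<Sum>n. Ln (1 - qpow (real (Suc n)) (\<i> * of_real y))) = of_real S"
    using sums_unique2[OF sl] S by (simp only: sums_of_real_iff)
  have "(\<lambda>m. 1 / (real (Suc m) * (exp (2 * pi * real (Suc m) * y) - 1))) sums (- S)"
  proof (rule sums_swap_nonneg[where f = "\<lambda>n m. (x ^ Suc n) ^ Suc m / real (Suc m)" and a = "\<lambda>n. - ln (1 - x ^ Suc n)"])
    show "(\<lambda>n. - ln (1 - x ^ Suc n)) sums (- S)" by (rule sums_minus[OF S])
    show "0 \<le> (x ^ Suc n) ^ Suc m / real (Suc m)" for n m using x by simp
    show "(\<lambda>m. (x ^ Suc n) ^ Suc m / real (Suc m)) sums (- ln (1 - x ^ Suc n))" for n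
    proof -
      have "(\<lambda>m. - ((- (- (x ^ Suc n))) ^ m) / of_nat m) sums ln (1 + (- (x ^ Suc n)))"
        by (rule ln_series') (use xp[of n] in simp)
      then have "(\<lambda>m. - ((x ^ Suc n) ^ Suc m) / of_nat (Suc m)) sums ln (1 + (- (x ^ Suc n)))"
        by (subst sums_Suc_iff) simp
      from sums_minus[OF this] show ?thesis by simp
    qed
    show "(\<lambda>n. (x ^ Suc n) ^ Suc m / real (Suc m)) sums
      (1 / (real (Suc m) * (exp (2 * pi * real (Suc m) * y) - 1)))" for m
    proof -
      define z where "z = x ^ Suc m"
      have "(\<lambda>n. z * z ^ n / real (Suc m)) sums (z * (1 / (1 - z)) / real (Suc m))"
        by (intro sums_divide sums_mult geometric_sums) (use xp[of m] in \<open>simp add: z_def\<close>)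
      moreover have "z * z ^ n = (x ^ Suc n) ^ Suc m" for n
        unfolding z_def by (metis mult.commute power_Suc power_mult)
      moreover have "exp (2 * pi * real (Suc m) * y) = 1 / z"
        unfolding z_def x_def
        by (simp only: exp_of_nat_mult[symmetric]) (simp add: exp_minus field_simps flip: exp_add)
      moreover have "z > 0" "z < 1" using xp[of m] by (auto simp: z_def)
      moreover from this have "z * (1 / (1 - z)) / real (Suc m) = 1 / (real (Suc m) * (1 / z - 1))"
        by (simp add: field_simps del: of_nat_Suc)
      ultimately show ?thesis by (simp only:)
    qed
  qed
  moreover from this have "lambert_sum y = - S" by (simp add: lambert_sum_def sums_iff)
  ultimately show "(\<lambda>m. 1 / (real (Suc m) * (exp (2 * pi * real (Suc m) * y) - 1))) sums lambert_sum y"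
    "log_eta (\<i> * of_real y) = of_real (- pi * y / 12 - lambert_sum y)"
    by (simp_all only: log_eta_def SS) simp
qed

text \<open>
  Two sums over the sides of a rectangle are compared by removing from both the double sum over the
  rectangle; only the tails remain.
\<close>

lemma square_difference_tails:
  fixes f :: "nat \<Rightarrow> nat \<Rightarrow> real"
  shows "(\<Sum>m<M. a m) - (\<Sum>k<K. b k) =
    (\<Sum>m<M. a m - (\<Sum>k<K. f m k)) - (\<Sum>k<K. b k - (\<Sum>m<M. f m k))"
  using sum.swap[of f "{..<K}" "{..<M}"] by (simp add: sum_subtractf)

text \<open>
  By the expansion of \<open>coth\<close>, the essential part of \<open>lambert_sum y\<close> is, up to the factor \<open>1 / \<pi>\<close>, the double sum of
  \<open>y / (m\<^sup>2 y\<^sup>2 + k\<^sup>2)\<close> over \<open>m, k \<ge> 1\<close>, an expression that is unchanged if \<open>y\<close> is replaced by \<open>1 / y\<close> and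
  the two indices are exchanged. The double sum diverges, so it is cut off at \<open>m \<le> q N\<close> and \<open>k \<le> p N\<close>.
  On both sides the same rectangle cancels. The remaining tails are up to \<open>o(1)\<close> Riemann sums of
  \<open>arctan t / t\<close> with the same limit, so they cancel as well. The harmonic sums of the two lengths
  contribute \<open>ln y / 2\<close>, and the sums of inverse squares give the terms in \<open>y\<close> and \<open>1 / y\<close>.
\<close>

lemma lambert_sum_inversion_rational:
  fixes p q :: nat
  assumes pq: "p > 0" "q > 0"
  defines "y \<equiv> real p / real q"
  shows "lambert_sum y - lambert_sum (1 / y) = ln y / 2 + pi / 12 * (1 / y - y)"
proof -
  have y: "y > 0" using pq by (simp add: y_def)
  define L where "L z m = 1 / (real (Suc m) * (exp (2 * pi * real (Suc m) * z) - 1))" for z :: real and m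
  define T where "T x = pi / x * (1 / (exp (2 * pi * x) - 1) + 1 / 2 - 1 / (2 * pi * x))" for x :: real
  have T: "(\<lambda>k. 1 / (x\<^sup>2 + (real (Suc k))\<^sup>2)) sums T x" if "x > 0" for x
    unfolding T_def by (rule coth_partial_fractions[OF that])
  have LT: "L z m = - (1/2) * inverse (real (Suc m)) + 1 / (2 * pi * z) * (1 / (real m + 1)\<^sup>2)
                + z / pi * T (real (Suc m) * z)" if "z > 0" for z m
  proof -
    define s where "s = real (Suc m)"
    have s: "s > 0" "real m + 1 = s" by (auto simp: s_def)
    define e where "e = exp (2 * pi * (s * z)) - 1"
    have e: "e > 0" using s that by (simp add: e_def)
    have 1: "L z m = 1 / (s * e)" by (simp add: L_def e_def s_def mult_ac)
    have 2: "T (s * z) = pi / (s * z) * (1 / e + 1 / 2 - 1 / (2 * pi * (s * z)))"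
      by (simp add: T_def e_def)
    show ?thesis unfolding 1 s_def[symmetric] s(2) 2 using that s e
      by (simp add: field_simps power2_eq_square)
  qed
  have partial: "(\<Sum>m<n. L z m) = - (1/2) * harm n + 1 / (2 * pi * z) * (\<Sum>m<n. 1 / (real m + 1)\<^sup>2)
                + z / pi * (\<Sum>m<n. T (real (Suc m) * z))" if "z > 0" for z n
  proof -
    have "(\<Sum>m<n. inverse (real (Suc m))) = harm n"
      by (simp add: harm_def sum.atLeast1_atMost_eq)
    moreover have "(\<Sum>m<n. L z m) = - (1/2) * (\<Sum>m<n. inverse (real (Suc m))) +
       1 / (2 * pi * z) * (\<Sum>m<n. 1 / (real m + 1)\<^sup>2) + z / pi * (\<Sum>m<n. T (real (Suc m) * z))"
      unfolding LT[OF that] sum.distrib sum_distrib_left by simp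
    ultimately show ?thesis by simp
  qed
  \<comment> \<open>The tails turn out to be Riemann sums of \<open>arctan t / t\<close>, whose value at \<open>0\<close> is its limit.\<close>
  define g where "g t = (if t = 0 then 1 else arctan t / t)" for t :: real
  have contg: "continuous_on {0..1} g"
  proof -
    have "isCont g t" for t
    proof (cases "t = 0")
      case True
      have "((\<lambda>t. arctan t / t) \<longlongrightarrow> 1) (at 0)"
        using DERIV_arctan[of 0] by (simp add: DERIV_def)
      then have "(g \<longlongrightarrow> 1) (at 0)"
        by (rule Lim_transform_eventually) (auto simp: g_def eventually_at_filter)
      then show ?thesis using True by (simp add: isCont_def g_def)
    next
      case False
      have "isCont (\<lambda>t. arctan t / t) t" using False by (intro continuous_intros) auto
      moreover have "\<forall>\<^sub>F s in nhds t. g s = arctan s / s"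
        using t1_space_nhds[OF False] by eventually_elim (simp add: g_def)
      ultimately show ?thesis using isCont_cong[of g "\<lambda>s. arctan s / s" t] by simp
    qed
    then show ?thesis by (simp add: continuous_at_imp_continuous_on)
  qed
  define R where "R n = (\<Sum>m<n. g (real (Suc m) / n)) / n" for n :: nat
  obtain l where R: "R \<longlonglongrightarrow> l" using riemann_sum_tendsto[OF contg] unfolding R_def by blast

  \<comment> \<open>Cut-offs with \<open>M y = K\<close>: both tails then involve the same function \<open>g\<close>.\<close>
  define M where "M N = q * Suc N" for N
  define K where "K N = p * Suc N" for N
  have MK0: "M N > 0" "K N > 0" for N using pq by (auto simp: M_def K_def)
  have MK: "real (M N) * y = real (K N)" for N using pq by (simp only: M_def K_def y_def of_nat_mult) (simp add: field_simps)
  have limM: "filterlim M sequentially sequentially" and limK: "filterlim K sequentially sequentially"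
    unfolding M_def K_def using pq
    by (auto intro!: filterlim_subseq simp: strict_mono_def)

  define A where "A N = (\<Sum>m<M N. T (real (Suc m) * y) - (\<Sum>k<K N. 1 / ((real (Suc m) * y)\<^sup>2 + (real (Suc k))\<^sup>2)))" for N
  define B where "B N = (\<Sum>k<K N. T (real (Suc k) * (1 / y)) / y\<^sup>2 - (\<Sum>m<M N. 1 / ((real (Suc m) * y)\<^sup>2 + (real (Suc k))\<^sup>2)))" for N
  have A_lim: "(\<lambda>N. A N) \<longlonglongrightarrow> l / y"
  proof -
    have bnd: "\<bar>A N - R (M N) / y\<bar> \<le> real (M N) / (real (K N))\<^sup>2" for N
    proof -
      have "R (M N) / y = (\<Sum>m<M N. arctan (real (Suc m) * y / K N) / (real (Suc m) * y))"
        unfolding R_def sum_divide_distrib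
      proof (intro sum.cong refl)
        fix m
        have "real (Suc m) * y / K N = real (Suc m) / M N"
          using y MK0[of N] by (simp add: MK[symmetric])
        then show "g (real (Suc m) / real (M N)) / real (M N) / y = arctan (real (Suc m) * y / K N) / (real (Suc m) * y)"
          using y MK0[of N] by (simp add: g_def del: of_nat_Suc)
      qed
      then have eq: "A N - R (M N) / y = (\<Sum>m<M N. T (real (Suc m) * y) - (\<Sum>k<K N. 1 / ((real (Suc m) * y)\<^sup>2 + (real (Suc k))\<^sup>2))
         - arctan (real (Suc m) * y / K N) / (real (Suc m) * y))"
        by (simp add: A_def sum_subtractf)
      have "\<bar>A N - R (M N) / y\<bar> \<le> (\<Sum>m<M N. 1 / (real (K N))\<^sup>2)"
        unfolding eq
      proof (rule order_trans[OF sum_abs], rule sum_mono)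
        fix m
        have a: "real (Suc m) * y > 0" using y by simp
        show "\<bar>T (real (Suc m) * y) - (\<Sum>k<K N. 1 / ((real (Suc m) * y)\<^sup>2 + (real (Suc k))\<^sup>2))
         - arctan (real (Suc m) * y / K N) / (real (Suc m) * y)\<bar> \<le> 1 / (real (K N))\<^sup>2"
          using tail_sum_arctan[OF a MK0(2) T[OF a], of N] by (simp only: abs_le_iff) auto
      qed
      then show ?thesis by simp
    qed
    have "(\<lambda>N. real (M N) / (real (K N))\<^sup>2) \<longlonglongrightarrow> 0"
      unfolding M_def K_def using pq by real_asymp
    then have "(\<lambda>N. A N - R (M N) / y) \<longlonglongrightarrow> 0"
      by (rule Lim_null_comparison[rotated]) (use bnd in auto)
    moreover have "(\<lambda>N. R (M N) / y) \<longlonglongrightarrow> l / y"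
      by (intro tendsto_divide tendsto_const filterlim_compose[OF R limM]) (use y in auto)
    ultimately show ?thesis using tendsto_add by fastforce
  qed
  have B_lim: "(\<lambda>N. B N) \<longlonglongrightarrow> l / y"
  proof -
    have bnd: "\<bar>B N - R (K N) / y\<bar> \<le> real (K N) / (real (M N))\<^sup>2 / y\<^sup>2" for N
    proof -
      have "R (K N) / y = (\<Sum>k<K N. arctan (real (Suc k) * (1 / y) / M N) / (real (Suc k) * (1 / y)) / y\<^sup>2)"
        unfolding R_def sum_divide_distrib
      proof (intro sum.cong refl)
        fix k
        have "real (Suc k) * (1 / y) / M N = real (Suc k) / K N"
          using y MK0[of N] by (simp add: MK[symmetric] field_simps)
        then show "g (real (Suc k) / real (K N)) / real (K N) / y = arctan (real (Suc k) * (1 / y) / M N) / (real (Suc k) * (1 / y)) / y\<^sup>2"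
          using y MK0[of N] by (simp add: g_def power2_eq_square del: of_nat_Suc)
      qed
      then have eq: "B N - R (K N) / y = (\<Sum>k<K N. (T (real (Suc k) * (1 / y)) - (\<Sum>m<M N. 1 / ((real (Suc k) * (1 / y))\<^sup>2 + (real (Suc m))\<^sup>2))
         - arctan (real (Suc k) * (1 / y) / M N) / (real (Suc k) * (1 / y))) / y\<^sup>2)"
      proof -
        have "1 / ((real (Suc m) * y)\<^sup>2 + (real (Suc k))\<^sup>2) = 1 / ((real (Suc k) * (1 / y))\<^sup>2 + (real (Suc m))\<^sup>2) / y\<^sup>2" for m k
        proof -
          have "((real (Suc k) * (1 / y))\<^sup>2 + (real (Suc m))\<^sup>2) * y\<^sup>2 = (real (Suc m) * y)\<^sup>2 + (real (Suc k))\<^sup>2"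
            using y by (simp add: distrib_right power_mult_distrib power_divide del: of_nat_Suc)
          then show ?thesis by (simp only: divide_divide_eq_left)
        qed
        with \<open>R (K N) / y = _\<close> show ?thesis
          unfolding B_def by (simp only: diff_divide_distrib sum_subtractf sum_divide_distrib)
      qed
      have "\<bar>B N - R (K N) / y\<bar> \<le> (\<Sum>k<K N. 1 / (real (M N))\<^sup>2 / y\<^sup>2)"
        unfolding eq
      proof (rule order_trans[OF sum_abs], rule sum_mono)
        fix k
        have a: "real (Suc k) * (1 / y) > 0" using y by simp
        have "\<bar>T (real (Suc k) * (1 / y)) - (\<Sum>m<M N. 1 / ((real (Suc k) * (1 / y))\<^sup>2 + (real (Suc m))\<^sup>2))
         - arctan (real (Suc k) * (1 / y) / M N) / (real (Suc k) * (1 / y))\<bar> \<le> 1 / (real (M N))\<^sup>2"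
          using tail_sum_arctan[OF a MK0(1) T[OF a], of N] by (simp only: abs_le_iff) auto
        then show "\<bar>(T (real (Suc k) * (1 / y)) - (\<Sum>m<M N. 1 / ((real (Suc k) * (1 / y))\<^sup>2 + (real (Suc m))\<^sup>2))
         - arctan (real (Suc k) * (1 / y) / M N) / (real (Suc k) * (1 / y))) / y\<^sup>2\<bar> \<le> 1 / (real (M N))\<^sup>2 / y\<^sup>2"
          by (simp only: abs_divide abs_power2 divide_right_mono zero_le_power2)
      qed
      also have "(\<Sum>k<K N. 1 / (real (M N))\<^sup>2 / y\<^sup>2) = real (K N) / (real (M N))\<^sup>2 / y\<^sup>2"
        by (simp only: sum_constant card_lessThan) (simp only: times_divide_eq_right mult_1_right)
      finally show ?thesis .
    qed
    have "(\<lambda>N. real (K N) / (real (M N))\<^sup>2) \<longlonglongrightarrow> 0"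
      unfolding M_def K_def using pq by real_asymp
    then have "(\<lambda>N. real (K N) / (real (M N))\<^sup>2 / y\<^sup>2) \<longlonglongrightarrow> 0"
      by (rule tendsto_divide_zero)
    then have "(\<lambda>N. B N - R (K N) / y) \<longlonglongrightarrow> 0"
      by (rule Lim_null_comparison[rotated]) (use bnd in auto)
    moreover have "(\<lambda>N. R (K N) / y) \<longlonglongrightarrow> l / y"
      by (intro tendsto_divide tendsto_const filterlim_compose[OF R limK]) (use y in auto)
    ultimately show ?thesis using tendsto_add by fastforce
  qed
  have H_lim: "(\<lambda>N. harm (M N) - harm (K N)) \<longlonglongrightarrow> - ln y"
  proof -
    have "(\<lambda>N. (harm (M N) - ln (real (M N))) - (harm (K N) - ln (real (K N)))) \<longlonglongrightarrow> euler_mascheroni - euler_mascheroni"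
      by (intro tendsto_diff filterlim_compose[OF euler_mascheroni_LIMSEQ limM] filterlim_compose[OF euler_mascheroni_LIMSEQ limK])
    moreover have "(harm (M N) - ln (real (M N))) - (harm (K N) - ln (real (K N))) = harm (M N) - harm (K N) + ln y" for N
    proof -
      have "ln (real (K N)) = ln (real (M N)) + ln y"
        using ln_mult[of "real (M N)" y] MK[of N] MK0[of N] y by simp
      then show ?thesis by simp
    qed
    ultimately have "(\<lambda>N. harm (M N) - harm (K N) + ln y) \<longlonglongrightarrow> (0::real)" by simp
    from tendsto_diff[OF this tendsto_const[of "ln y"]] show ?thesis by simp
  qed
  have Z: "(\<lambda>n. \<Sum>m<n. 1 / (real m + 1)\<^sup>2) \<longlonglongrightarrow> pi\<^sup>2 / 6"
    using inverse_squares_sums by (simp add: sums_def add_ac)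
  have L_lim: "(\<lambda>n. \<Sum>m<n. L z m) \<longlonglongrightarrow> lambert_sum z" if "z > 0" for z
    using log_eta_imaginary_axis(1)[OF that] by (simp add: L_def sums_def)
  have "(\<lambda>N. (\<Sum>m<M N. L y m) - (\<Sum>m<K N. L (1 / y) m)) \<longlonglongrightarrow> lambert_sum y - lambert_sum (1 / y)"
    by (intro tendsto_diff filterlim_compose[OF L_lim limM] filterlim_compose[OF L_lim limK]) (use y in auto)
  moreover have "(\<lambda>N. (\<Sum>m<M N. L y m) - (\<Sum>m<K N. L (1 / y) m)) \<longlonglongrightarrow>
      - (1/2) * (- ln y) + 1 / (2 * pi * y) * (pi\<^sup>2 / 6) - 1 / (2 * pi * (1 / y)) * (pi\<^sup>2 / 6) + y / pi * (l / y - l / y)"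
  proof -
    have "(\<Sum>m<M N. L y m) - (\<Sum>m<K N. L (1 / y) m) =
      - (1/2) * (harm (M N) - harm (K N)) + 1 / (2 * pi * y) * (\<Sum>m<M N. 1 / (real m + 1)\<^sup>2)
       - 1 / (2 * pi * (1 / y)) * (\<Sum>m<K N. 1 / (real m + 1)\<^sup>2) + y / pi * (A N - B N)" for N
    proof -
      have "A N - B N = (\<Sum>m<M N. T (real (Suc m) * y)) - (\<Sum>k<K N. T (real (Suc k) * (1 / y)) / y\<^sup>2)"
        unfolding A_def B_def by (rule square_difference_tails[symmetric])
      then have "y / pi * (A N - B N) = y / pi * (\<Sum>m<M N. T (real (Suc m) * y)) -
          (1 / y) / pi * (\<Sum>k<K N. T (real (Suc k) * (1 / y)))"
        using y by (simp add: right_diff_distrib power2_eq_square flip: sum_divide_distrib)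
      moreover have "1 / y > 0" using y by simp
      ultimately show ?thesis unfolding partial[OF y] partial[OF \<open>1 / y > 0\<close>] by (simp add: algebra_simps)
    qed
    then show ?thesis
      by (simp only:) (intro tendsto_intros H_lim A_lim B_lim filterlim_compose[OF Z limM] filterlim_compose[OF Z limK])
  qed
  ultimately have "lambert_sum y - lambert_sum (1 / y) =
      - (1/2) * (- ln y) + 1 / (2 * pi * y) * (pi\<^sup>2 / 6) - 1 / (2 * pi * (1 / y)) * (pi\<^sup>2 / 6) + y / pi * (l / y - l / y)"
    by (rule LIMSEQ_unique)
  also have "\<dots> = ln y / 2 + pi / 12 * (1 / y - y)"
    using y by (simp add: field_simps power2_eq_square)
  finally show ?thesis .
qed

text \<open>
  Both sides are holomorphic, so it suffices to have equality at points that accumulate in the half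
  plane. On the imaginary axis at rational height it is the inversion formula for the Lambert sum.
\<close>

theorem log_eta_inversion:
  assumes "Im \<tau> > 0"
  shows "log_eta (- 1 / \<tau>) = log_eta \<tau> + Ln (- \<i> * \<tau>) / 2"
proof -
  define D where "D \<tau> = log_eta (- 1 / \<tau>) - log_eta \<tau> - Ln (- \<i> * \<tau>) / 2" for \<tau>
  have "(\<lambda>\<tau>. - 1 / \<tau>) holomorphic_on \<H>"
    by (intro holomorphic_intros) auto
  moreover have "Im (- 1 / \<tau>) > 0" if "Im \<tau> > 0" for \<tau>
    using that by (simp add: Im_divide sum_power2_gt_zero_iff)
  ultimately have "(log_eta \<circ> (\<lambda>\<tau>. - 1 / \<tau>)) holomorphic_on \<H>"
    by (intro holomorphic_on_compose_gen[OF _ holomorphic_log_eta]) auto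
  moreover have "(\<lambda>\<tau>. Ln (- \<i> * \<tau>)) holomorphic_on \<H>"
    by (intro holomorphic_on_Ln' holomorphic_intros) (auto simp: complex_nonpos_Reals_iff)
  ultimately have hol: "D holomorphic_on \<H>"
    unfolding D_def using holomorphic_log_eta
    by (intro holomorphic_on_diff holomorphic_on_divide holomorphic_on_const) (auto simp: o_def)
  \<comment> \<open>Zeros of \<open>D\<close> at imaginary points of rational height that accumulate at \<open>i\<close>.\<close>
  define r where "r n = \<i> * of_real (real (n + 2) / real (n + 1))" for n :: nat
  have zero: "D (r n) = 0" for n
  proof -
    define y where "y = real (n + 2) / real (n + 1)"
    have y: "y > 0" by (simp add: y_def)
    have "- 1 / (\<i> * complex_of_real y) = \<i> * of_real (1 / y)"
      using y by (simp add: field_simps)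
    moreover have "- \<i> * (\<i> * of_real y) = of_real y" by simp
    ultimately have "D (\<i> * of_real y) = log_eta (\<i> * of_real (1 / y)) - log_eta (\<i> * of_real y) - of_real (ln y) / 2"
      unfolding D_def using y by (simp only: Ln_of_real)
    also have "\<dots> = of_real ((- pi * (1 / y) / 12 - lambert_sum (1 / y)) - (- pi * y / 12 - lambert_sum y) - ln y / 2)"
      using log_eta_imaginary_axis(2)[of y] log_eta_imaginary_axis(2)[of "1 / y"] y by simp
    also have "\<dots> = 0"
      using lambert_sum_inversion_rational[of "n + 2" "n + 1"] unfolding y_def[symmetric] by (simp add: field_simps)
    finally show ?thesis by (simp add: r_def y_def)
  qed
  have "r \<longlonglongrightarrow> \<i> * of_real 1"
    unfolding r_def by (intro tendsto_intros) real_asymp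
  moreover have "r n \<noteq> \<i>" for n by (simp add: r_def complex_eq_iff)
  ultimately have "\<i> islimpt range r"
    unfolding islimpt_sequential by (intro exI[of _ r]) auto
  then have "D \<tau> = 0"
    by (rule analytic_continuation[OF hol open_upper_half_plane connected_upper_half_plane, rotated 2])
       (use assms zero in \<open>auto simp: r_def\<close>)
  then show ?thesis by (simp add: D_def algebra_simps)
qed

section \<open>Integral matrices and their action\<close>

definition mat22 :: "int \<Rightarrow> int \<Rightarrow> int \<Rightarrow> int \<Rightarrow> mat2" where
  "mat22 a b c d = vector [vector [a, b], vector [c, d]]"

lemma mat22_nth [simp]:
  "mat22 a b c d $ 1 $ 1 = a" "mat22 a b c d $ 1 $ 2 = b"
  "mat22 a b c d $ 2 $ 1 = c" "mat22 a b c d $ 2 $ 2 = d"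
  by (simp_all add: mat22_def)

lemma mat2_eqI:
  fixes \<gamma> \<delta> :: mat2
  assumes "\<gamma>$1$1 = \<delta>$1$1" "\<gamma>$1$2 = \<delta>$1$2" "\<gamma>$2$1 = \<delta>$2$1" "\<gamma>$2$2 = \<delta>$2$2"
  shows "\<gamma> = \<delta>"
  using assms by (simp add: vec_eq_iff forall_2)

lemma mat22_collapse: "mat22 (\<gamma>$1$1) (\<gamma>$1$2) (\<gamma>$2$1) (\<gamma>$2$2) = \<gamma>"
  by (rule mat2_eqI) simp_all

lemma mat2_mult_nth:
  fixes \<gamma> \<delta> :: mat2
  shows "(\<gamma> ** \<delta>)$1$1 = \<gamma>$1$1 * \<delta>$1$1 + \<gamma>$1$2 * \<delta>$2$1"
    "(\<gamma> ** \<delta>)$1$2 = \<gamma>$1$1 * \<delta>$1$2 + \<gamma>$1$2 * \<delta>$2$2"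
    "(\<gamma> ** \<delta>)$2$1 = \<gamma>$2$1 * \<delta>$1$1 + \<gamma>$2$2 * \<delta>$2$1"
    "(\<gamma> ** \<delta>)$2$2 = \<gamma>$2$1 * \<delta>$1$2 + \<gamma>$2$2 * \<delta>$2$2"
  by (simp_all add: matrix_matrix_mult_def sum_2)

lemma SL2Z_iff: "\<gamma> \<in> SL2Z \<longleftrightarrow> \<gamma>$1$1 * \<gamma>$2$2 - \<gamma>$1$2 * \<gamma>$2$1 = 1"
  by (simp add: SL2Z_def det_2)

lemma SL2Z_mult: "\<gamma> \<in> SL2Z \<Longrightarrow> \<delta> \<in> SL2Z \<Longrightarrow> \<gamma> ** \<delta> \<in> SL2Z"
  by (simp add: SL2Z_def det_mul)

text \<open>
  The inverse on determinant one, with integral entries.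
\<close>

definition adjugate :: "mat2 \<Rightarrow> mat2" where
  "adjugate \<gamma> = mat22 (\<gamma>$2$2) (- \<gamma>$1$2) (- \<gamma>$2$1) (\<gamma>$1$1)"

lemma adjugate_nth [simp]:
  "adjugate \<gamma> $ 1 $ 1 = \<gamma>$2$2" "adjugate \<gamma> $ 1 $ 2 = - \<gamma>$1$2"
  "adjugate \<gamma> $ 2 $ 1 = - \<gamma>$2$1" "adjugate \<gamma> $ 2 $ 2 = \<gamma>$1$1"
  by (simp_all add: adjugate_def)

lemma adjugate_SL2Z: "\<gamma> \<in> SL2Z \<Longrightarrow> adjugate \<gamma> \<in> SL2Z"
  by (simp add: SL2Z_iff algebra_simps)

lemma adjugate_right: "\<gamma> \<in> SL2Z \<Longrightarrow> \<gamma> ** adjugate \<gamma> = mat 1"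
  and adjugate_left: "\<gamma> \<in> SL2Z \<Longrightarrow> adjugate \<gamma> ** \<gamma> = mat 1"
  by (auto intro!: mat2_eqI simp: mat2_mult_nth SL2Z_iff mat_def algebra_simps)

lemma mult_adjugate_cancel: "\<gamma> \<in> SL2Z \<Longrightarrow> (\<delta> ** adjugate \<gamma>) ** \<gamma> = \<delta>"
  by (metis adjugate_left matrix_mul_assoc matrix_mul_rid)

lemma denom_nonzero:
  assumes "\<gamma> \<in> SL2Z" "Im \<tau> > 0"
  shows "denom \<gamma> \<tau> \<noteq> 0"
proof
  assume 0: "denom \<gamma> \<tau> = 0"
  then have "of_int (\<gamma>$2$1) * Im \<tau> = (0::real)" by (simp add: denom_def complex_eq_iff)
  then have c: "\<gamma>$2$1 = 0" using assms by simp
  with 0 have "\<gamma>$2$2 = 0" by (simp add: denom_def)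
  with c assms show False by (simp add: SL2Z_iff)
qed

lemma act_conv: "act \<gamma> \<tau> = (of_int (\<gamma>$1$1) * \<tau> + of_int (\<gamma>$1$2)) / denom \<gamma> \<tau>"
  by (simp add: act_def denom_def)

lemma Im_act:
  assumes "\<gamma> \<in> SL2Z" "Im \<tau> > 0"
  shows "Im (act \<gamma> \<tau>) = Im \<tau> / (norm (denom \<gamma> \<tau>))\<^sup>2"
proof -
  have "of_int (\<gamma>$1$1) * of_int (\<gamma>$2$2) - of_int (\<gamma>$1$2) * of_int (\<gamma>$2$1) = (1::real)"
    using assms(1) unfolding SL2Z_iff of_int_mult[symmetric] of_int_diff[symmetric] by simp
  then have "Im \<tau> = (of_int (\<gamma>$1$1) * of_int (\<gamma>$2$2) - of_int (\<gamma>$1$2) * of_int (\<gamma>$2$1)) * Im \<tau>" by simp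
  also have "\<dots> = Im (of_int (\<gamma>$1$1) * \<tau> + of_int (\<gamma>$1$2)) * Re (denom \<gamma> \<tau>) -
      Re (of_int (\<gamma>$1$1) * \<tau> + of_int (\<gamma>$1$2)) * Im (denom \<gamma> \<tau>)"
    by (simp add: denom_def algebra_simps)
  finally show ?thesis
    unfolding act_conv Im_divide cmod_power2 by simp
qed

lemma act_in_upper_half_plane:
  assumes "\<gamma> \<in> SL2Z" "Im \<tau> > 0"
  shows "Im (act \<gamma> \<tau>) > 0"
  using denom_nonzero[OF assms] assms by (simp add: Im_act)

lemma denom_mult:
  assumes "\<delta> \<in> SL2Z" "Im \<tau> > 0"
  shows "denom (\<gamma> ** \<delta>) \<tau> = denom \<gamma> (act \<delta> \<tau>) * denom \<delta> \<tau>"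
proof -
  have "denom \<gamma> (act \<delta> \<tau>) * denom \<delta> \<tau> =
     of_int (\<gamma>$2$1) * (act \<delta> \<tau> * denom \<delta> \<tau>) + of_int (\<gamma>$2$2) * denom \<delta> \<tau>"
    by (simp add: denom_def[of \<gamma>] algebra_simps)
  also have "act \<delta> \<tau> * denom \<delta> \<tau> = of_int (\<delta>$1$1) * \<tau> + of_int (\<delta>$1$2)"
    using denom_nonzero[OF assms] by (simp add: act_conv)
  finally show ?thesis by (simp add: denom_def mat2_mult_nth algebra_simps)
qed

lemma act_mult:
  assumes "\<gamma> \<in> SL2Z" "\<delta> \<in> SL2Z" "Im \<tau> > 0"
  shows "act (\<gamma> ** \<delta>) \<tau> = act \<gamma> (act \<delta> \<tau>)"
proof -
  have "(of_int (\<gamma>$1$1) * act \<delta> \<tau> + of_int (\<gamma>$1$2)) * denom \<delta> \<tau> =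
     of_int (\<gamma>$1$1) * (act \<delta> \<tau> * denom \<delta> \<tau>) + of_int (\<gamma>$1$2) * denom \<delta> \<tau>"
    by (simp add: algebra_simps)
  also have "act \<delta> \<tau> * denom \<delta> \<tau> = of_int (\<delta>$1$1) * \<tau> + of_int (\<delta>$1$2)"
    using denom_nonzero[OF assms(2,3)] by (simp add: act_conv)
  finally have "(of_int (\<gamma>$1$1) * act \<delta> \<tau> + of_int (\<gamma>$1$2)) * denom \<delta> \<tau> =
     of_int ((\<gamma> ** \<delta>)$1$1) * \<tau> + of_int ((\<gamma> ** \<delta>)$1$2)"
    by (simp add: denom_def mat2_mult_nth algebra_simps)
  then show ?thesis
    using denom_nonzero[OF assms(2,3)]
    unfolding act_conv[of "\<gamma> ** \<delta>"] act_conv[of \<gamma>] denom_mult[OF assms(2,3)]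
    by (metis nonzero_mult_divide_mult_cancel_right)
qed

lemma mat_1_SL2Z [simp]: "mat 1 \<in> SL2Z"
  by (simp add: SL2Z_def)

lemma mat_1_nth [simp]:
  "(mat 1 :: mat2)$1$1 = 1" "(mat 1 :: mat2)$1$2 = 0" "(mat 1 :: mat2)$2$1 = 0" "(mat 1 :: mat2)$2$2 = 1"
  by (simp_all add: mat_def)

lemma act_mat_1 [simp]: "act (mat 1) \<tau> = \<tau>" and denom_mat_1 [simp]: "denom (mat 1) \<tau> = 1"
  by (simp_all add: act_def denom_def)

section \<open>Generation of the modular group and of the congruence subgroup of level three\<close>

lemma int_translate_induct:
  fixes Q :: "int \<Rightarrow> bool"
  assumes "Q 0" "\<And>n. Q n \<Longrightarrow> Q (n + 1)" "\<And>n. Q n \<Longrightarrow> Q (n - 1)"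
  shows "Q n"
  by (induction n rule: int_induct[of _ 0]) (use assms in auto)

text \<open>
  Generation by \<open>T\<close> and \<open>S\<close>, in the form of an induction on the entries: right multiplication by
  these matrices performs the Euclidean algorithm on the lower row.
\<close>

lemma SL2Z_entries_induct:
  fixes Q :: "int \<Rightarrow> int \<Rightarrow> int \<Rightarrow> int \<Rightarrow> bool"
  assumes det: "a * d - b * c = 1" and one: "Q 1 0 0 1"
    and T: "\<And>a b c d. a * d - b * c = 1 \<Longrightarrow> Q a b c d \<Longrightarrow> Q a (b + a) c (d + c)"
    and T': "\<And>a b c d. a * d - b * c = 1 \<Longrightarrow> Q a b c d \<Longrightarrow> Q a (b - a) c (d - c)"
    and S: "\<And>a b c d. a * d - b * c = 1 \<Longrightarrow> Q a b c d \<Longrightarrow> Q b (- a) d (- c)"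
  shows "Q a b c d"
  using det
proof (induction "nat \<bar>c\<bar>" arbitrary: a b c d rule: less_induct)
  case less
  have Tn: "Q a (b + n * a) c (d + n * c)" if "a * d - b * c = 1" "Q a b c d" for a b c d n
  proof (induction n rule: int_translate_induct)
    case (2 n)
    have "a * (d + n * c) - (b + n * a) * c = 1" using that by (simp add: algebra_simps)
    from T[OF this 2] show ?case by (simp add: algebra_simps)
  next
    case (3 n)
    have "a * (d + n * c) - (b + n * a) * c = 1" using that by (simp add: algebra_simps)
    from T'[OF this 3] show ?case by (simp add: algebra_simps)
  qed (use that in simp)
  show ?case
  proof (cases "c = 0")
    case True
    then have "a * d = 1" using less.prems by simp
    then consider "a = 1" "d = 1" | "a = -1" "d = -1" using zmult_eq_1_iff by auto
    then show ?thesis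
    proof cases
      case 1
      then show ?thesis using Tn[of 1 1 0 0 b] one True by simp
    next
      case 2
      have "Q (-1) 0 0 (-1)" using S[of 0 0 "-1" 1] S[of 1 1 0 0] one by simp
      then show ?thesis using Tn[of "-1" "-1" 0 0 "-b"] 2 True by simp
    qed
  next
    case False
    \<comment> \<open>A translation replaces \<open>d\<close> by \<open>d mod c\<close>, and the inversion makes that the new lower left entry.\<close>
    define n where "n = d div c"
    have d: "d = d mod c + n * c" by (simp add: n_def)
    have lt: "nat \<bar>- (d mod c)\<bar> < nat \<bar>c\<bar>" using False abs_mod_less[of c d] by simp
    have det: "(- (b - n * a)) * c - a * (- (d mod c)) = 1"
    proof -
      have m: "d mod c = d - n * c" using d by simp
      show ?thesis unfolding m using less.prems by (simp add: algebra_simps)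
    qed
    from S[OF det less.hyps[OF lt det]] have "Q a (b - n * a) c (d mod c)" by simp
    moreover have "a * (d mod c) - (b - n * a) * c = 1" using det by (simp add: algebra_simps)
    ultimately have "Q a (b - n * a + n * a) c (d mod c + n * c)" using Tn by blast
    then show ?thesis using d by simp
  qed
qed

lemma nearest_residue:
  fixes x m :: int
  assumes "m \<noteq> 0"
  shows "\<exists>n. 2 * \<bar>x - n * m\<bar> \<le> \<bar>m\<bar>"
proof -
  define r where "r = x mod m"
  have x: "x = m * (x div m) + r" by (simp add: r_def)
  consider "2 * \<bar>r\<bar> \<le> \<bar>m\<bar>" | "2 * \<bar>r - m\<bar> \<le> \<bar>m\<bar>"
  proof (cases "m > 0")
    case True
    then have "0 \<le> r" "r < m" by (simp_all add: r_def)
    then have "2 * \<bar>r\<bar> \<le> \<bar>m\<bar> \<or> 2 * \<bar>r - m\<bar> \<le> \<bar>m\<bar>" by (smt (verit))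
    then show ?thesis using that by blast
  next
    case False
    then have "r \<le> 0" "m < r" using assms by (simp_all add: r_def)
    then have "2 * \<bar>r\<bar> \<le> \<bar>m\<bar> \<or> 2 * \<bar>r - m\<bar> \<le> \<bar>m\<bar>" by (smt (verit))
    then show ?thesis using that by blast
  qed
  then show ?thesis
  proof cases
    case 1
    moreover have "x - x div m * m = r" by (simp add: r_def minus_div_mult_eq_mod)
    ultimately show ?thesis by metis
  next
    case 2
    have "x - (x div m + 1) * m = r - m" using x by (simp add: algebra_simps)
    with 2 show ?thesis by metis
  qed
qed

text \<open>
  \<open>\<Gamma>\<^sub>0(3)\<close> is generated by \<open>-1\<close>, the translation \<open>T\<close> and the lower triangular matrix with lower left
  entry \<open>3\<close>. Remainders of least absolute value are essential for the descent: after a step modulo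
  \<open>c\<close> and a step modulo \<open>3 d\<close> the entry \<open>c\<close> has shrunk by the factor \<open>3/4\<close>, whereas with ordinary
  remainders it need not shrink at all.
\<close>

lemma Gamma0_3_entries_induct:
  fixes Q :: "int \<Rightarrow> int \<Rightarrow> int \<Rightarrow> int \<Rightarrow> bool"
  assumes det: "a * d - b * c = 1" and c: "3 dvd c" and one: "Q 1 0 0 1"
    and T: "\<And>a b c d. a * d - b * c = 1 \<Longrightarrow> 3 dvd c \<Longrightarrow> Q a b c d \<Longrightarrow> Q a (b + a) c (d + c)"
    and T': "\<And>a b c d. a * d - b * c = 1 \<Longrightarrow> 3 dvd c \<Longrightarrow> Q a b c d \<Longrightarrow> Q a (b - a) c (d - c)"
    and V: "\<And>a b c d. a * d - b * c = 1 \<Longrightarrow> 3 dvd c \<Longrightarrow> Q a b c d \<Longrightarrow> Q (a + 3 * b) b (c + 3 * d) d"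
    and V': "\<And>a b c d. a * d - b * c = 1 \<Longrightarrow> 3 dvd c \<Longrightarrow> Q a b c d \<Longrightarrow> Q (a - 3 * b) b (c - 3 * d) d"
    and neg: "\<And>a b c d. a * d - b * c = 1 \<Longrightarrow> 3 dvd c \<Longrightarrow> Q a b c d \<Longrightarrow> Q (- a) (- b) (- c) (- d)"
  shows "Q a b c d"
  using det c
proof (induction "nat \<bar>c\<bar>" arbitrary: a b c d rule: less_induct)
  case less
  have Tn: "Q a (b + n * a) c (d + n * c)" if "a * d - b * c = 1" "3 dvd c" "Q a b c d" for a b c d n
  proof (induction n rule: int_translate_induct)
    case (2 n)
    have "a * (d + n * c) - (b + n * a) * c = 1" using that by (simp add: algebra_simps)
    from T[OF this that(2) 2] show ?case by (simp add: algebra_simps)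
  next
    case (3 n)
    have "a * (d + n * c) - (b + n * a) * c = 1" using that by (simp add: algebra_simps)
    from T'[OF this that(2) 3] show ?case by (simp add: algebra_simps)
  qed (use that in simp)
  have Vn: "Q (a + n * (3 * b)) b (c + n * (3 * d)) d" if "a * d - b * c = 1" "3 dvd c" "Q a b c d" for a b c d n
  proof (induction n rule: int_translate_induct)
    case (2 n)
    have "(a + n * (3 * b)) * d - b * (c + n * (3 * d)) = 1" "3 dvd c + n * (3 * d)"
      using that by (auto simp: algebra_simps)
    from V[OF this 2] show ?case by (simp add: algebra_simps)
  next
    case (3 n)
    have "(a + n * (3 * b)) * d - b * (c + n * (3 * d)) = 1" "3 dvd c + n * (3 * d)"
      using that by (auto simp: algebra_simps)
    from V'[OF this 3] show ?case by (simp add: algebra_simps)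
  qed (use that in simp)
  show ?case
  proof (cases "c = 0")
    case True
    then have "a * d = 1" using less.prems by simp
    then consider "a = 1" "d = 1" | "a = -1" "d = -1" using zmult_eq_1_iff by auto
    then show ?thesis
    proof cases
      case 1
      then show ?thesis using Tn[of 1 1 0 0 b] one True by simp
    next
      case 2
      have "Q (-1) 0 0 (-1)" using neg[of 1 1 0 0] one by simp
      then show ?thesis using Tn[of "-1" "-1" 0 0 "-b"] 2 True by simp
    qed
  next
    case False
    \<comment> \<open>Nearest residues give \<open>|d'| \<le> |c| / 2\<close> and then \<open>|c'| \<le> 3 |d'| / 2 \<le> 3 |c| / 4\<close>.\<close>
    obtain n where n: "2 * \<bar>d - n * c\<bar> \<le> \<bar>c\<bar>" using nearest_residue[OF False] by blast
    define d' where "d' = d - n * c"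
    define b' where "b' = b - n * a"
    have det': "a * d' - b' * c = 1" using less.prems by (simp add: d'_def b'_def algebra_simps)
    have "d' \<noteq> 0"
    proof
      assume "d' = 0"
      then have "c dvd 1" using det' by (metis dvd_minus_iff dvd_triv_right minus_diff_eq mult_zero_right diff_0)
      then have "(3::int) dvd 1" using less.prems(2) dvd_trans by blast
      then show False by simp
    qed
    then obtain m where m: "2 * \<bar>c - m * (3 * d')\<bar> \<le> \<bar>3 * d'\<bar>" using nearest_residue[of "3 * d'" c] by auto
    have lt: "nat \<bar>c - m * (3 * d')\<bar> < nat \<bar>c\<bar>"
    proof -
      have "\<bar>3 * d'\<bar> = 3 * \<bar>d'\<bar>" by simp
      then have "\<bar>c - m * (3 * d')\<bar> < \<bar>c\<bar>"
      proof -
        define x where "x = \<bar>c - m * (3 * d')\<bar>"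
        have "2 * x \<le> 3 * \<bar>d'\<bar>" "2 * \<bar>d'\<bar> \<le> \<bar>c\<bar>" "\<bar>c\<bar> > 0"
          using m n False by (simp_all add: x_def abs_mult flip: d'_def)
        then show ?thesis unfolding x_def[symmetric] by linarith
      qed
      then show ?thesis by simp
    qed
    have det'': "(a - m * (3 * b')) * d' - b' * (c - m * (3 * d')) = 1"
      using det' by (simp add: algebra_simps)
    have dv: "3 dvd c - m * (3 * d')" using less.prems by simp
    have "Q (a - m * (3 * b') + m * (3 * b')) b' (c - m * (3 * d') + m * (3 * d')) d'"
      by (rule Vn[OF det'' dv less.hyps[OF lt det'' dv]])
    then have "Q a b' c d'" by simp
    from Tn[OF det' less.prems(2) this, of n] show ?thesis by (simp add: b'_def d'_def)
  qed
qed

section \<open>Transformation of eta and its cubic quotients\<close>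

lemma mat22_mult: "mat22 a b c d ** mat22 a' b' c' d' =
    mat22 (a * a' + b * c') (a * b' + b * d') (c * a' + d * c') (c * b' + d * d')"
  by (rule mat2_eqI) (simp_all add: mat2_mult_nth)

lemma mat22_SL2Z [simp]: "mat22 a b c d \<in> SL2Z \<longleftrightarrow> a * d - b * c = 1"
  by (simp add: SL2Z_iff)

lemma log_eta_shift_back: "log_eta (\<tau> - 1) = log_eta \<tau> - 2 * of_real pi * \<i> / 24"
  using log_eta_shift[of "\<tau> - 1"] by simp

lemma log_eta_shift_nat: "log_eta (\<tau> + of_nat n) = log_eta \<tau> + of_nat n * (2 * of_real pi * \<i> / 24)"
proof (induction n)
  case (Suc n)
  have "log_eta (\<tau> + of_nat (Suc n)) = log_eta ((\<tau> + of_nat n) + 1)" by (simp add: algebra_simps)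
  also have "\<dots> = log_eta (\<tau> + of_nat n) + 2 * of_real pi * \<i> / 24" by (rule log_eta_shift)
  finally show ?case using Suc by (simp add: algebra_simps)
qed simp

text \<open>
  Absolute values carry no roots of unity, so the modulus of \<open>\<eta>\<close> transforms under the full modular
  group with no multiplier at all. This is enough for every growth condition at the cusps.
\<close>

lemma Re_log_eta_act:
  assumes "\<gamma> \<in> SL2Z" "Im \<tau> > 0"
  shows "Re (log_eta (act \<gamma> \<tau>)) = Re (log_eta \<tau>) + ln (norm (denom \<gamma> \<tau>)) / 2"
proof -
  define Q where "Q a b c d \<longleftrightarrow> (\<forall>\<tau>. Im \<tau> > 0 \<longrightarrow> Re (log_eta (act (mat22 a b c d) \<tau>)) =
      Re (log_eta \<tau>) + ln (norm (denom (mat22 a b c d) \<tau>)) / 2)" for a b c d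
  have step: "Q (a * a' + b * c') (a * b' + b * d') (c * a' + d * c') (c * b' + d * d')"
    if "a * d - b * c = 1" "Q a b c d" "a' * d' - b' * c' = 1" "Q a' b' c' d'" for a b c d a' b' c' d'
  proof -
    define \<gamma> \<delta> where "\<gamma> = mat22 a b c d" and "\<delta> = mat22 a' b' c' d'"
    have S: "\<gamma> \<in> SL2Z" "\<delta> \<in> SL2Z" using that by (simp_all add: \<gamma>_def \<delta>_def)
    have "Re (log_eta (act (\<gamma> ** \<delta>) \<tau>)) = Re (log_eta \<tau>) + ln (norm (denom (\<gamma> ** \<delta>) \<tau>)) / 2" if "Im \<tau> > 0" for \<tau>
    proof -
      have "norm (denom \<gamma> (act \<delta> \<tau>)) > 0" "norm (denom \<delta> \<tau>) > 0"
        using denom_nonzero S that act_in_upper_half_plane by auto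
      then show ?thesis
        using \<open>Q a b c d\<close> \<open>Q a' b' c' d'\<close> act_in_upper_half_plane[OF S(2) that] that
        by (simp add: act_mult[OF S that] denom_mult[OF S(2) that] norm_mult ln_mult Q_def
             flip: \<gamma>_def \<delta>_def)
    qed
    then show ?thesis unfolding \<gamma>_def \<delta>_def mat22_mult Q_def by blast
  qed
  have "Q (\<gamma>$1$1) (\<gamma>$1$2) (\<gamma>$2$1) (\<gamma>$2$2)"
  proof (rule SL2Z_entries_induct)
    show "\<gamma>$1$1 * \<gamma>$2$2 - \<gamma>$1$2 * \<gamma>$2$1 = 1" using assms by (simp add: SL2Z_iff)
    show "Q 1 0 0 1" by (simp add: Q_def act_def denom_def)
  next
    fix a b c d :: int assume *: "a * d - b * c = 1" "Q a b c d"
    have "Q 1 1 0 1" "Q 1 (-1) 0 1"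
      using log_eta_shift log_eta_shift_back by (auto simp: Q_def act_def denom_def)
    moreover have "Q 0 (-1) 1 0"
    proof -
      have "Re (Ln (- \<i> * \<tau>)) = ln (norm \<tau>)" if "Im \<tau> > 0" for \<tau>
      proof -
        have "\<tau> \<noteq> 0" using that by auto
        then show ?thesis by (simp add: norm_mult)
      qed
      then show ?thesis using log_eta_inversion by (simp add: Q_def act_def denom_def)
    qed
    ultimately show "Q a (b + a) c (d + c)" "Q a (b - a) c (d - c)" "Q b (- a) d (- c)"
      using step[OF *, of 1 1 1 0] step[OF *, of 1 1 "-1" 0] step[OF *, of 0 0 "-1" 1]
      by (simp_all add: add.commute)
  qed
  then show ?thesis using assms(2) by (simp add: Q_def mat22_collapse)
qed

text \<open>
  A cubic character of the additive group of the integers; the values of \<open>b9\<close> and \<open>c9\<close> on level \<open>3\<close> have this form.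
\<close>

definition cis3 :: "int \<Rightarrow> complex" where
  "cis3 n = exp (2 * of_real pi * \<i> * of_int n / 3)"

lemma cis3_add: "cis3 (m + n) = cis3 m * cis3 n"
  by (simp add: cis3_def ring_distribs add_divide_distrib exp_add)

lemma cis3_0 [simp]: "cis3 0 = 1" by (simp add: cis3_def)

lemma cis3_nonzero [simp]: "cis3 n \<noteq> 0" by (simp add: cis3_def)

lemma cis3_minus: "cis3 (- n) = inverse (cis3 n)"
  by (simp add: cis3_def exp_minus)

lemma cis3_triple: "cis3 (3 * n) = 1"
proof -
  have "cis3 (3 * n) = exp (\<i> * (of_int n * (of_real pi * 2)))" by (simp add: cis3_def mult_ac)
  then show ?thesis by simp
qed

lemma cis3_dvd: "3 dvd n \<Longrightarrow> cis3 n = 1"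
  by (auto simp: cis3_triple)

lemma cis3_cong: "3 dvd m - n \<Longrightarrow> cis3 m = cis3 n"
  using cis3_add[of "m - n" n] by (simp add: cis3_dvd)

lemma cis3_power: "cis3 n ^ k = cis3 (int k * n)"
  by (simp add: cis3_def flip: exp_of_nat_mult) (simp add: mult_ac)

definition chi3 :: "int \<Rightarrow> complex" where
  "chi3 d = (if d mod 3 = 0 then 0 else if d mod 3 = 1 then 1 else - 1)"

lemma chi3_cong: "3 dvd m - n \<Longrightarrow> chi3 m = chi3 n"
  by (simp add: chi3_def mod_eq_dvd_iff[symmetric])

lemma chi3_minus: "chi3 (- d) = - chi3 d"
proof -
  have "d mod 3 = 0 \<or> d mod 3 = 1 \<or> d mod 3 = 2" by presburger
  moreover have "d mod 3 = 0 \<Longrightarrow> (- d) mod 3 = 0" "d mod 3 = 1 \<Longrightarrow> (- d) mod 3 = 2" "d mod 3 = 2 \<Longrightarrow> (- d) mod 3 = 1"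
    by presburger+
  ultimately show ?thesis unfolding chi3_def by fastforce
qed

lemma chi3_square: "\<not> 3 dvd d \<Longrightarrow> chi3 d ^ 2 = 1"
  by (auto simp: chi3_def)

text \<open>
  The quotients \<open>\<eta>(3\<tau>)\<^sup>3 / \<eta>(\<tau>)\<close> and \<open>\<eta>(\<tau>)\<^sup>3 / \<eta>(3\<tau>)\<close> have weight \<open>1\<close> on \<open>\<Gamma>\<^sub>0(3)\<close> and are interchanged, up to
  constants, by the Fricke involution \<open>\<tau> \<mapsto> - 1 / (3\<tau>)\<close>. They determine the multipliers of both cube roots, and as
  \<open>\<eta>\<^sup>8\<close> is the product of the first and the cube of the second, they
  also determine the cube of the cocycle of weight \<open>1/3\<close>.
\<close>

definition eta_cube_quot3 :: "complex \<Rightarrow> complex" where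
  "eta_cube_quot3 \<tau> = exp (3 * log_eta (3 * \<tau>) - log_eta \<tau>)"

definition eta_cube_quot1 :: "complex \<Rightarrow> complex" where
  "eta_cube_quot1 \<tau> = exp (3 * log_eta \<tau> - log_eta (3 * \<tau>))"

lemma eta_cube_quot_nonzero [simp]: "eta_cube_quot3 \<tau> \<noteq> 0" "eta_cube_quot1 \<tau> \<noteq> 0"
  by (simp_all add: eta_cube_quot3_def eta_cube_quot1_def)

lemma eta_cube_quot3_shift: "eta_cube_quot3 (\<tau> + 1) = cis3 1 * eta_cube_quot3 \<tau>"
  using log_eta_shift[of \<tau>] log_eta_shift_nat[of "3 * \<tau>" 3]
  by (simp add: eta_cube_quot3_def cis3_def algebra_simps flip: exp_add)

lemma eta_cube_quot1_shift: "eta_cube_quot1 (\<tau> + 1) = eta_cube_quot1 \<tau>"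
  using log_eta_shift[of \<tau>] log_eta_shift_nat[of "3 * \<tau>" 3]
  by (simp add: eta_cube_quot1_def algebra_simps)

lemma log_eta_inversion_3:
  assumes "Im \<tau> > 0"
  shows "log_eta (3 * (- 1 / (3 * \<tau>))) = log_eta \<tau> + Ln (- \<i> * \<tau>) / 2"
    "log_eta (- 1 / (3 * \<tau>)) = log_eta (3 * \<tau>) + (of_real (ln 3) + Ln (- \<i> * \<tau>)) / 2"
proof -
  have "\<tau> \<noteq> 0" using assms by auto
  then show "log_eta (3 * (- 1 / (3 * \<tau>))) = log_eta \<tau> + Ln (- \<i> * \<tau>) / 2"
    using log_eta_inversion[OF assms] by simp
  have "Ln (- \<i> * (3 * \<tau>)) = of_real (ln 3) + Ln (- \<i> * \<tau>)"
  proof -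
    have "Ln (of_real 3 * (- \<i> * \<tau>)) = of_real (ln 3) + Ln (- \<i> * \<tau>)"
      using Ln_times_of_real[of 3 "- \<i> * \<tau>"] \<open>\<tau> \<noteq> 0\<close> by (simp del: of_real_numeral add: Ln_of_real)
    moreover have "of_real 3 * (- \<i> * \<tau>) = - \<i> * (3 * \<tau>)" by simp
    ultimately show ?thesis by (simp only:)
  qed
  then show "log_eta (- 1 / (3 * \<tau>)) = log_eta (3 * \<tau>) + (of_real (ln 3) + Ln (- \<i> * \<tau>)) / 2"
    using log_eta_inversion[of "3 * \<tau>"] assms by simp
qed

lemma eta_cube_quot3_inversion:
  assumes "Im \<tau> > 0"
  shows "eta_cube_quot3 (- 1 / (3 * \<tau>)) = exp (- of_real (ln 3) / 2) * (- \<i> * \<tau>) * eta_cube_quot1 \<tau>"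
proof -
  have "- \<i> * \<tau> \<noteq> 0" using assms by auto
  then have "exp (Ln (- \<i> * \<tau>)) = - \<i> * \<tau>" by (rule exp_Ln)
  moreover have "3 * log_eta (3 * (- 1 / (3 * \<tau>))) - log_eta (- 1 / (3 * \<tau>)) =
     - of_real (ln 3) / 2 + Ln (- \<i> * \<tau>) + (3 * log_eta \<tau> - log_eta (3 * \<tau>))"
    unfolding log_eta_inversion_3[OF assms] by (simp add: field_simps)
  ultimately show ?thesis unfolding eta_cube_quot3_def eta_cube_quot1_def by (simp only: exp_add)
qed

lemma eta_cube_quot1_inversion:
  assumes "Im \<tau> > 0"
  shows "eta_cube_quot1 (- 1 / (3 * \<tau>)) = exp (3 * of_real (ln 3) / 2) * (- \<i> * \<tau>) * eta_cube_quot3 \<tau>"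
proof -
  have "- \<i> * \<tau> \<noteq> 0" using assms by auto
  then have "exp (Ln (- \<i> * \<tau>)) = - \<i> * \<tau>" by (rule exp_Ln)
  moreover have "3 * log_eta (- 1 / (3 * \<tau>)) - log_eta (3 * (- 1 / (3 * \<tau>))) =
     3 * of_real (ln 3) / 2 + Ln (- \<i> * \<tau>) + (3 * log_eta (3 * \<tau>) - log_eta \<tau>)"
    unfolding log_eta_inversion_3[OF assms] by (simp add: field_simps)
  ultimately show ?thesis unfolding eta_cube_quot3_def eta_cube_quot1_def by (simp only: exp_add)
qed

text \<open>
  The lower triangular generator is the conjugate of \<open>T\<^sup>-\<^sup>1\<close> by the Fricke involution \<open>\<tau> \<mapsto> \<sigma>\<close>.
\<close>

lemma lower_triangular_step:
  assumes "Im \<tau> > 0"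
  defines "\<sigma> \<equiv> - 1 / (3 * \<tau>)"
  shows "Im \<sigma> > 0" "\<tau> = - 1 / (3 * \<sigma>)" "\<tau> / (3 * \<tau> + 1) = - 1 / (3 * (\<sigma> - 1))" "(\<sigma> - 1) / \<sigma> = 3 * \<tau> + 1" "\<sigma> \<noteq> 0"
proof -
  have t: "\<tau> \<noteq> 0" "3 * \<tau> + 1 \<noteq> 0" using assms by (auto simp: complex_eq_iff)
  have "Im \<sigma> = 3 * Im \<tau> / (cmod (3 * \<tau>))\<^sup>2" unfolding \<sigma>_def Im_divide cmod_power2 by simp
  then show "Im \<sigma> > 0" using assms(1) t by simp
  show "\<tau> = - 1 / (3 * \<sigma>)" "(\<sigma> - 1) / \<sigma> = 3 * \<tau> + 1" "\<sigma> \<noteq> 0"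
    using t by (simp_all add: \<sigma>_def field_simps)
  have "3 * (\<sigma> - 1) = - (3 * \<tau> + 1) / \<tau>" using t by (simp add: \<sigma>_def field_simps)
  moreover have "- 1 / (- x / \<tau>) = \<tau> / x" for x by simp
  ultimately show "\<tau> / (3 * \<tau> + 1) = - 1 / (3 * (\<sigma> - 1))" by metis
qed

lemma eta_cube_quot3_lower:
  assumes "Im \<tau> > 0"
  shows "eta_cube_quot3 (\<tau> / (3 * \<tau> + 1)) = (3 * \<tau> + 1) * eta_cube_quot3 \<tau>"
proof -
  define \<sigma> where "\<sigma> = - 1 / (3 * \<tau>)"
  note s = lower_triangular_step[OF assms, folded \<sigma>_def]
  have "Im (\<sigma> - 1) > 0" using s by simp
  from eta_cube_quot3_inversion[OF this]
  have "eta_cube_quot3 (\<tau> / (3 * \<tau> + 1)) = exp (- of_real (ln 3) / 2) * (- \<i> * (\<sigma> - 1)) * eta_cube_quot1 (\<sigma> - 1)"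
    unfolding s(3) .
  also have "eta_cube_quot1 (\<sigma> - 1) = eta_cube_quot1 \<sigma>" using eta_cube_quot1_shift[of "\<sigma> - 1"] by simp
  also have "exp (- of_real (ln 3) / 2) * (- \<i> * (\<sigma> - 1)) * eta_cube_quot1 \<sigma> =
      (\<sigma> - 1) / \<sigma> * (exp (- of_real (ln 3) / 2) * (- \<i> * \<sigma>) * eta_cube_quot1 \<sigma>)"
    using s(5) by simp
  also have "exp (- of_real (ln 3) / 2) * (- \<i> * \<sigma>) * eta_cube_quot1 \<sigma> = eta_cube_quot3 \<tau>"
    using eta_cube_quot3_inversion[OF s(1)] s(2) by simp
  finally show ?thesis unfolding s(4) .
qed

lemma eta_cube_quot1_lower:
  assumes "Im \<tau> > 0"
  shows "eta_cube_quot1 (\<tau> / (3 * \<tau> + 1)) = cis3 (- 1) * (3 * \<tau> + 1) * eta_cube_quot1 \<tau>"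
proof -
  define \<sigma> where "\<sigma> = - 1 / (3 * \<tau>)"
  note s = lower_triangular_step[OF assms, folded \<sigma>_def]
  have "Im (\<sigma> - 1) > 0" using s by simp
  from eta_cube_quot1_inversion[OF this]
  have "eta_cube_quot1 (\<tau> / (3 * \<tau> + 1)) = exp (3 * of_real (ln 3) / 2) * (- \<i> * (\<sigma> - 1)) * eta_cube_quot3 (\<sigma> - 1)"
    unfolding s(3) .
  also have "eta_cube_quot3 (\<sigma> - 1) = cis3 (- 1) * eta_cube_quot3 \<sigma>"
    using eta_cube_quot3_shift[of "\<sigma> - 1"] by (simp add: cis3_minus field_simps)
  also have "exp (3 * of_real (ln 3) / 2) * (- \<i> * (\<sigma> - 1)) * (cis3 (- 1) * eta_cube_quot3 \<sigma>) =
      cis3 (- 1) * ((\<sigma> - 1) / \<sigma>) * (exp (3 * of_real (ln 3) / 2) * (- \<i> * \<sigma>) * eta_cube_quot3 \<sigma>)"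
    using s(5) by simp
  also have "exp (3 * of_real (ln 3) / 2) * (- \<i> * \<sigma>) * eta_cube_quot3 \<sigma> = eta_cube_quot1 \<tau>"
    using eta_cube_quot1_inversion[OF s(1)] s(2) by simp
  finally show ?thesis unfolding s(4) .
qed

lemma square_mod_3: "\<not> 3 dvd (d::int) \<Longrightarrow> 3 dvd d * d - 1"
proof -
  assume "\<not> 3 dvd d"
  then have d: "d mod 3 = 1 \<or> d mod 3 = 2" by presburger
  define q where "q = d div 3"
  have "d = 3 * q + 1 \<or> d = 3 * q + 2" unfolding q_def using d by presburger
  then have "d * d - 1 = 3 * (3 * q * q + 2 * q) \<or> d * d - 1 = 3 * (3 * q * q + 4 * q + 1)"
    by (auto simp: algebra_simps)
  then show "3 dvd d * d - 1" by (metis dvd_triv_left)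
qed

text \<open>
  The transformation behaviour on \<open>\<Gamma>\<^sub>0(3)\<close> is determined by the constants \<open>s\<close> and \<open>t\<close> at the two unipotent
  generators. That the exponent \<open>s b d + t (c/3) d\<close> is additive rests on \<open>a d \<equiv> d\<^sup>2 \<equiv> 1\<close> modulo \<open>3\<close>; the
  factor \<open>chi3 d\<close> accounts for the matrix \<open>-1\<close>, where the denominator changes sign.
\<close>

lemma weight_one_character:
  fixes f :: "complex \<Rightarrow> complex"
  assumes shift: "\<And>\<tau>. f (\<tau> + 1) = cis3 s * f \<tau>"
    and lower: "\<And>\<tau>. Im \<tau> > 0 \<Longrightarrow> f (\<tau> / (3 * \<tau> + 1)) = cis3 t * (3 * \<tau> + 1) * f \<tau>"
    and \<gamma>: "a * d - b * c = 1" "3 dvd c" and \<tau>: "Im \<tau> > 0"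
  shows "f (act (mat22 a b c d) \<tau>) = chi3 d * cis3 (s * (b * d) + t * (c div 3 * d)) * denom (mat22 a b c d) \<tau> * f \<tau>"
proof -
  define Q where "Q a b c d \<longleftrightarrow> (\<forall>\<tau>. Im \<tau> > 0 \<longrightarrow> f (act (mat22 a b c d) \<tau>) =
      chi3 d * cis3 (s * (b * d) + t * (c div 3 * d)) * denom (mat22 a b c d) \<tau> * f \<tau>)" for a b c d
  have step: "f (act (mat22 a b c d ** \<delta>) \<tau>) =
      chi3 d * cis3 (s * (b * d) + t * (c div 3 * d) + k) * denom (mat22 a b c d ** \<delta>) \<tau> * f \<tau>"
    if "a * d - b * c = 1" "Q a b c d" "\<delta> \<in> SL2Z" "Im \<tau> > 0" "f (act \<delta> \<tau>) = cis3 k * denom \<delta> \<tau> * f \<tau>"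
    for a b c d \<delta> k \<tau>
    using that act_in_upper_half_plane[OF that(3,4)]
    by (simp add: act_mult denom_mult cis3_add Q_def mult_ac)
  have "Q a b c d"
  proof (rule Gamma0_3_entries_induct[OF \<gamma>])
    show "Q 1 0 0 1" by (simp add: Q_def act_def denom_def chi3_def)
  next
    fix a b c d :: int assume *: "a * d - b * c = 1" "3 dvd c" "Q a b c d"
    obtain k where k: "c = 3 * k" using *(2) by auto
    have chi: "chi3 (d + c) = chi3 d" "chi3 (d - c) = chi3 d" using *(2) by (auto intro!: chi3_cong)
    \<comment> \<open>The exponent \<open>b d\<close> grows by \<open>a d\<close> up to multiples of \<open>3\<close>, and \<open>a d = 1 + b c\<close>.\<close>
    have e: "cis3 (s * ((b + a) * (d + c)) + t * (c div 3 * (d + c))) = cis3 (s * (b * d) + t * (c div 3 * d) + s)"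
    proof (rule cis3_cong)
      have ad: "a * d = 1 + b * (3 * k)" using *(1) k by (simp add: algebra_simps)
      have "(s * ((b + a) * (d + c)) + t * (c div 3 * (d + c))) - (s * (b * d) + t * (c div 3 * d) + s) =
         s * (a * d - 1) + 3 * (s * (b * k + a * k) + t * (k * k))"
        by (simp add: k algebra_simps)
      also have "\<dots> = 3 * (s * (b * k) + s * (b * k + a * k) + t * (k * k))"
        unfolding ad by (simp add: algebra_simps)
      finally show "3 dvd (s * ((b + a) * (d + c)) + t * (c div 3 * (d + c))) - (s * (b * d) + t * (c div 3 * d) + s)"
        by simp
    qed
    have T: "f (act (mat22 1 1 0 1) \<tau>) = cis3 s * denom (mat22 1 1 0 1) \<tau> * f \<tau>" for \<tau>
      using shift by (simp add: act_def denom_def)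
    show "Q a (b + a) c (d + c)"
      unfolding Q_def e chi
      using step[OF *(1,3) _ _ T] by (simp add: mat22_mult add_ac)
    have e': "cis3 (s * ((b - a) * (d - c)) + t * (c div 3 * (d - c))) = cis3 (s * (b * d) + t * (c div 3 * d) - s)"
    proof (rule cis3_cong)
      have ad: "a * d = 1 + b * (3 * k)" using *(1) k by (simp add: algebra_simps)
      have "(s * ((b - a) * (d - c)) + t * (c div 3 * (d - c))) - (s * (b * d) + t * (c div 3 * d) - s) =
         - s * (a * d - 1) + 3 * (s * (- b * k + a * k) - t * (k * k))"
        by (simp add: k algebra_simps)
      also have "\<dots> = 3 * (- s * (b * k) + s * (- b * k + a * k) - t * (k * k))"
        unfolding ad by (simp add: algebra_simps)
      finally show "3 dvd (s * ((b - a) * (d - c)) + t * (c div 3 * (d - c))) - (s * (b * d) + t * (c div 3 * d) - s)"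
        by simp
    qed
    have T': "f (act (mat22 1 (-1) 0 1) \<tau>) = cis3 (- s) * denom (mat22 1 (-1) 0 1) \<tau> * f \<tau>" for \<tau>
      using shift[of "\<tau> - 1"] by (simp add: act_def denom_def cis3_minus field_simps)
    show "Q a (b - a) c (d - c)"
      unfolding Q_def e' chi
      using step[OF *(1,3) _ _ T'] by (simp add: mat22_mult algebra_simps)
    have nd: "\<not> 3 dvd d"
    proof
      assume "3 dvd d"
      then have "3 dvd a * d - b * c" using *(2) by (intro dvd_diff dvd_mult)
      then show False using *(1) by simp
    qed
    then have "3 dvd d * d - 1" by (rule square_mod_3)
    then obtain r where r: "d * d = 1 + 3 * r" by (metis dvdE add.commute diff_add_cancel)
    have V: "f (act (mat22 1 0 3 1) \<tau>) = cis3 t * denom (mat22 1 0 3 1) \<tau> * f \<tau>" if "Im \<tau> > 0" for \<tau>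
      using lower[OF that] by (simp add: act_def denom_def)
    have V': "f (act (mat22 1 0 (-3) 1) \<tau>) = cis3 (- t) * denom (mat22 1 0 (-3) 1) \<tau> * f \<tau>" if "Im \<tau> > 0" for \<tau>
    proof -
      have M: "mat22 1 0 3 1 \<in> SL2Z" "mat22 1 0 (-3) 1 \<in> SL2Z" by simp_all
      have one: "mat22 1 0 3 1 ** mat22 1 0 (-3) 1 = mat 1" by (rule mat2_eqI) (simp_all add: mat22_mult)
      define \<sigma> where "\<sigma> = act (mat22 1 0 (-3) 1) \<tau>"
      have "f \<tau> = cis3 t * denom (mat22 1 0 3 1) \<sigma> * f \<sigma>"
        using V[of \<sigma>] act_in_upper_half_plane[OF M(2) that] act_mult[OF M that] unfolding \<sigma>_def one by simp
      moreover have "denom (mat22 1 0 3 1) \<sigma> * denom (mat22 1 0 (-3) 1) \<tau> = 1"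
        using denom_mult[OF M(2) that, of "mat22 1 0 3 1"] unfolding one \<sigma>_def by simp
      ultimately have "cis3 (- t) * denom (mat22 1 0 (-3) 1) \<tau> * f \<tau> = f \<sigma>"
        by (simp add: cis3_minus mult_ac)
      then show ?thesis by (simp add: \<sigma>_def)
    qed
    \<comment> \<open>Here \<open>(c / 3) d\<close> grows by \<open>d\<^sup>2\<close>, which is \<open>1\<close> modulo \<open>3\<close>.\<close>
    have e: "cis3 (s * (b * d) + t * ((c + 3 * d) div 3 * d)) = cis3 (s * (b * d) + t * (c div 3 * d) + t)"
    proof (rule cis3_cong)
      have "s * (b * d) + t * ((c + 3 * d) div 3 * d) - (s * (b * d) + t * (c div 3 * d) + t) = t * (d * d - 1)"
      proof -
        have "(c + 3 * d) div 3 = k + d" "c div 3 = k" by (simp_all add: k)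
        then show ?thesis by (simp only:) (simp add: algebra_simps)
      qed
      then show "3 dvd s * (b * d) + t * ((c + 3 * d) div 3 * d) - (s * (b * d) + t * (c div 3 * d) + t)"
        by (simp add: r)
    qed
    show "Q (a + 3 * b) b (c + 3 * d) d"
      unfolding Q_def e
      using step[OF *(1,3) _ _ V] by (simp add: mat22_mult mult_ac)
    have e: "cis3 (s * (b * d) + t * ((c - 3 * d) div 3 * d)) = cis3 (s * (b * d) + t * (c div 3 * d) - t)"
    proof (rule cis3_cong)
      have "s * (b * d) + t * ((c - 3 * d) div 3 * d) - (s * (b * d) + t * (c div 3 * d) - t) = - t * (d * d - 1)"
      proof -
        have "c - 3 * d = 3 * (k - d)" by (simp add: k algebra_simps)
        then have "(c - 3 * d) div 3 = k - d" "c div 3 = k" by (simp_all add: k)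
        then show ?thesis by (simp only:) (simp add: algebra_simps)
      qed
      then show "3 dvd s * (b * d) + t * ((c - 3 * d) div 3 * d) - (s * (b * d) + t * (c div 3 * d) - t)"
        by (simp add: r)
    qed
    show "Q (a - 3 * b) b (c - 3 * d) d"
      unfolding Q_def e
      using step[OF *(1,3) _ _ V'] by (simp add: mat22_mult mult_ac)
    have "act (mat22 (- a) (- b) (- c) (- d)) \<tau> = act (mat22 a b c d) \<tau>" for \<tau>
      by (simp add: act_def) (metis (no_types, opaque_lifting) add.commute diff_conv_add_uminus minus_add_distrib minus_divide_divide)
    moreover have "denom (mat22 (- a) (- b) (- c) (- d)) \<tau> = - denom (mat22 a b c d) \<tau>" for \<tau>
      by (simp add: denom_def)
    moreover have "(- c) div 3 * (- d) = c div 3 * d"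
    proof -
      have "- c = 3 * (- k)" by (simp add: k)
      then have "(- c) div 3 = - k" by simp
      moreover have "c div 3 = k" by (simp add: k)
      ultimately show ?thesis by simp
    qed
    ultimately show "Q (- a) (- b) (- c) (- d)"
      using *(3) by (simp add: Q_def chi3_minus)
  qed
  then show ?thesis using \<tau> by (simp add: Q_def)
qed

lemma eta_cube_quot3_act:
  assumes "a * d - b * c = 1" "3 dvd c" "Im \<tau> > 0"
  shows "eta_cube_quot3 (act (mat22 a b c d) \<tau>) =
    chi3 d * cis3 (b * d) * denom (mat22 a b c d) \<tau> * eta_cube_quot3 \<tau>"
  using weight_one_character[of eta_cube_quot3 1 0, OF _ _ assms] eta_cube_quot3_shift eta_cube_quot3_lower
  by simp

lemma eta_cube_quot1_act:
  assumes "a * d - b * c = 1" "3 dvd c" "Im \<tau> > 0"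
  shows "eta_cube_quot1 (act (mat22 a b c d) \<tau>) =
    chi3 d * cis3 (- (c div 3 * d)) * denom (mat22 a b c d) \<tau> * eta_cube_quot1 \<tau>"
  using weight_one_character[of eta_cube_quot1 0 "-1", OF _ _ assms] eta_cube_quot1_shift eta_cube_quot1_lower
  by simp

section \<open>The slash operation\<close>

text \<open>
  The factor of weight \<open>1/3\<close> without the characters \<open>c9\<close> and \<open>b9\<close>. As a quotient of values of a single
  function divided by the cocycle \<open>c\<tau> + d\<close>, it is a cocycle on the full modular group, so that
  functions can be moved to any cusp with it.
\<close>

definition third_factor :: "mat2 \<Rightarrow> complex \<Rightarrow> complex" where
  "third_factor \<gamma> \<tau> = exp (8 / 3 * (log_eta (act \<gamma> \<tau>) - log_eta \<tau>)) / denom \<gamma> \<tau>"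

lemma third_factor_nonzero:
  assumes "\<gamma> \<in> SL2Z" "Im \<tau> > 0"
  shows "third_factor \<gamma> \<tau> \<noteq> 0"
  using denom_nonzero[OF assms] by (simp add: third_factor_def)

lemma third_factor_mult:
  assumes "\<gamma> \<in> SL2Z" "\<delta> \<in> SL2Z" "Im \<tau> > 0"
  shows "third_factor (\<gamma> ** \<delta>) \<tau> = third_factor \<gamma> (act \<delta> \<tau>) * third_factor \<delta> \<tau>"
  by (simp add: third_factor_def act_mult assms denom_mult ring_distribs flip: exp_add)

text \<open>
  The exponents add up: \<open>\<eta>\<^sup>8\<^sup>/\<^sup>3\<close> has weight \<open>4/3\<close>, and \<open>4/3 - 1 = 1/3\<close>.
\<close>

lemma norm_third_factor:
  assumes "\<gamma> \<in> SL2Z" "Im \<tau> > 0"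
  shows "norm (third_factor \<gamma> \<tau>) = norm (denom \<gamma> \<tau>) powr (1 / 3)"
proof -
  define D where "D = norm (denom \<gamma> \<tau>)"
  have D: "D > 0" using denom_nonzero[OF assms] by (simp add: D_def)
  have "Re (8 / 3 * (log_eta (act \<gamma> \<tau>) - log_eta \<tau>)) = 4 / 3 * ln D"
    using Re_log_eta_act[OF assms] by (simp add: D_def)
  then have "norm (third_factor \<gamma> \<tau>) = exp (4 / 3 * ln D) / D"
    by (simp only: third_factor_def norm_divide norm_exp_eq_Re D_def)
  also have "\<dots> = D powr (4 / 3) / D powr 1" using D by (simp add: powr_def)
  also have "\<dots> = D powr (4 / 3 - 1)" by (rule powr_diff[symmetric])
  also have "\<dots> = D powr (1 / 3)" by simp
  finally show ?thesis by (simp add: D_def)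
qed

lemma J_one_third_conv_third_factor:
  assumes "\<gamma> \<in> SL2Z" "Im \<tau> > 0"
  shows "J_one_third \<gamma> \<tau> = inverse (c9 \<gamma> * b9 \<gamma>) * third_factor \<gamma> \<tau>"
  using act_in_upper_half_plane[OF assms] assms
  by (simp add: J_one_third_def J_four_thirds_def third_factor_def eta_pow_conv_log_eta exp_diff ring_distribs diff_divide_distrib)

lemma third_factor_translation: "third_factor (mat22 1 (int n) 0 1) \<tau> = exp (2 * of_real pi * \<i> * of_nat n / 9)"
  using log_eta_shift_nat[of \<tau> n] by (simp add: third_factor_def act_def denom_def mult_ac)

definition slash :: "nat \<Rightarrow> (complex \<Rightarrow> complex) \<Rightarrow> mat2 \<Rightarrow> complex \<Rightarrow> complex" where
  "slash k f \<gamma> \<tau> = (if Im \<tau> > 0 then f (act \<gamma> \<tau>) / third_factor \<gamma> \<tau> ^ k else 0)"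

lemma slash_slash:
  assumes "\<gamma> \<in> SL2Z" "\<delta> \<in> SL2Z"
  shows "slash k (slash k f \<gamma>) \<delta> = slash k f (\<gamma> ** \<delta>)"
  using assms act_in_upper_half_plane[OF assms(2)]
  by (auto simp: slash_def fun_eq_iff act_mult third_factor_mult power_mult_distrib)

lemma slash_mat_1: "Im \<tau> > 0 \<Longrightarrow> slash k f (mat 1) \<tau> = f \<tau>"
  by (simp add: slash_def third_factor_def)

lemma slash_mult: "slash (k + l) (\<lambda>\<tau>. f \<tau> * g \<tau>) \<gamma> \<tau> = slash k f \<gamma> \<tau> * slash l g \<gamma> \<tau>"
  by (simp add: slash_def power_add)

lemma slash_scale: "slash k (\<lambda>\<tau>. c * f \<tau>) \<gamma> \<tau> = c * slash k f \<gamma> \<tau>"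
  by (simp add: slash_def)

lemma slash_sum: "slash k (\<lambda>\<tau>. \<Sum>i\<in>I. f i \<tau>) \<gamma> \<tau> = (\<Sum>i\<in>I. slash k (f i) \<gamma> \<tau>)"
  by (simp add: slash_def sum_divide_distrib)

lemma cusp_growth_eq_norm_slash:
  assumes "\<gamma> \<in> SL2Z" "Im \<tau> > 0"
  shows "cusp_growth k f \<gamma> \<tau> = norm (slash k f \<gamma> \<tau>)"
proof -
  have "norm (denom \<gamma> \<tau>) > 0" using denom_nonzero[OF assms] by simp
  then have "(norm (denom \<gamma> \<tau>) powr (1 / 3)) ^ k = norm (denom \<gamma> \<tau>) powr (real k / 3)"
    by (simp add: powr_realpow[symmetric] powr_powr)
  then show ?thesis using assms
    by (simp add: cusp_growth_def slash_def norm_divide norm_power norm_third_factor powr_minus_divide minus_divide_left[symmetric])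
qed

lemma holomorphic_act:
  assumes "\<gamma> \<in> SL2Z"
  shows "act \<gamma> holomorphic_on \<H>"
proof -
  have "(\<lambda>\<tau>. (of_int (\<gamma>$1$1) * \<tau> + of_int (\<gamma>$1$2)) / denom \<gamma> \<tau>) holomorphic_on \<H>"
    unfolding denom_def using denom_nonzero[OF assms] by (intro holomorphic_intros) (auto simp: denom_def)
  then show ?thesis by (simp add: act_conv[abs_def])
qed

lemma holomorphic_compose_upper:
  assumes "f holomorphic_on \<H>" "g holomorphic_on \<H>" "\<And>\<tau>. Im \<tau> > 0 \<Longrightarrow> Im (g \<tau>) > 0"
  shows "(\<lambda>\<tau>. f (g \<tau>)) holomorphic_on \<H>"
proof -
  have "g ` \<H> \<subseteq> \<H>" using assms(3) by auto
  from holomorphic_on_compose_gen[OF assms(2,1) this] show ?thesis by (simp add: o_def)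
qed

lemma holomorphic_slash:
  assumes "\<gamma> \<in> SL2Z" "f holomorphic_on \<H>"
  shows "slash k f \<gamma> holomorphic_on \<H>"
proof -
  note c = holomorphic_compose_upper[OF _ holomorphic_act[OF assms(1)] act_in_upper_half_plane[OF assms(1)]]
  have "(\<lambda>\<tau>. third_factor \<gamma> \<tau>) holomorphic_on \<H>"
    unfolding third_factor_def denom_def using denom_nonzero[OF assms(1)]
    by (intro holomorphic_intros c holomorphic_log_eta) (auto simp: denom_def)
  then have "(\<lambda>\<tau>. f (act \<gamma> \<tau>) / third_factor \<gamma> \<tau> ^ k) holomorphic_on \<H>"
    using third_factor_nonzero[OF assms(1)] c[OF assms(2)] by (intro holomorphic_intros) auto
  then show ?thesis
    by (rule holomorphic_transform) (simp add: slash_def)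
qed

abbreviation at_i_infinity :: "complex filter" where
  "at_i_infinity \<equiv> filtercomap Im at_top"

lemma eventually_at_i_infinity: "eventually P at_i_infinity \<longleftrightarrow> (\<exists>Y. \<forall>\<tau>. Im \<tau> \<ge> Y \<longrightarrow> P \<tau>)"
  by (simp add: eventually_filtercomap_at_top_linorder)

lemma eventually_upper: "eventually (\<lambda>\<tau>. Im \<tau> > 0) at_i_infinity"
  by (auto simp: eventually_at_i_infinity intro!: exI[of _ 1])

lemma Bfun_cusp_growth_iff:
  assumes "\<gamma> \<in> SL2Z"
  shows "Bfun (cusp_growth k f \<gamma>) at_i_infinity \<longleftrightarrow> Bfun (slash k f \<gamma>) at_i_infinity"
proof -
  have "eventually (\<lambda>\<tau>. norm (cusp_growth k f \<gamma> \<tau>) = norm (slash k f \<gamma> \<tau>)) at_i_infinity"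
    using eventually_upper by eventually_elim (simp add: cusp_growth_eq_norm_slash assms)
  then have "eventually (\<lambda>\<tau>. norm (cusp_growth k f \<gamma> \<tau>) \<le> K) at_i_infinity \<longleftrightarrow>
      eventually (\<lambda>\<tau>. norm (slash k f \<gamma> \<tau>) \<le> K) at_i_infinity"
    for K by (rule eventually_cong) (simp only:)
  then show ?thesis by (simp add: Bfun_def)
qed

lemma tendsto_cusp_growth_iff:
  assumes "\<gamma> \<in> SL2Z"
  shows "(cusp_growth k f \<gamma> \<longlongrightarrow> 0) at_i_infinity \<longleftrightarrow> (slash k f \<gamma> \<longlongrightarrow> 0) at_i_infinity"
proof -
  have "eventually (\<lambda>\<tau>. cusp_growth k f \<gamma> \<tau> = norm (slash k f \<gamma> \<tau>)) at_i_infinity"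
    using eventually_upper by eventually_elim (simp add: cusp_growth_eq_norm_slash assms)
  then show ?thesis by (subst tendsto_cong) (auto simp: tendsto_norm_zero_iff)
qed

text \<open>
  Passing from the automorphy factor to \<open>third_factor\<close> moves the characters \<open>c9\<close> and \<open>b9\<close> into the
  multiplier; the growth conditions depend on absolute values only and are not affected.
\<close>

lemma modular_forms_iff_slash:
  assumes "G \<subseteq> SL2Z"
  shows "f \<in> modular_forms G k \<psi> \<longleftrightarrow>
    (\<forall>\<tau>. Im \<tau> \<le> 0 \<longrightarrow> f \<tau> = 0) \<and> f holomorphic_on \<H> \<and>
    (\<forall>\<gamma>\<in>G. \<forall>\<tau>. Im \<tau> > 0 \<longrightarrow> slash k f \<gamma> \<tau> = \<psi> \<gamma> / (c9 \<gamma> * b9 \<gamma>) ^ k * f \<tau>) \<and>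
    (\<forall>\<gamma>\<in>SL2Z. Bfun (slash k f \<gamma>) at_i_infinity)"
proof -
  have "f (act \<gamma> \<tau>) = \<psi> \<gamma> * J_thirds k \<gamma> \<tau> * f \<tau> \<longleftrightarrow>
     slash k f \<gamma> \<tau> = \<psi> \<gamma> / (c9 \<gamma> * b9 \<gamma>) ^ k * f \<tau>" if "\<gamma> \<in> G" "Im \<tau> > 0" for \<gamma> \<tau>
  proof -
    have S: "\<gamma> \<in> SL2Z" using assms that by blast
    have J: "J_thirds k \<gamma> \<tau> = third_factor \<gamma> \<tau> ^ k / (c9 \<gamma> * b9 \<gamma>) ^ k"
      unfolding J_thirds_def J_one_third_conv_third_factor[OF S that(2)] power_mult_distrib
      by (simp add: power_inverse power_mult_distrib divide_inverse)
    show ?thesis unfolding J slash_def using that third_factor_nonzero[OF S that(2)]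
      by (auto simp: divide_eq_eq mult_ac)
  qed
  then show ?thesis unfolding modular_forms_def
    by (auto simp: Bfun_cusp_growth_iff not_less not_le)
qed

section \<open>The two cube roots and their orders at the cusps\<close>

definition Gamma3_diag :: "mat2 set" where "Gamma3_diag = \<Gamma>\<^sub>0 3 \<inter> \<Gamma>\<^sup>0 3"

lemma Gamma3_diag_iff: "\<gamma> \<in> Gamma3_diag \<longleftrightarrow> \<gamma> \<in> SL2Z \<and> 3 dvd \<gamma>$1$2 \<and> 3 dvd \<gamma>$2$1"
  by (auto simp: Gamma3_diag_def Gamma_lower0_def Gamma_upper0_def)

lemma Gamma3_diag_SL2Z: "\<gamma> \<in> Gamma3_diag \<Longrightarrow> \<gamma> \<in> SL2Z"
  by (simp add: Gamma3_diag_iff)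

lemma Gamma3_diag_subset_SL2Z: "Gamma3_diag \<subseteq> SL2Z"
  by (auto simp: Gamma3_diag_iff)

lemma Gamma3_diag_not_dvd:
  fixes \<gamma> :: mat2
  assumes "\<gamma> \<in> Gamma3_diag"
  shows "\<not> 3 dvd \<gamma>$2$2"
proof
  assume "3 dvd \<gamma>$2$2"
  then have "3 dvd \<gamma>$1$1 * \<gamma>$2$2 - \<gamma>$1$2 * \<gamma>$2$1"
    using assms by (intro dvd_diff dvd_mult) (auto simp: Gamma3_diag_iff)
  then show False using assms by (simp add: Gamma3_diag_iff SL2Z_iff)
qed

lemma b9_conv_cis3:
  fixes \<gamma> :: mat2
  assumes "3 dvd \<gamma>$1$2"
  shows "b9 \<gamma> = cis3 (\<gamma>$1$2 div 3 * \<gamma>$2$2)"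
proof -
  obtain k where "\<gamma>$1$2 = 3 * k" using assms by auto
  then show ?thesis by (simp add: b9_def cis3_def mult_ac)
qed

lemma c9_conv_cis3:
  fixes \<gamma> :: mat2
  assumes "3 dvd \<gamma>$2$1"
  shows "c9 \<gamma> = cis3 (- (\<gamma>$2$1 div 3 * \<gamma>$2$2))"
proof -
  obtain k where "\<gamma>$2$1 = 3 * k" using assms by auto
  then show ?thesis by (simp add: c9_def cis3_def mult_ac)
qed

lemma cbrt_eta_bot_conv:
  "Im \<tau> > 0 \<Longrightarrow> cbrt_eta_bot \<tau> = exp (log_eta (\<tau> / 3) - log_eta \<tau> / 3)"
  by (simp add: cbrt_eta_bot_def eta_conv_log_eta eta_pow_conv_log_eta flip: exp_add)

lemma cbrt_eta_top_conv:
  "Im \<tau> > 0 \<Longrightarrow> cbrt_eta_top \<tau> = exp (log_eta (3 * \<tau>) - log_eta \<tau> / 3)"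
  by (simp add: cbrt_eta_top_def eta_conv_log_eta eta_pow_conv_log_eta flip: exp_add)

text \<open>
  Division of the argument by \<open>3\<close> conjugates \<open>\<Gamma>\<^sup>0(3)\<close> into \<open>\<Gamma>\<^sub>0(3)\<close>, where the
  multiplier of \<open>eta_cube_quot3\<close> is known.
\<close>

lemma act_conjugate:
  fixes \<gamma> :: mat2
  assumes "\<gamma> \<in> SL2Z" "3 dvd \<gamma>$1$2" "Im \<tau> > 0"
  shows "act \<gamma> \<tau> / 3 = act (mat22 (\<gamma>$1$1) (\<gamma>$1$2 div 3) (3 * \<gamma>$2$1) (\<gamma>$2$2)) (\<tau> / 3)"
    and "denom \<gamma> \<tau> = denom (mat22 (\<gamma>$1$1) (\<gamma>$1$2 div 3) (3 * \<gamma>$2$1) (\<gamma>$2$2)) (\<tau> / 3)"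
proof -
  obtain k where k: "\<gamma>$1$2 = 3 * k" using assms by auto
  have "of_int (\<gamma>$1$1) * (\<tau> / 3) + of_int k = (of_int (\<gamma>$1$1) * \<tau> + of_int (\<gamma>$1$2)) / 3"
    by (simp add: k field_simps)
  moreover have "of_int (3 * \<gamma>$2$1) * (\<tau> / 3) + of_int (\<gamma>$2$2) = of_int (\<gamma>$2$1) * \<tau> + of_int (\<gamma>$2$2)"
    by simp
  moreover have "\<gamma>$1$2 div 3 = k" by (simp add: k)
  ultimately show "act \<gamma> \<tau> / 3 = act (mat22 (\<gamma>$1$1) (\<gamma>$1$2 div 3) (3 * \<gamma>$2$1) (\<gamma>$2$2)) (\<tau> / 3)"
    by (simp only: act_def mat22_nth divide_divide_eq_left mult.commute[of 3])
  show "denom \<gamma> \<tau> = denom (mat22 (\<gamma>$1$1) (\<gamma>$1$2 div 3) (3 * \<gamma>$2$1) (\<gamma>$2$2)) (\<tau> / 3)"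
    by (simp add: denom_def)
qed

lemma quotient_by_sign:
  fixes s :: complex
  assumes "s * s = 1" "D \<noteq> 0"
  shows "D * X / (s * b * D * U) = s / b * (X / U)"
proof -
  have "inverse s = s" using assms(1) by (rule inverse_unique)
  moreover have "D * X / (s * b * D * U) = inverse s / b * (X / U)"
    using assms(2) by (simp add: divide_inverse mult_ac)
  ultimately show ?thesis by simp
qed

text \<open>
  The root is \<open>\<eta>\<^sup>8\<^sup>/\<^sup>3(\<tau>)\<close> divided by \<open>eta_cube_quot3 (\<tau> / 3)\<close>. The slash operation makes the first
  invariant up to the denominator, so the multiplier is the inverse of that of the second.
\<close>

lemma slash_cbrt_eta_bot:
  fixes \<gamma> :: mat2
  assumes "\<gamma> \<in> Gamma3_diag" "Im \<tau> > 0"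
  shows "slash 1 cbrt_eta_bot \<gamma> \<tau> = chi3 (\<gamma>$2$2) / b9 \<gamma> * cbrt_eta_bot \<tau>"
proof -
  have S: "\<gamma> \<in> SL2Z" "3 dvd \<gamma>$1$2" using assms by (auto simp: Gamma3_diag_iff)
  define D where "D = denom \<gamma> \<tau>"
  have D: "D \<noteq> 0" using denom_nonzero[OF S(1) assms(2)] by (simp add: D_def)
  have det: "\<gamma>$1$1 * \<gamma>$2$2 - \<gamma>$1$2 div 3 * (3 * \<gamma>$2$1) = 1"
    using S by (auto simp: SL2Z_iff)
  have "eta_cube_quot3 (act \<gamma> \<tau> / 3) = chi3 (\<gamma>$2$2) * b9 \<gamma> * D * eta_cube_quot3 (\<tau> / 3)"
    unfolding act_conjugate(1)[OF S assms(2)] using eta_cube_quot3_act[OF det, of "\<tau> / 3"] assms(2)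
    by (simp add: b9_conv_cis3[OF S(2)] D_def act_conjugate(2)[OF S assms(2)])
  moreover have "slash 1 cbrt_eta_bot \<gamma> \<tau> = D * exp (8 / 3 * log_eta \<tau>) / eta_cube_quot3 (act \<gamma> \<tau> / 3)"
  proof -
    have "log_eta (act \<gamma> \<tau> / 3) - log_eta (act \<gamma> \<tau>) / 3 =
        8 / 3 * (log_eta (act \<gamma> \<tau>) - log_eta \<tau>) + 8 / 3 * log_eta \<tau> - (3 * log_eta (act \<gamma> \<tau>) - log_eta (act \<gamma> \<tau> / 3))"
      by (simp add: field_simps)
    then have "cbrt_eta_bot (act \<gamma> \<tau>) = exp (8 / 3 * (log_eta (act \<gamma> \<tau>) - log_eta \<tau>)) * exp (8 / 3 * log_eta \<tau>) / eta_cube_quot3 (act \<gamma> \<tau> / 3)"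
      unfolding cbrt_eta_bot_conv[OF act_in_upper_half_plane[OF S(1) assms(2)]]
      by (simp only: exp_add exp_diff) (simp add: eta_cube_quot3_def exp_diff)
    then show ?thesis using assms(2) by (simp add: slash_def third_factor_def D_def)
  qed
  moreover have "exp (8 / 3 * log_eta \<tau>) / eta_cube_quot3 (\<tau> / 3) = cbrt_eta_bot \<tau>"
    unfolding cbrt_eta_bot_conv[OF assms(2)] eta_cube_quot3_def exp_diff[symmetric] by (simp add: field_simps)
  moreover have "chi3 (\<gamma>$2$2) * chi3 (\<gamma>$2$2) = 1"
    using chi3_square[OF Gamma3_diag_not_dvd[OF assms(1)]] by (simp add: power2_eq_square)
  ultimately show ?thesis by (simp only: quotient_by_sign[OF _ D])
qed

text \<open>
  In the same way, this root is \<open>\<eta>\<^sup>8\<^sup>/\<^sup>3(\<tau>)\<close> divided by \<open>eta_cube_quot1 \<tau>\<close>.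
\<close>

lemma slash_cbrt_eta_top:
  fixes \<gamma> :: mat2
  assumes "\<gamma> \<in> Gamma3_diag" "Im \<tau> > 0"
  shows "slash 1 cbrt_eta_top \<gamma> \<tau> = chi3 (\<gamma>$2$2) / c9 \<gamma> * cbrt_eta_top \<tau>"
proof -
  have S: "\<gamma> \<in> SL2Z" "3 dvd \<gamma>$2$1" using assms by (auto simp: Gamma3_diag_iff)
  define D where "D = denom \<gamma> \<tau>"
  have D: "D \<noteq> 0" using denom_nonzero[OF S(1) assms(2)] by (simp add: D_def)
  have det: "\<gamma>$1$1 * \<gamma>$2$2 - \<gamma>$1$2 * \<gamma>$2$1 = 1"
    using S by (auto simp: SL2Z_iff)
  have "eta_cube_quot1 (act \<gamma> \<tau>) = chi3 (\<gamma>$2$2) * c9 \<gamma> * D * eta_cube_quot1 \<tau>"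
    using eta_cube_quot1_act[OF det S(2) assms(2)] by (simp add: mat22_collapse D_def c9_conv_cis3[OF S(2)])
  moreover have "slash 1 cbrt_eta_top \<gamma> \<tau> = D * exp (8 / 3 * log_eta \<tau>) / eta_cube_quot1 (act \<gamma> \<tau>)"
  proof -
    have "log_eta (3 * act \<gamma> \<tau>) - log_eta (act \<gamma> \<tau>) / 3 =
        8 / 3 * (log_eta (act \<gamma> \<tau>) - log_eta \<tau>) + 8 / 3 * log_eta \<tau> - (3 * log_eta (act \<gamma> \<tau>) - log_eta (3 * act \<gamma> \<tau>))"
      by (simp add: field_simps)
    then have "cbrt_eta_top (act \<gamma> \<tau>) = exp (8 / 3 * (log_eta (act \<gamma> \<tau>) - log_eta \<tau>)) * exp (8 / 3 * log_eta \<tau>) / eta_cube_quot1 (act \<gamma> \<tau>)"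
      unfolding cbrt_eta_top_conv[OF act_in_upper_half_plane[OF S(1) assms(2)]]
      by (simp only: exp_add exp_diff) (simp add: eta_cube_quot1_def exp_diff)
    then show ?thesis using assms(2) by (simp add: slash_def third_factor_def D_def)
  qed
  moreover have "exp (8 / 3 * log_eta \<tau>) / eta_cube_quot1 \<tau> = cbrt_eta_top \<tau>"
    unfolding cbrt_eta_top_conv[OF assms(2)] eta_cube_quot1_def exp_diff[symmetric] by (simp add: field_simps)
  moreover have "chi3 (\<gamma>$2$2) * chi3 (\<gamma>$2$2) = 1"
    using chi3_square[OF Gamma3_diag_not_dvd[OF assms(1)]] by (simp add: power2_eq_square)
  ultimately show ?thesis by (simp only: quotient_by_sign[OF _ D])
qed

text \<open>
  On this group \<open>\<eta>\<^sup>8\<close> has a trivial multiplier: it is \<open>eta_cube_quot1\<^sup>3 eta_cube_quot3\<close>, and the cubic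
  characters and the signs cancel.
\<close>

lemma third_factor_cubed:
  fixes \<gamma> :: mat2
  assumes "\<gamma> \<in> Gamma3_diag" "Im \<tau> > 0"
  shows "third_factor \<gamma> \<tau> ^ 3 = denom \<gamma> \<tau>"
proof -
  have S: "\<gamma> \<in> SL2Z" "3 dvd \<gamma>$1$2" "3 dvd \<gamma>$2$1" using assms by (auto simp: Gamma3_diag_iff)
  have det: "\<gamma>$1$1 * \<gamma>$2$2 - \<gamma>$1$2 * \<gamma>$2$1 = 1"
    using S by (auto simp: SL2Z_iff)
  define D where "D = denom \<gamma> \<tau>"
  have D: "D \<noteq> 0" using denom_nonzero[OF S(1) assms(2)] by (simp add: D_def)
  have eta8: "exp (8 * log_eta z) = eta_cube_quot1 z ^ 3 * eta_cube_quot3 z" for z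
    by (simp add: eta_cube_quot1_def eta_cube_quot3_def flip: exp_of_nat_mult exp_add)
  have chi: "chi3 (\<gamma>$2$2) ^ 3 * chi3 (\<gamma>$2$2) = 1"
    using chi3_square[OF Gamma3_diag_not_dvd[OF assms(1)]] by (simp add: power2_eq_square power3_eq_cube)
  have "exp (8 * log_eta (act \<gamma> \<tau>)) =
     (chi3 (\<gamma>$2$2) ^ 3 * chi3 (\<gamma>$2$2)) * D ^ 4 * exp (8 * log_eta \<tau>)"
  proof -
    define n where "n = - (\<gamma>$2$1 div 3 * \<gamma>$2$2)"
    have 1: "eta_cube_quot1 (act \<gamma> \<tau>) = chi3 (\<gamma>$2$2) * cis3 n * D * eta_cube_quot1 \<tau>"
      using eta_cube_quot1_act[OF det S(3) assms(2)] by (simp add: mat22_collapse D_def n_def)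
    have 3: "eta_cube_quot3 (act \<gamma> \<tau>) = chi3 (\<gamma>$2$2) * D * eta_cube_quot3 \<tau>"
      using eta_cube_quot3_act[OF det S(3) assms(2)] S(2) by (simp add: mat22_collapse D_def cis3_dvd)
    have "cis3 n ^ 3 = 1" unfolding cis3_power by (simp add: cis3_dvd)
    then show ?thesis unfolding eta8 1 3 power_mult_distrib by (simp add: eval_nat_numeral)
  qed
  then have "exp (8 * log_eta (act \<gamma> \<tau>)) = D ^ 4 * exp (8 * log_eta \<tau>)" unfolding chi by simp
  moreover have "third_factor \<gamma> \<tau> ^ 3 = exp (8 * log_eta (act \<gamma> \<tau>) - 8 * log_eta \<tau>) / D ^ 3"
  proof -
    have "of_nat 3 * (8 / 3 * (log_eta (act \<gamma> \<tau>) - log_eta \<tau>)) = 8 * log_eta (act \<gamma> \<tau>) - 8 * log_eta \<tau>"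
      by (simp add: field_simps)
    then show ?thesis unfolding third_factor_def power_divide D_def exp_of_nat_mult[symmetric] by (simp only:)
  qed
  ultimately show ?thesis using D by (simp add: exp_diff D_def eval_nat_numeral)
qed

lemma slash_eta_pow:
  assumes "\<gamma> \<in> SL2Z" "Im \<tau> > 0"
  shows "slash 4 (eta_pow (8/3)) \<gamma> \<tau> = denom \<gamma> \<tau> / third_factor \<gamma> \<tau> ^ 3 * eta_pow (8/3) \<tau>"
proof -
  have "eta_pow (8/3) (act \<gamma> \<tau>) = third_factor \<gamma> \<tau> * denom \<gamma> \<tau> * eta_pow (8/3) \<tau>"
  proof -
    have "8 / 3 * log_eta (act \<gamma> \<tau>) = 8 / 3 * (log_eta (act \<gamma> \<tau>) - log_eta \<tau>) + 8 / 3 * log_eta \<tau>"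
      by (simp add: algebra_simps diff_divide_distrib)
    then have "exp (8 / 3 * log_eta (act \<gamma> \<tau>)) = exp (8 / 3 * (log_eta (act \<gamma> \<tau>) - log_eta \<tau>)) * exp (8 / 3 * log_eta \<tau>)"
      by (simp only: exp_add)
    then show ?thesis
      using denom_nonzero[OF assms] act_in_upper_half_plane[OF assms] assms
      by (simp add: third_factor_def eta_pow_conv_log_eta)
  qed
  then show ?thesis using third_factor_nonzero[OF assms] assms by (simp add: slash_def eval_nat_numeral)
qed

lemma norm_slash_eta_pow:
  assumes "\<gamma> \<in> SL2Z" "Im \<tau> > 0"
  shows "norm (slash 4 (eta_pow (8/3)) \<gamma> \<tau>) = norm (eta_pow (8/3) \<tau>)"
proof -
  have D: "norm (denom \<gamma> \<tau>) > 0" using denom_nonzero[OF assms] by simp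
  then have "(norm (denom \<gamma> \<tau>) powr (1 / 3)) ^ 3 = norm (denom \<gamma> \<tau>)"
    by (simp add: powr_realpow[symmetric] powr_powr)
  then show ?thesis using D by (simp add: slash_eta_pow[OF assms] norm_mult norm_divide norm_power norm_third_factor[OF assms])
qed

lemma eta_pow_growth:
  "\<exists>C. \<forall>\<tau>. Im \<tau> \<ge> 1 \<longrightarrow> norm (eta_pow (8/3) \<tau>) * exp (2 * pi / 9 * Im \<tau>) \<in> {exp (- C)..exp C}"
proof -
  obtain C where C: "\<And>\<tau>. Im \<tau> \<ge> 1 \<Longrightarrow> \<bar>Re (log_eta \<tau>) + pi * Im \<tau> / 12\<bar> \<le> C" using log_eta_growth by blast
  have "norm (eta_pow (8/3) \<tau>) * exp (2 * pi / 9 * Im \<tau>) \<in> {exp (- (8/3 * C))..exp (8/3 * C)}" if "Im \<tau> \<ge> 1" for \<tau>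
  proof -
    have "norm (eta_pow (8/3) \<tau>) * exp (2 * pi / 9 * Im \<tau>) = exp (8 / 3 * (Re (log_eta \<tau>) + pi * Im \<tau> / 12))"
      using that by (simp add: eta_pow_conv_log_eta flip: exp_add)
    then show ?thesis using C[OF that] by (simp add: abs_le_iff)
  qed
  then show ?thesis by blast
qed

text \<open>
  In \<open>\<eta>(3\<tau>) \<eta>(\<tau>)\<^sup>-\<^sup>1\<^sup>/\<^sup>3\<close> the leading exponent is \<open>3/24 - 1/72 = 1/9\<close>, in
  \<open>\<eta>((\<tau> + B)/3) \<eta>(\<tau>)\<^sup>-\<^sup>1\<^sup>/\<^sup>3\<close> it is \<open>1/72 - 1/72 = 0\<close>.
\<close>

lemma Re_log_eta_quotient_growth:
  "\<exists>C. \<forall>\<tau>. Im \<tau> \<ge> 3 \<longrightarrow> \<bar>Re (log_eta (3 * \<tau>)) - Re (log_eta \<tau>) / 3 + 2 * pi / 9 * Im \<tau>\<bar> \<le> C \<and>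
     (\<forall>B::int. \<bar>Re (log_eta ((\<tau> + of_int B) / 3)) - Re (log_eta \<tau>) / 3\<bar> \<le> C)"
proof -
  obtain C where C: "\<And>\<tau>. Im \<tau> \<ge> 1 \<Longrightarrow> \<bar>Re (log_eta \<tau>) + pi * Im \<tau> / 12\<bar> \<le> C" using log_eta_growth by blast
  have tri: "\<bar>x - y / 3\<bar> \<le> 4 / 3 * C" if "\<bar>x\<bar> \<le> C" "\<bar>y\<bar> \<le> C" for x y :: real
    using that by linarith
  show ?thesis
  proof (intro exI[of _ "4 / 3 * C"] allI impI conjI)
    fix \<tau> :: complex assume t: "Im \<tau> \<ge> 3"
    have 1: "\<bar>Re (log_eta \<tau>) + pi * Im \<tau> / 12\<bar> \<le> C" "\<bar>Re (log_eta (3 * \<tau>)) + pi * (3 * Im \<tau>) / 12\<bar> \<le> C"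
      using C[of \<tau>] C[of "3 * \<tau>"] t by auto
    have e: "Re (log_eta (3 * \<tau>)) - Re (log_eta \<tau>) / 3 + 2 * pi / 9 * Im \<tau> =
       (Re (log_eta (3 * \<tau>)) + pi * (3 * Im \<tau>) / 12) - (Re (log_eta \<tau>) + pi * Im \<tau> / 12) / 3"
      by (simp add: field_simps)
    show "\<bar>Re (log_eta (3 * \<tau>)) - Re (log_eta \<tau>) / 3 + 2 * pi / 9 * Im \<tau>\<bar> \<le> 4 / 3 * C"
      unfolding e by (rule tri[OF 1(2,1)])
    fix B :: int
    have 2: "\<bar>Re (log_eta ((\<tau> + of_int B) / 3)) + pi * (Im \<tau> / 3) / 12\<bar> \<le> C"
      using C[of "(\<tau> + of_int B) / 3"] t by simp
    have e: "Re (log_eta ((\<tau> + of_int B) / 3)) - Re (log_eta \<tau>) / 3 =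
       (Re (log_eta ((\<tau> + of_int B) / 3)) + pi * (Im \<tau> / 3) / 12) - (Re (log_eta \<tau>) + pi * Im \<tau> / 12) / 3"
      by (simp add: field_simps)
    show "\<bar>Re (log_eta ((\<tau> + of_int B) / 3)) - Re (log_eta \<tau>) / 3\<bar> \<le> 4 / 3 * C"
      unfolding e by (rule tri[OF 2 1(1)])
  qed
qed

lemma norm_slash_1:
  assumes "\<gamma> \<in> SL2Z" "Im \<tau> > 0" "f (act \<gamma> \<tau>) = exp (w - log_eta (act \<gamma> \<tau>) / 3)"
  shows "norm (slash 1 f \<gamma> \<tau>) = exp (Re w - Re (log_eta \<tau>) / 3 - ln (norm (denom \<gamma> \<tau>)) / 2)"
proof -
  define D where "D = norm (denom \<gamma> \<tau>)"
  have D: "D > 0" using denom_nonzero[OF assms(1,2)] by (simp add: D_def)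
  have "norm (slash 1 f \<gamma> \<tau>) = exp (Re w - Re (log_eta (act \<gamma> \<tau>)) / 3) / exp (1 / 3 * ln D)"
    using assms D by (simp add: slash_def norm_divide norm_third_factor D_def[symmetric] powr_def)
  also have "\<dots> = exp (Re w - Re (log_eta (act \<gamma> \<tau>)) / 3 - 1 / 3 * ln D)"
    by (simp add: exp_diff)
  also have "Re w - Re (log_eta (act \<gamma> \<tau>)) / 3 - 1 / 3 * ln D = Re w - Re (log_eta \<tau>) / 3 - ln D / 2"
    unfolding Re_log_eta_act[OF assms(1,2)] by (simp add: D_def field_simps)
  finally show ?thesis by (simp add: D_def)
qed

lemma mod_3_inverse:
  assumes "\<not> 3 dvd (a::int)"
  shows "\<exists>B. 3 dvd b - a * B"
proof -
  have "3 dvd - (a * a - 1) * b" using square_mod_3[OF assms] by (intro dvd_mult2) (simp only: dvd_minus_iff)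
  then have "3 dvd b - a * (a * b)" by (simp add: algebra_simps)
  then show ?thesis by blast
qed

text \<open>
  The orders of the two roots at the cusps, as bounds from both sides. At the cusp of \<open>\<gamma>\<close> the argument
  of the outer \<open>\<eta>\<close> is an integral matrix of determinant \<open>3\<close> applied to \<open>\<tau>\<close>. It factors into an element
  \<open>\<delta>\<close> of the modular group and one of the upper triangular matrices that send \<open>\<tau>\<close> to \<open>3\<tau>\<close> or to
  \<open>(\<tau> + B)/3\<close>. In the first case the order is \<open>1/9\<close>, in the second it is \<open>0\<close>; which one occurs is decided by
  the divisibility of the first column of \<open>\<gamma>\<close> by \<open>3\<close>.
\<close>

lemma slash_cbrt_eta_growth:
  fixes \<gamma> :: mat2
  assumes "\<gamma> \<in> SL2Z"
  shows slash_cbrt_eta_bot_growth: "\<exists>C. \<forall>\<tau>. Im \<tau> \<ge> 3 \<longrightarrow>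
      norm (slash 1 cbrt_eta_bot \<gamma> \<tau>) * exp (of_bool (3 dvd \<gamma>$1$1) * (2 * pi / 9 * Im \<tau>)) \<in> {exp (- C)..exp C}"
    and slash_cbrt_eta_top_growth: "\<exists>C. \<forall>\<tau>. Im \<tau> \<ge> 3 \<longrightarrow>
      norm (slash 1 cbrt_eta_top \<gamma> \<tau>) * exp (of_bool (3 dvd \<gamma>$2$1) * (2 * pi / 9 * Im \<tau>)) \<in> {exp (- C)..exp C}"
proof -
  obtain C where C: "\<And>\<tau>. Im \<tau> \<ge> 3 \<Longrightarrow> \<bar>Re (log_eta (3 * \<tau>)) - Re (log_eta \<tau>) / 3 + 2 * pi / 9 * Im \<tau>\<bar> \<le> C"
     "\<And>\<tau> B. Im \<tau> \<ge> 3 \<Longrightarrow> \<bar>Re (log_eta ((\<tau> + of_int B) / 3)) - Re (log_eta \<tau>) / 3\<bar> \<le> C"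
    using Re_log_eta_quotient_growth by blast
  define a b c d where "a = \<gamma>$1$1" and "b = \<gamma>$1$2" and "c = \<gamma>$2$1" and "d = \<gamma>$2$2"
  have det: "a * d - b * c = 1" using assms by (simp add: SL2Z_iff a_def b_def c_def d_def)
  have dn: "denom \<gamma> \<tau> = of_int c * \<tau> + of_int d" for \<tau> by (simp add: denom_def c_def d_def)
  have ac: "act \<gamma> \<tau> = (of_int a * \<tau> + of_int b) / (of_int c * \<tau> + of_int d)" for \<tau>
    by (simp add: act_def a_def b_def c_def d_def)
  \<comment> \<open>All four cases at once: \<open>w\<close> is the argument of the outer eta function, \<open>\<kappa>\<close> the ratio of the two denominators.\<close>
  have main: "\<exists>C. \<forall>\<tau>. Im \<tau> \<ge> 3 \<longrightarrow>
      norm (slash 1 f \<gamma> \<tau>) * exp (of_bool p * (2 * pi / 9 * Im \<tau>)) \<in> {exp (- C)..exp C}"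
    if f: "\<And>\<tau>. Im \<tau> > 0 \<Longrightarrow> f \<tau> = exp (log_eta (w \<tau>) - log_eta \<tau> / 3)"
      and \<delta>: "\<delta> \<in> SL2Z" and k: "\<kappa> > 0"
      and den: "\<And>\<tau>. denom \<delta> (if p then 3 * \<tau> else (\<tau> + of_int B) / 3) = of_real \<kappa> * denom \<gamma> \<tau>"
      and w: "\<And>\<tau>. Im \<tau> > 0 \<Longrightarrow> w (act \<gamma> \<tau>) = act \<delta> (if p then 3 * \<tau> else (\<tau> + of_int B) / 3)"
    for f w \<delta> \<kappa> B p
  proof (intro exI[of _ "C + \<bar>ln \<kappa>\<bar>"] allI impI)
    fix \<tau> assume t: "Im \<tau> \<ge> 3"
    define z where "z = (if p then 3 * \<tau> else (\<tau> + of_int B) / 3)"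
    have z: "Im z > 0" using t by (simp add: z_def)
    have t0: "Im \<tau> > 0" using t by simp
    define D where "D = norm (denom \<gamma> \<tau>)"
    have D: "D > 0" using denom_nonzero[OF assms t0] by (simp add: D_def)
    have "f (act \<gamma> \<tau>) = exp (log_eta (act \<delta> z) - log_eta (act \<gamma> \<tau>) / 3)"
      using f[OF act_in_upper_half_plane[OF assms t0]] w[OF t0] by (simp add: z_def)
    from norm_slash_1[where f = f and w = "log_eta (act \<delta> z)", OF assms t0 this]
    have "norm (slash 1 f \<gamma> \<tau>) = exp (Re (log_eta (act \<delta> z)) - Re (log_eta \<tau>) / 3 - ln D / 2)"
      by (simp add: D_def)
    also have "Re (log_eta (act \<delta> z)) = Re (log_eta z) + (ln \<kappa> + ln D) / 2"
      using Re_log_eta_act[OF \<delta> z] den[of \<tau>, folded z_def] D k by (simp add: norm_mult D_def ln_mult)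
    finally have "norm (slash 1 f \<gamma> \<tau>) * exp (of_bool p * (2 * pi / 9 * Im \<tau>)) =
        exp (Re (log_eta z) - Re (log_eta \<tau>) / 3 + of_bool p * (2 * pi / 9 * Im \<tau>) + ln \<kappa> / 2)"
      by (simp add: add_divide_distrib flip: exp_add)
    moreover have "\<bar>Re (log_eta z) - Re (log_eta \<tau>) / 3 + of_bool p * (2 * pi / 9 * Im \<tau>)\<bar> \<le> C"
      using C(1)[OF t] C(2)[OF t, of B] by (simp add: z_def)
    moreover have "exp (x + y / 2) \<in> {exp (- (C + \<bar>y\<bar>))..exp (C + \<bar>y\<bar>)}" if "\<bar>x\<bar> \<le> C" for x y :: real
    proof -
      have "x + y / 2 \<le> C + \<bar>y\<bar>" "- (C + \<bar>y\<bar>) \<le> x + y / 2" using that by linarith+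
      then show ?thesis by simp
    qed
    ultimately show "norm (slash 1 f \<gamma> \<tau>) * exp (of_bool p * (2 * pi / 9 * Im \<tau>)) \<in> {exp (- (C + \<bar>ln \<kappa>\<bar>))..exp (C + \<bar>ln \<kappa>\<bar>)}"
      by (simp only:)
  qed
  have nz: "of_int c * \<tau> + of_int d \<noteq> 0" if "Im \<tau> > 0" for \<tau>
    using denom_nonzero[OF assms that] by (simp add: dn)
  show "\<exists>C. \<forall>\<tau>. Im \<tau> \<ge> 3 \<longrightarrow>
      norm (slash 1 cbrt_eta_bot \<gamma> \<tau>) * exp (of_bool (3 dvd \<gamma>$1$1) * (2 * pi / 9 * Im \<tau>)) \<in> {exp (- C)..exp C}"
    unfolding a_def[symmetric]
  proof (cases "3 dvd a")
    case True
    then obtain a' where a': "a = 3 * a'" by auto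
    show "\<exists>C. \<forall>\<tau>. Im \<tau> \<ge> 3 \<longrightarrow>
      norm (slash 1 cbrt_eta_bot \<gamma> \<tau>) * exp (of_bool (3 dvd a) * (2 * pi / 9 * Im \<tau>)) \<in> {exp (- C)..exp C}"
    proof (rule main[where \<delta> = "mat22 a' b c (3 * d)" and \<kappa> = 3 and B = 0])
      show "mat22 a' b c (3 * d) \<in> SL2Z" using det by (simp add: a')
      fix \<tau> assume t: "Im \<tau> > 0"
      show "cbrt_eta_bot \<tau> = exp (log_eta (\<tau> / 3) - log_eta \<tau> / 3)" by (rule cbrt_eta_bot_conv[OF t])
      show "act \<gamma> \<tau> / 3 = act (mat22 a' b c (3 * d)) (if 3 dvd a then 3 * \<tau> else (\<tau> + of_int 0) / 3)"
      proof -
        have "of_int a' * (3 * \<tau>) + of_int b = of_int a * \<tau> + of_int b"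
          "of_int c * (3 * \<tau>) + of_int (3 * d) = (of_int c * \<tau> + of_int d) * 3"
          by (simp_all add: a' algebra_simps)
        then show ?thesis
          using True by (simp only: ac act_def[of "mat22 _ _ _ _"] mat22_nth if_True) simp
      qed
    qed (use True in \<open>simp_all add: dn denom_def[of "mat22 _ _ _ _"] algebra_simps\<close>)
  next
    case False
    then obtain B where "3 dvd b - a * B" using mod_3_inverse by blast
    then obtain b' where b': "b - a * B = 3 * b'" by auto
    have b: "b = a * B + 3 * b'" using b' by simp
    show "\<exists>C. \<forall>\<tau>. Im \<tau> \<ge> 3 \<longrightarrow>
      norm (slash 1 cbrt_eta_bot \<gamma> \<tau>) * exp (of_bool (3 dvd a) * (2 * pi / 9 * Im \<tau>)) \<in> {exp (- C)..exp C}"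
    proof (rule main[where \<delta> = "mat22 a b' (3 * c) (d - c * B)" and \<kappa> = 1 and B = B])
      show "mat22 a b' (3 * c) (d - c * B) \<in> SL2Z" using det by (simp add: b algebra_simps)
      fix \<tau> assume t: "Im \<tau> > 0"
      show "cbrt_eta_bot \<tau> = exp (log_eta (\<tau> / 3) - log_eta \<tau> / 3)" by (rule cbrt_eta_bot_conv[OF t])
      have "of_int a * ((\<tau> + of_int B) / 3) + of_int b' = (of_int a * \<tau> + of_int b) / 3"
        by (simp add: b field_simps)
      moreover have "of_int (3 * c) * ((\<tau> + of_int B) / 3) + of_int (d - c * B) = of_int c * \<tau> + of_int d"
        by (simp add: field_simps)
      ultimately show "act \<gamma> \<tau> / 3 = act (mat22 a b' (3 * c) (d - c * B)) (if 3 dvd a then 3 * \<tau> else (\<tau> + of_int B) / 3)"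
        using False by (simp only: ac act_def[of "mat22 _ _ _ _"] mat22_nth if_False) simp
    qed (use False in \<open>simp_all add: dn denom_def[of "mat22 _ _ _ _"] field_simps\<close>)
  qed
  show "\<exists>C. \<forall>\<tau>. Im \<tau> \<ge> 3 \<longrightarrow>
      norm (slash 1 cbrt_eta_top \<gamma> \<tau>) * exp (of_bool (3 dvd \<gamma>$2$1) * (2 * pi / 9 * Im \<tau>)) \<in> {exp (- C)..exp C}"
    unfolding c_def[symmetric]
  proof (cases "3 dvd c")
    case True
    then obtain c' where c': "c = 3 * c'" by auto
    show "\<exists>C. \<forall>\<tau>. Im \<tau> \<ge> 3 \<longrightarrow>
      norm (slash 1 cbrt_eta_top \<gamma> \<tau>) * exp (of_bool (3 dvd c) * (2 * pi / 9 * Im \<tau>)) \<in> {exp (- C)..exp C}"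
    proof (rule main[where \<delta> = "mat22 a (3 * b) c' d" and \<kappa> = 1 and B = 0])
      show "mat22 a (3 * b) c' d \<in> SL2Z" using det by (simp add: c')
      fix \<tau> assume t: "Im \<tau> > 0"
      show "cbrt_eta_top \<tau> = exp (log_eta (3 * \<tau>) - log_eta \<tau> / 3)" by (rule cbrt_eta_top_conv[OF t])
      show "3 * act \<gamma> \<tau> = act (mat22 a (3 * b) c' d) (if 3 dvd c then 3 * \<tau> else (\<tau> + of_int 0) / 3)"
      proof -
        have "of_int a * (3 * \<tau>) + of_int (3 * b) = 3 * (of_int a * \<tau> + of_int b)"
          "of_int c' * (3 * \<tau>) + of_int d = of_int c * \<tau> + of_int d"
          by (simp_all add: c' algebra_simps)
        then show ?thesis
          using True by (simp only: ac act_def[of "mat22 _ _ _ _"] mat22_nth if_True) simp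
      qed
    qed (use True in \<open>simp_all add: dn denom_def[of "mat22 _ _ _ _"] algebra_simps c'\<close>)
  next
    case False
    then obtain B where "3 dvd d - c * B" using mod_3_inverse by blast
    then obtain d' where d': "d - c * B = 3 * d'" by auto
    have d: "d = c * B + 3 * d'" using d' by simp
    show "\<exists>C. \<forall>\<tau>. Im \<tau> \<ge> 3 \<longrightarrow>
      norm (slash 1 cbrt_eta_top \<gamma> \<tau>) * exp (of_bool (3 dvd c) * (2 * pi / 9 * Im \<tau>)) \<in> {exp (- C)..exp C}"
    proof (rule main[where \<delta> = "mat22 (3 * a) (b - a * B) c d'" and \<kappa> = "1/3" and B = B])
      show "mat22 (3 * a) (b - a * B) c d' \<in> SL2Z" using det by (simp add: d algebra_simps)
      fix \<tau> assume t: "Im \<tau> > 0"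
      show "cbrt_eta_top \<tau> = exp (log_eta (3 * \<tau>) - log_eta \<tau> / 3)" by (rule cbrt_eta_top_conv[OF t])
      have "of_int c * ((\<tau> + of_int B) / 3) + of_int d' = (of_int c * \<tau> + of_int d) / 3"
        by (simp add: d field_simps)
      moreover have "of_int (3 * a) * ((\<tau> + of_int B) / 3) + of_int (b - a * B) = of_int a * \<tau> + of_int b"
        by (simp add: field_simps)
      ultimately show "3 * act \<gamma> \<tau> = act (mat22 (3 * a) (b - a * B) c d') (if 3 dvd c then 3 * \<tau> else (\<tau> + of_int B) / 3)"
        using False by (simp only: ac act_def[of "mat22 _ _ _ _"] mat22_nth if_False) simp
    qed (use False in \<open>simp_all add: dn denom_def[of "mat22 _ _ _ _"] field_simps d\<close>)
  qed
qed

section \<open>Periodic functions on the half plane\<close>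

lemma periodic_int:
  fixes F :: "complex \<Rightarrow> complex"
  assumes "\<And>\<tau>. Im \<tau> > 0 \<Longrightarrow> F (\<tau> + of_real h) = F \<tau>" "Im \<tau> > 0"
  shows "F (\<tau> + of_int n * of_real h) = F \<tau>"
proof (induction n rule: int_translate_induct)
  case (2 n)
  have "F (\<tau> + of_int (n + 1) * of_real h) = F ((\<tau> + of_int n * of_real h) + of_real h)"
    by (simp add: algebra_simps)
  with 2 assms(1)[of "\<tau> + of_int n * of_real h"] assms(2) show ?case by simp
next
  case (3 n)
  have "F (\<tau> + of_int n * of_real h) = F ((\<tau> + of_int (n - 1) * of_real h) + of_real h)"
    by (simp add: algebra_simps)
  with 3 assms(1)[of "\<tau> + of_int (n - 1) * of_real h"] assms(2) show ?case by simp
qed simp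

text \<open>
  A periodic function is a function of \<open>exp (2 \<pi> i \<tau> / h)\<close> on the punctured disc. If it grows
  less than the inverse of this variable, the singularity at the origin is removable.
\<close>

lemma periodic_extends_to_disc:
  assumes hol: "F holomorphic_on \<H>" and h: "h > 0"
    and per: "\<And>\<tau>. Im \<tau> > 0 \<Longrightarrow> F (\<tau> + of_real h) = F \<tau>"
    and lim: "((\<lambda>\<tau>. F \<tau> * exp (2 * of_real pi * \<i> * \<tau> / of_real h)) \<longlongrightarrow> 0) at_i_infinity"
  shows "\<exists>G. G holomorphic_on ball 0 1 \<and> (\<forall>\<tau>. Im \<tau> > 0 \<longrightarrow> F \<tau> = G (exp (2 * of_real pi * \<i> * \<tau> / of_real h)))"
proof -
  define e where "e \<tau> = exp (2 * of_real pi * \<i> * \<tau> / of_real h)" for \<tau>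
  define l where "l w = of_real h * w / (2 * of_real pi * \<i>)" for w :: complex
  have el: "e (l w) = exp w" for w using h by (simp add: e_def l_def)
  have Im_l: "Im (l w) = - h * Re w / (2 * pi)" for w
    using h by (simp add: l_def Im_divide power2_eq_square)
  have norm_e: "norm (e \<tau>) = exp (- 2 * pi * Im \<tau> / h)" for \<tau>
    using h by (simp add: e_def)
  have Fe: "F \<sigma> = F \<tau>" if eq: "e \<sigma> = e \<tau>" and pos: "Im \<tau> > 0" for \<sigma> \<tau>
  proof -
    obtain n :: int where n: "2 * of_real pi * \<i> * \<sigma> / of_real h = 2 * of_real pi * \<i> * \<tau> / of_real h + (of_int (2 * n) * pi) * \<i>"
      using eq unfolding e_def exp_eq by blast
    have "(2 * of_real pi * \<i>) * \<sigma> = of_real h * (2 * of_real pi * \<i> * \<sigma> / of_real h)"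
      using h by simp
    also have "\<dots> = (2 * of_real pi * \<i>) * (\<tau> + of_int n * of_real h)"
      unfolding n using h by (simp add: distrib_left mult_ac)
    finally have "(2 * of_real pi * \<i>) * \<sigma> = (2 * of_real pi * \<i>) * (\<tau> + of_int n * of_real h)" .
    then have "\<sigma> = \<tau> + of_int n * of_real h" by (simp only: mult_cancel_left) simp
    then show ?thesis using periodic_int[where F = F, OF per pos] by simp
  qed
  define g where "g w = F (l (Ln w))" for w
  have Im_pos: "Im (l z) > 0" if "norm (exp z) < 1" for z
    using that h by (simp add: Im_l divide_neg_pos mult_pos_neg)
  have ge: "g (e \<tau>) = F \<tau>" if "Im \<tau> > 0" for \<tau>
  proof -
    have "e (l (Ln (e \<tau>))) = e \<tau>" by (simp add: el) (simp add: e_def)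
    then show ?thesis unfolding g_def using Fe that by blast
  qed
  have g_hol: "g holomorphic_on ball 0 1 - {0}"
    unfolding holomorphic_on_def
  proof
    fix w0 :: complex assume w0: "w0 \<in> ball 0 1 - {0}"
    \<comment> \<open>The principal logarithm jumps, but by periodicity any local branch gives the same \<open>g\<close>.\<close>
    define S where "S = ball 0 1 \<inter> ball w0 (norm w0)"
    have S: "open S" "w0 \<in> S" using w0 by (auto simp: S_def)
    have slit: "w / w0 \<notin> \<real>\<^sub>\<le>\<^sub>0" "w \<noteq> 0" if "w \<in> S" for w
    proof -
      have d: "norm (w0 - w) < norm w0" using that by (simp add: S_def dist_norm)
      then show "w \<noteq> 0" by auto
      have "norm (1 - w / w0) < 1"
      proof -
        have "1 - w / w0 = (w0 - w) / w0" using w0 by (simp add: field_simps)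
        then show ?thesis using d w0 by (simp add: norm_divide)
      qed
      then have "Re (w / w0) > 0" using complex_Re_le_cmod[of "1 - w / w0"] by simp
      then show "w / w0 \<notin> \<real>\<^sub>\<le>\<^sub>0" by (auto simp: complex_nonpos_Reals_iff)
    qed
    define b where "b w = l (Ln (w / w0) + Ln w0)" for w
    have eb: "e (b w) = w" if "w \<in> S" for w
      using slit[OF that] w0 by (simp add: b_def el exp_add)
    have bpos: "Im (b w) > 0" if "w \<in> S" for w
      unfolding b_def using Im_pos[of "Ln (w / w0) + Ln w0"] that slit[OF that] w0
      by (simp add: exp_add S_def)
    have "b holomorphic_on S"
      unfolding b_def l_def using slit w0 by (intro holomorphic_intros) auto
    then have "(F \<circ> b) holomorphic_on S"
      by (rule holomorphic_on_compose_gen[OF _ hol]) (use bpos in auto)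
    moreover have "g w = F (b w)" if "w \<in> S" for w
      using ge[OF bpos[OF that]] eb[OF that] by simp
    ultimately have "g holomorphic_on S"
      by (subst holomorphic_cong[OF refl, of S g "F \<circ> b"]) auto
    then show "g field_differentiable at w0 within ball 0 1 - {0}"
      using S holomorphic_on_imp_differentiable_at field_differentiable_at_within by blast
  qed
  have "((\<lambda>w. g w * w) \<longlongrightarrow> 0) (at 0)"
  proof -
    have "filterlim (\<lambda>w. Im (l (Ln w))) at_top (at 0)"
    proof -
      have "filterlim (\<lambda>w::complex. norm w) (at_right 0) (at 0)"
        unfolding filterlim_at by (auto simp: eventually_at_filter intro!: tendsto_eq_intros)
      then have "filterlim (\<lambda>w::complex. ln (norm w)) at_bot (at 0)"
        by (rule filterlim_compose[OF ln_at_0])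
      then have "filterlim (\<lambda>w::complex. (h / (2 * pi)) * (- ln (norm w))) at_top (at 0)"
        unfolding filterlim_uminus_at_bot
        by (intro filterlim_tendsto_pos_mult_at_top[OF tendsto_const]) (use h in auto)
      moreover have ev: "eventually (\<lambda>w::complex. (h / (2 * pi)) * (- ln (norm w)) = Im (l (Ln w))) (at 0)"
        by (auto simp: eventually_at_filter Im_l)
      ultimately show ?thesis by (simp only: filterlim_cong[OF refl refl ev])
    qed
    then have "filterlim (\<lambda>w. l (Ln w)) at_i_infinity (at 0)"
      by (simp add: filterlim_filtercomap_iff o_def)
    from filterlim_compose[OF lim this]
    have "((\<lambda>w. F (l (Ln w)) * e (l (Ln w))) \<longlongrightarrow> 0) (at 0)" by (simp add: e_def)
    then show ?thesis
      by (rule Lim_transform_eventually) (auto simp: eventually_at_filter g_def el)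
  qed
  then have "((\<lambda>w. (w - 0) * g w) \<longlongrightarrow> 0) (at 0)" by (simp add: mult.commute)
  then have "\<exists>G. G holomorphic_on ball 0 1 \<and> (\<forall>w\<in>ball 0 1 - {0}. G w = g w)"
    using holomorphic_on_extend_lim[OF g_hol] by (simp add: interior_open)
  then obtain G where G: "G holomorphic_on ball 0 1" "\<And>w. w \<in> ball 0 1 - {0} \<Longrightarrow> G w = g w" by blast
  have "F \<tau> = G (e \<tau>)" if "Im \<tau> > 0" for \<tau>
  proof -
    have "e \<tau> \<in> ball 0 1 - {0}" using that h norm_e[of \<tau>] by (simp add: e_def divide_neg_pos)
    then show ?thesis using G(2) ge[OF that] by simp
  qed
  with G(1) show ?thesis unfolding e_def by blast
qed

lemma periodic_bounded:
  assumes hol: "F holomorphic_on \<H>" and h: "h > 0"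
    and per: "\<And>\<tau>. Im \<tau> > 0 \<Longrightarrow> F (\<tau> + of_real h) = F \<tau>"
    and lim: "((\<lambda>\<tau>. F \<tau> * exp (2 * of_real pi * \<i> * \<tau> / of_real h)) \<longlongrightarrow> 0) at_i_infinity"
  shows "Bfun F at_i_infinity"
proof -
  obtain G where G: "G holomorphic_on ball 0 1"
    "\<And>\<tau>. Im \<tau> > 0 \<Longrightarrow> F \<tau> = G (exp (2 * of_real pi * \<i> * \<tau> / of_real h))"
    using periodic_extends_to_disc[OF assms] by blast
  have "compact (G ` cball 0 (1/2))"
    by (intro compact_continuous_image holomorphic_on_imp_continuous_on holomorphic_on_subset[OF G(1)]) auto
  then have "bounded (G ` cball 0 (1/2))" by (rule compact_imp_bounded)
  then obtain B where "\<forall>z\<in>G ` cball 0 (1/2). norm z \<le> B"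
    unfolding bounded_iff by blast
  then have B: "norm (G w) \<le> B" if "norm w \<le> 1 / 2" for w
    using that by simp
  have "norm (F \<tau>) \<le> B" if "Im \<tau> \<ge> h" for \<tau>
  proof -
    have "exp (- 2 * pi * Im \<tau> / h) \<le> exp (- 1)"
    proof -
      have "1 * 1 \<le> (2 * pi) * (Im \<tau> / h)"
        using that h pi_gt3 by (intro mult_mono) auto
      then show ?thesis by simp
    qed
    also have "exp (- 1) \<le> (1 / 2 :: real)"
      using exp_ge_add_one_self[of 1] by (simp add: exp_minus field_simps)
    finally have "norm (exp (2 * of_real pi * \<i> * \<tau> / of_real h)) \<le> 1 / 2" using h by simp
    then show ?thesis using G(2)[of \<tau>] B that h by simp
  qed
  then show ?thesis
    by (intro BfunI[of _ B]) (auto simp: eventually_at_i_infinity)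
qed

lemma tendsto_exp_minus_Im:
  assumes "c > 0"
  shows "((\<lambda>\<tau>. exp (- c * Im \<tau>)) \<longlongrightarrow> 0) at_i_infinity"
proof -
  have "((\<lambda>y. exp (- c * y)) \<longlongrightarrow> 0) at_top" using assms by real_asymp
  from filterlim_compose[OF this filterlim_filtercomap] show ?thesis .
qed

text \<open>
  The factor \<open>exp (2 \<pi> i \<theta>)\<close> under the translation forces the exponents of the expansion into
  \<open>(\<theta> + \<int>) / h\<close>. If those below \<open>\<theta> / h\<close> are excluded by the growth assumption, the leading
  exponent is at least \<open>\<theta> / h\<close>.
\<close>

lemma quasi_periodic_decay_criterion:
  assumes hol: "F holomorphic_on \<H>" and h: "h > 0"
    and per: "\<And>\<tau>. Im \<tau> > 0 \<Longrightarrow> F (\<tau> + of_real h) = exp (2 * of_real pi * \<i> * of_real \<theta>) * F \<tau>"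
    and lim: "((\<lambda>\<tau>. norm (F \<tau>) * exp (- (2 * pi * (1 - \<theta>) / h) * Im \<tau>)) \<longlongrightarrow> 0) at_i_infinity"
  shows "Bfun (\<lambda>\<tau>. norm (F \<tau>) * exp (2 * pi * \<theta> / h * Im \<tau>)) at_i_infinity"
proof -
  define F' where "F' \<tau> = F \<tau> * exp (- (2 * of_real pi * \<i> * of_real \<theta> * \<tau> / of_real h))" for \<tau>
  have n: "norm (F' \<tau>) = norm (F \<tau>) * exp (2 * pi * \<theta> / h * Im \<tau>)" for \<tau>
    using h by (simp add: F'_def norm_mult)
  have "Bfun F' at_i_infinity"
  proof (rule periodic_bounded[OF _ h])
    show "F' holomorphic_on \<H>" unfolding F'_def using hol h by (intro holomorphic_intros) auto
    show "F' (\<tau> + of_real h) = F' \<tau>" if "Im \<tau> > 0" for \<tau>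
    proof -
      have "- (2 * of_real pi * \<i> * of_real \<theta> * (\<tau> + of_real h) / of_real h) =
         - (2 * of_real pi * \<i> * of_real \<theta> * \<tau> / of_real h) + - (2 * of_real pi * \<i> * of_real \<theta>)"
        using h by (simp add: field_simps)
      then show ?thesis unfolding F'_def per[OF that]
        by (simp only: exp_add) (simp add: exp_minus)
    qed
    have eq: "norm (F' \<tau> * exp (2 * of_real pi * \<i> * \<tau> / of_real h)) =
        norm (F \<tau>) * exp (- (2 * pi * (1 - \<theta>) / h) * Im \<tau>)" for \<tau>
    proof -
      have "norm (F' \<tau> * exp (2 * of_real pi * \<i> * \<tau> / of_real h)) =
          norm (F \<tau>) * (exp (2 * pi * \<theta> / h * Im \<tau>) * exp (- 2 * pi * Im \<tau> / h))"
        using h by (simp add: norm_mult n)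
      also have "exp (2 * pi * \<theta> / h * Im \<tau>) * exp (- 2 * pi * Im \<tau> / h) = exp (- (2 * pi * (1 - \<theta>) / h) * Im \<tau>)"
        using h by (simp add: field_simps flip: exp_add)
      finally show ?thesis .
    qed
    show "((\<lambda>\<tau>. F' \<tau> * exp (2 * of_real pi * \<i> * \<tau> / of_real h)) \<longlongrightarrow> 0) at_i_infinity"
      by (rule tendsto_norm_zero_cancel) (use lim in \<open>simp only: eq\<close>)
  qed
  then show ?thesis unfolding Bfun_def n[symmetric] by simp
qed

text \<open>
  For \<open>\<theta> < 1\<close> boundedness excludes the exponents \<open>(\<theta> - n) / h\<close> with \<open>n \<ge> 1\<close>, all of which are negative.
\<close>

lemma quasi_periodic_decay:
  assumes hol: "F holomorphic_on \<H>" and h: "h > 0" and \<theta>: "\<theta> < 1"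
    and per: "\<And>\<tau>. Im \<tau> > 0 \<Longrightarrow> F (\<tau> + of_real h) = exp (2 * of_real pi * \<i> * of_real \<theta>) * F \<tau>"
    and bdd: "Bfun F at_i_infinity"
  shows "Bfun (\<lambda>\<tau>. norm (F \<tau>) * exp (2 * pi * \<theta> / h * Im \<tau>)) at_i_infinity"
proof (rule quasi_periodic_decay_criterion[OF hol h per])
  define c where "c = 2 * pi * (1 - \<theta>) / h"
  have c: "c > 0" using h \<theta> by (simp add: c_def)
  obtain B where B: "eventually (\<lambda>\<tau>. norm (F \<tau>) \<le> B) at_i_infinity" using bdd unfolding Bfun_def by blast
  have "((\<lambda>\<tau>. norm (F \<tau>) * exp (- c * Im \<tau>)) \<longlongrightarrow> 0) at_i_infinity"
  proof (rule Lim_null_comparison)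
    show "eventually (\<lambda>\<tau>. norm (norm (F \<tau>) * exp (- c * Im \<tau>)) \<le> B * exp (- c * Im \<tau>)) at_i_infinity"
      using B by eventually_elim (simp add: mult_right_mono)
    show "((\<lambda>\<tau>. B * exp (- c * Im \<tau>)) \<longlongrightarrow> 0) at_i_infinity"
      using tendsto_mult_left[OF tendsto_exp_minus_Im[OF c], of B] by simp
  qed
  then show "((\<lambda>\<tau>. norm (F \<tau>) * exp (- (2 * pi * (1 - \<theta>) / h) * Im \<tau>)) \<longlongrightarrow> 0) at_i_infinity"
    by (simp only: c_def)
qed

text \<open>
  The criterion with \<open>\<theta> = 1\<close>: a function of period \<open>h\<close> that tends to \<open>0\<close> has leading exponent at least \<open>1 / h\<close>.
\<close>

lemma periodic_vanishing_decay:
  assumes hol: "F holomorphic_on \<H>" and h: "h > 0"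
    and per: "\<And>\<tau>. Im \<tau> > 0 \<Longrightarrow> F (\<tau> + of_real h) = F \<tau>"
    and lim: "(F \<longlongrightarrow> 0) at_i_infinity"
  shows "Bfun (\<lambda>\<tau>. norm (F \<tau>) * exp (2 * pi / h * Im \<tau>)) at_i_infinity"
  using quasi_periodic_decay_criterion[OF hol h, of 1] per tendsto_norm_zero[OF lim] by simp

section \<open>Forms of negative weight\<close>

text \<open>
  Among all \<open>\<gamma>\<close> one with the least denominator \<open>|c\<tau> + d|\<close> is chosen, that is, the greatest imaginary
  part of \<open>\<gamma>\<tau>\<close>, and a translation brings the real part close to \<open>0\<close>. The minimality, applied to the
  inversion, gives \<open>|\<sigma>| \<ge> 1\<close>.
\<close>

lemma fundamental_domain:
  assumes \<tau>: "Im \<tau> > 0"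
  shows "\<exists>\<gamma>\<in>SL2Z. \<exists>\<sigma>. \<tau> = act \<gamma> \<sigma> \<and> \<bar>Re \<sigma>\<bar> \<le> 1 / 2 \<and> Im \<sigma> \<ge> 1 / 2"
proof -
  define nd where "nd p = norm (of_int (fst p) * \<tau> + of_int (snd p))" for p :: "int \<times> int"
  define row where "row \<gamma> = (\<gamma>$2$1, \<gamma>$2$2)" for \<gamma> :: mat2
  have nd: "nd (row \<gamma>) = norm (denom \<gamma> \<tau>)" for \<gamma> by (simp add: nd_def row_def denom_def)
  \<comment> \<open>Only finitely many lower rows give a denominator of norm at most \<open>1\<close>, the value at the identity.\<close>
  define P where "P = {p \<in> row ` SL2Z. nd p \<le> 1}"
  define N where "N = \<lceil>max (1 / Im \<tau>) (1 + norm \<tau> / Im \<tau>)\<rceil>"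
  have "P \<subseteq> {-N..N} \<times> {-N..N}"
  proof
    fix p assume "p \<in> P"
    obtain c d where p: "p = (c, d)" by (cases p)
    have le: "norm (of_int c * \<tau> + of_int d) \<le> 1" using \<open>p \<in> P\<close> by (simp add: P_def nd_def p)
    have "\<bar>of_int c\<bar> * Im \<tau> = \<bar>Im (of_int c * \<tau> + of_int d)\<bar>" using \<tau> by (simp add: abs_mult)
    also have "\<dots> \<le> 1" using le abs_Im_le_cmod order_trans by blast
    finally have c: "\<bar>of_int c\<bar> \<le> 1 / Im \<tau>" using \<tau> by (simp add: field_simps)
    have "\<bar>real_of_int d\<bar> = norm ((of_int c * \<tau> + of_int d) - of_int c * \<tau>)" by simp
    also have "\<dots> \<le> 1 + \<bar>of_int c\<bar> * norm \<tau>"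
      using norm_triangle_ineq4[of "of_int c * \<tau> + of_int d" "of_int c * \<tau>"] le by (simp add: norm_mult)
    also have "\<dots> \<le> 1 + 1 / Im \<tau> * norm \<tau>" using c by (intro add_left_mono mult_right_mono) auto
    finally have d: "\<bar>real_of_int d\<bar> \<le> 1 + norm \<tau> / Im \<tau>" by simp
    have "real_of_int \<bar>c\<bar> \<le> of_int N" "real_of_int \<bar>d\<bar> \<le> of_int N"
      using c d unfolding N_def by (auto intro: order_trans[OF _ le_of_int_ceiling])
    then have "\<bar>c\<bar> \<le> N" "\<bar>d\<bar> \<le> N" by (simp_all only: of_int_le_iff)
    then show "p \<in> {-N..N} \<times> {-N..N}" by (auto simp: p)
  qed
  then have fin: "finite P" by (rule finite_subset) auto
  have "row (mat 1) \<in> P" by (auto simp: P_def nd)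
  then obtain p where p: "p \<in> P" "\<And>p'. p' \<in> P \<Longrightarrow> nd p \<le> nd p'"
    using ex_min_if_finite[of "nd ` P"] fin by (metis (no_types, lifting) empty_iff finite_imageI imageE image_eqI not_le)
  then obtain \<gamma> where \<gamma>: "\<gamma> \<in> SL2Z" "p = row \<gamma>" by (auto simp: P_def)
  have min: "norm (denom \<gamma> \<tau>) \<le> norm (denom \<delta> \<tau>)" if "\<delta> \<in> SL2Z" for \<delta>
  proof (cases "nd (row \<delta>) \<le> 1")
    case True
    then show ?thesis using p(2)[of "row \<delta>"] that \<gamma> by (auto simp: P_def nd)
  next
    case False
    then show ?thesis using p(1) \<gamma> by (auto simp: P_def nd)
  qed
  define n where "n = round (Re (act \<gamma> \<tau>))"
  define T where "T = mat22 1 (- n) 0 1"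
  define S where "S = mat22 0 (- 1) 1 0"
  have TS: "T \<in> SL2Z" "S \<in> SL2Z" by (simp_all add: T_def S_def)
  define \<sigma> where "\<sigma> = act (T ** \<gamma>) \<tau>"
  have TG: "T ** \<gamma> \<in> SL2Z" using TS \<gamma> by (simp add: SL2Z_mult)
  have \<sigma>: "\<sigma> = act \<gamma> \<tau> - of_int n"
  proof -
    have "act T z = z - of_int n" for z by (simp add: act_def T_def)
    then show ?thesis unfolding \<sigma>_def act_mult[OF TS(1) \<gamma>(1) \<tau>] by simp
  qed
  have re: "\<bar>Re \<sigma>\<bar> \<le> 1 / 2"
    using of_int_round_abs_le[of "Re (act \<gamma> \<tau>)"] by (simp add: \<sigma> n_def abs_minus_commute)
  have pos: "norm (denom \<gamma> \<tau>) > 0" using denom_nonzero[OF \<gamma>(1) \<tau>] by simp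
  have "denom (T ** \<gamma>) \<tau> = denom \<gamma> \<tau>"
    by (simp add: denom_mult[OF \<gamma>(1) \<tau>]) (simp add: denom_def T_def)
  have "denom (S ** (T ** \<gamma>)) \<tau> = \<sigma> * denom \<gamma> \<tau>"
  proof -
    have "denom S z = z" for z by (simp add: denom_def S_def)
    then show ?thesis using \<open>denom (T ** \<gamma>) \<tau> = denom \<gamma> \<tau>\<close>
      unfolding denom_mult[OF TG \<tau>] \<sigma>_def[symmetric] by simp
  qed
  then have "norm (denom \<gamma> \<tau>) * 1 \<le> norm (denom \<gamma> \<tau>) * norm \<sigma>"
    using min[OF SL2Z_mult[OF TS(2) TG]] by (simp add: norm_mult mult.commute)
  then have "1 \<le> norm \<sigma>" using pos by simp
  then have "1 \<le> (Re \<sigma>)\<^sup>2 + (Im \<sigma>)\<^sup>2" by (simp add: cmod_power2[symmetric])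
  moreover have "(Re \<sigma>)\<^sup>2 \<le> (1 / 2)\<^sup>2" using re by (simp add: abs_le_square_iff[symmetric])
  ultimately have "(1 / 2)\<^sup>2 \<le> (Im \<sigma>)\<^sup>2" by (simp add: power2_eq_square)
  moreover have "Im \<sigma> > 0" unfolding \<sigma>_def by (rule act_in_upper_half_plane[OF TG \<tau>])
  ultimately have im: "1 / 2 \<le> Im \<sigma>" by (simp only: power2_le_iff_abs_le[of "Im \<sigma>"] abs_le_square_iff[symmetric])
  have "act (adjugate (T ** \<gamma>)) \<sigma> = \<tau>"
    unfolding \<sigma>_def using act_mult[OF adjugate_SL2Z[OF TG] TG \<tau>] by (simp add: adjugate_left[OF TG])
  then show ?thesis using adjugate_SL2Z[OF TG] re im by metis
qed

abbreviation (input) Gamma9 :: "mat2 set" where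
  "Gamma9 \<equiv> principal_congruence_subgroup 9"

text \<open>
  Cosets of \<open>\<Gamma>(9)\<close> in the modular group are distinguished by the entries modulo \<open>9\<close>, so there are
  finitely many of them.
\<close>

definition residue9 :: "mat2 \<Rightarrow> int \<times> int \<times> int \<times> int" where
  "residue9 \<gamma> = (\<gamma>$1$1 mod 9, \<gamma>$1$2 mod 9, \<gamma>$2$1 mod 9, \<gamma>$2$2 mod 9)"

lemma finite_residue9: "finite (residue9 ` X)"
proof (rule finite_subset)
  show "residue9 ` X \<subseteq> {0..<9} \<times> {0..<9} \<times> {0..<9} \<times> {0..<9}" by (auto simp: residue9_def)
qed auto

lemma Gamma9_subset_SL2Z: "Gamma9 \<subseteq> SL2Z"
  by (auto simp: principal_congruence_subgroup_def)

lemma Gamma9_iff: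
  "\<gamma> \<in> Gamma9 \<longleftrightarrow> \<gamma> \<in> SL2Z \<and> residue9 \<gamma> = (1, 0, 0, 1)"
  by (auto simp: principal_congruence_subgroup_def residue9_def cong_def)

lemma residue9_quotient:
  assumes "\<gamma> \<in> SL2Z" "\<delta> \<in> SL2Z" "residue9 \<gamma> = residue9 \<delta>"
  shows "\<gamma> ** adjugate \<delta> \<in> Gamma9"
proof -
  have c: "[\<gamma>$1$1 = \<delta>$1$1] (mod 9)" "[\<gamma>$1$2 = \<delta>$1$2] (mod 9)" "[\<gamma>$2$1 = \<delta>$2$1] (mod 9)" "[\<gamma>$2$2 = \<delta>$2$2] (mod 9)"
    using assms(3) by (simp_all add: residue9_def cong_def)
  have "residue9 (\<gamma> ** adjugate \<delta>) = residue9 (\<delta> ** adjugate \<delta>)"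
    using c unfolding residue9_def mat2_mult_nth adjugate_nth prod.inject cong_def[symmetric]
    by (intro conjI cong_add cong_mult cong_refl)
  also have "\<delta> ** adjugate \<delta> = mat 1" by (rule adjugate_right[OF assms(2)])
  finally show ?thesis
    using SL2Z_mult[OF assms(1) adjugate_SL2Z[OF assms(2)]] by (simp add: Gamma9_iff residue9_def)
qed

text \<open>
  There are finitely many cosets of \<open>\<Gamma>(9)\<close>, and \<open>g\<close> is bounded at all cusps, so reduction theory
  gives \<open>|g(\<tau>)| \<le> C (Im \<tau>)\<^sup>-\<^sup>w\<^sup>/\<^sup>2\<close> on the whole half plane. Since \<open>w < 0\<close>, the bound tends to \<open>0\<close> at the real line. As a
  function of \<open>exp (2 \<pi> i \<tau> / 9)\<close> on the disc, \<open>g\<close> therefore vanishes by the maximum principle.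
  The invariance concerns absolute values, apart from the translation by \<open>9\<close>, so it makes sense for
  real weights without a choice of automorphy factors.
\<close>

theorem negative_weight_vanishes:
  fixes g :: "complex \<Rightarrow> complex" and w :: real
  assumes hol: "g holomorphic_on \<H>" and w: "w < 0"
    and inv: "\<And>\<gamma> \<tau>. \<gamma> \<in> Gamma9 \<Longrightarrow> Im \<tau> > 0 \<Longrightarrow>
                norm (g (act \<gamma> \<tau>)) = norm (denom \<gamma> \<tau>) powr w * norm (g \<tau>)"
    and per: "\<And>\<tau>. Im \<tau> > 0 \<Longrightarrow> g (\<tau> + 9) = g \<tau>"
    and bdd: "\<And>\<gamma>. \<gamma> \<in> SL2Z \<Longrightarrow> Bfun (\<lambda>\<tau>. norm (denom \<gamma> \<tau>) powr (- w) * norm (g (act \<gamma> \<tau>))) at_i_infinity"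
    and \<tau>: "Im \<tau> > 0"
  shows "g \<tau> = 0"
proof -
  \<comment> \<open>The norm of \<open>g\<close> slashed by \<open>\<gamma>\<close>; it depends only on \<open>\<gamma>\<close> modulo \<open>9\<close>.\<close>
  define H where "H \<gamma> \<tau> = norm (denom \<gamma> \<tau>) powr (- w) * norm (g (act \<gamma> \<tau>))" for \<gamma> \<tau>
  have H_cong: "H \<gamma> \<tau> = H \<delta> \<tau>" if "\<gamma> \<in> SL2Z" "\<delta> \<in> SL2Z" "residue9 \<gamma> = residue9 \<delta>" "Im \<tau> > 0" for \<gamma> \<delta> \<tau>
  proof -
    define \<epsilon> where "\<epsilon> = \<gamma> ** adjugate \<delta>"
    have \<epsilon>: "\<epsilon> \<in> Gamma9" unfolding \<epsilon>_def by (rule residue9_quotient[OF that(1,2,3)])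
    then have S: "\<epsilon> \<in> SL2Z" by (simp add: Gamma9_iff)
    have \<gamma>: "\<gamma> = \<epsilon> ** \<delta>" unfolding \<epsilon>_def by (simp add: mult_adjugate_cancel[OF that(2)])
    have t: "Im (act \<delta> \<tau>) > 0" by (rule act_in_upper_half_plane[OF that(2,4)])
    have "norm (denom \<epsilon> (act \<delta> \<tau>)) > 0" using denom_nonzero[OF S t] by simp
    then have "norm (denom \<epsilon> (act \<delta> \<tau>)) powr (- w) * norm (denom \<epsilon> (act \<delta> \<tau>)) powr w = 1"
      by (simp flip: powr_add)
    then show ?thesis
      unfolding H_def \<gamma> denom_mult[OF that(2,4)] act_mult[OF S that(2,4)] inv[OF \<epsilon> t] norm_mult
      by (simp add: powr_mult)
  qed
  obtain R where R: "R \<subseteq> SL2Z" "finite R" "residue9 ` SL2Z = residue9 ` R"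
    using finite_subset_image[OF finite_residue9[of SL2Z] order_refl] by blast
  have local_bound: "\<exists>B. \<forall>\<tau>. \<bar>Re \<tau>\<bar> \<le> 1 / 2 \<longrightarrow> Im \<tau> \<ge> 1 / 2 \<longrightarrow> H \<rho> \<tau> \<le> B" if \<rho>: "\<rho> \<in> SL2Z" for \<rho>
  proof -
    obtain B1 Y where B1: "\<And>\<tau>. Im \<tau> \<ge> Y \<Longrightarrow> H \<rho> \<tau> \<le> B1"
      using bdd[OF \<rho>] unfolding Bfun_def eventually_at_i_infinity H_def by auto
    define K where "K = cbox (Complex (- 1 / 2) (1 / 2)) (Complex (1 / 2) Y)"
    have K: "\<tau> \<in> K \<longleftrightarrow> \<bar>Re \<tau>\<bar> \<le> 1 / 2 \<and> 1 / 2 \<le> Im \<tau> \<and> Im \<tau> \<le> Y" for \<tau>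
      by (auto simp: K_def in_cbox_complex_iff)
    have sub: "K \<subseteq> \<H>" by (auto simp: K)
    have "continuous_on K (\<lambda>\<tau>. g (act \<rho> \<tau>))"
      by (rule holomorphic_on_imp_continuous_on, rule holomorphic_on_subset[OF _ sub],
          rule holomorphic_compose_upper[OF hol holomorphic_act[OF \<rho>] act_in_upper_half_plane[OF \<rho>]])
    moreover have "continuous_on K (\<lambda>\<tau>. denom \<rho> \<tau>)"
      unfolding denom_def by (intro continuous_intros)
    moreover have "denom \<rho> \<tau> \<noteq> 0" if "\<tau> \<in> K" for \<tau>
      using denom_nonzero[OF \<open>\<rho> \<in> SL2Z\<close>] sub that by auto
    ultimately have "continuous_on K (H \<rho>)"
      unfolding H_def by (intro continuous_intros) auto
    then have "compact (H \<rho> ` K)" by (intro compact_continuous_image) (auto simp: K_def)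
    then have "bounded (H \<rho> ` K)" by (rule compact_imp_bounded)
    then obtain B2 where B2: "\<And>\<tau>. \<tau> \<in> K \<Longrightarrow> norm (H \<rho> \<tau>) \<le> B2"
      unfolding bounded_iff by auto
    have "H \<rho> \<tau> \<le> max B1 B2" if "\<bar>Re \<tau>\<bar> \<le> 1 / 2" "Im \<tau> \<ge> 1 / 2" for \<tau>
      using B1[of \<tau>] B2[of \<tau>] that K[of \<tau>] by (cases "Im \<tau> \<ge> Y") (auto simp: abs_le_iff)
    then show ?thesis by blast
  qed
  then have "\<forall>\<rho>\<in>R. \<exists>B. \<forall>\<tau>. \<bar>Re \<tau>\<bar> \<le> 1 / 2 \<longrightarrow> Im \<tau> \<ge> 1 / 2 \<longrightarrow> H \<rho> \<tau> \<le> B" using R(1) by blast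
  from bchoice[OF this] obtain b where b: "\<And>\<rho> \<tau>. \<rho> \<in> R \<Longrightarrow> \<bar>Re \<tau>\<bar> \<le> 1 / 2 \<Longrightarrow> Im \<tau> \<ge> 1 / 2 \<Longrightarrow> H \<rho> \<tau> \<le> b \<rho>" by blast
  define B where "B = (\<Sum>\<rho>\<in>R. \<bar>b \<rho>\<bar>)"
  have B: "H \<gamma> \<tau> \<le> B" if "\<gamma> \<in> SL2Z" "\<bar>Re \<tau>\<bar> \<le> 1 / 2" "Im \<tau> \<ge> 1 / 2" for \<gamma> \<tau>
  proof -
    have "residue9 \<gamma> \<in> residue9 ` R" using that(1) R(3) by blast
    then obtain \<rho> where \<rho>: "\<rho> \<in> R" "residue9 \<gamma> = residue9 \<rho>" by blast
    have "H \<gamma> \<tau> = H \<rho> \<tau>" using that \<rho> R(1) by (intro H_cong) auto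
    also have "\<dots> \<le> \<bar>b \<rho>\<bar>" using b[OF \<rho>(1) that(2,3)] by linarith
    also have "\<dots> \<le> B" unfolding B_def by (rule member_le_sum) (use \<rho> R in auto)
    finally show ?thesis .
  qed
  have B0: "B \<ge> 0" by (simp add: B_def sum_nonneg)
  define C where "C = B * (1 / 2) powr (w / 2)"
  have bound: "norm (g \<tau>) \<le> C * Im \<tau> powr (- w / 2)" if t: "Im \<tau> > 0" for \<tau>
  proof -
    obtain \<gamma> \<sigma> where s: "\<gamma> \<in> SL2Z" "\<tau> = act \<gamma> \<sigma>" "\<bar>Re \<sigma>\<bar> \<le> 1 / 2" "Im \<sigma> \<ge> 1 / 2"
      using fundamental_domain[OF t] by blast
    have s0: "Im \<sigma> > 0" using s(4) by simp
    define D where "D = norm (denom \<gamma> \<sigma>)"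
    have D: "D > 0" using denom_nonzero[OF s(1) s0] by (simp add: D_def)
    have Im: "Im \<tau> = Im \<sigma> / D\<^sup>2" unfolding s(2) D_def by (rule Im_act[OF s(1) s0])
    have D2: "D\<^sup>2 = Im \<sigma> / Im \<tau>" using Im D t by (simp add: field_simps)
    have "D powr w = (D\<^sup>2) powr (w / 2)"
      using D by (simp add: powr_powr flip: powr_numeral)
    also have "\<dots> = Im \<sigma> powr (w / 2) * Im \<tau> powr (- w / 2)"
      unfolding D2 using s0 t by (simp add: powr_divide powr_minus_divide)
    finally have Dw: "D powr w = Im \<sigma> powr (w / 2) * Im \<tau> powr (- w / 2)" .
    have "norm (g \<tau>) = H \<gamma> \<sigma> * D powr w"
      unfolding H_def s(2) D_def[symmetric] using D by (simp add: powr_minus field_simps)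
    also have "\<dots> \<le> B * D powr w" using B[OF s(1,3,4)] by (intro mult_right_mono) auto
    also have "\<dots> = (B * Im \<sigma> powr (w / 2)) * Im \<tau> powr (- w / 2)" by (simp add: Dw)
    also have "\<dots> \<le> C * Im \<tau> powr (- w / 2)"
      unfolding C_def using s(4) w B0 by (intro mult_right_mono mult_left_mono powr_mono2') auto
    finally show ?thesis .
  qed
  have "((\<lambda>\<tau>. g \<tau> * exp (2 * of_real pi * \<i> * \<tau> / of_real 9)) \<longlongrightarrow> 0) at_i_infinity"
  proof -
    obtain A where A: "eventually (\<lambda>\<tau>. norm (g \<tau>) \<le> A) at_i_infinity"
      using bdd[OF mat_1_SL2Z] unfolding Bfun_def by auto
    show ?thesis
    proof (rule Lim_null_comparison)
      show "eventually (\<lambda>\<tau>. norm (g \<tau> * exp (2 * of_real pi * \<i> * \<tau> / of_real 9)) \<le> A * exp (- (2 * pi / 9) * Im \<tau>)) at_i_infinity"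
        using A by eventually_elim (simp add: norm_mult mult_right_mono)
      show "((\<lambda>\<tau>. A * exp (- (2 * pi / 9) * Im \<tau>)) \<longlongrightarrow> 0) at_i_infinity"
        using tendsto_mult_left[OF tendsto_exp_minus_Im[of "2 * pi / 9"], of A] by simp
    qed
  qed
  then obtain G where G: "G holomorphic_on ball 0 1"
     "\<And>\<tau>. Im \<tau> > 0 \<Longrightarrow> g \<tau> = G (exp (2 * of_real pi * \<i> * \<tau> / of_real 9))"
    using periodic_extends_to_disc[OF hol, of 9] per by auto
  have "norm (g \<tau>) \<le> C * y powr (- w / 2)" if y: "0 < y" "y < Im \<tau>" for y
  proof -
    \<comment> \<open>The horizontal line at height \<open>y\<close> is mapped onto the circle of radius \<open>r\<close>.\<close>
    define r where "r = exp (- 2 * pi * y / 9)"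
    define q where "q = exp (2 * of_real pi * \<i> * \<tau> / of_real 9)"
    have r: "r < 1" "r > 0" using y by (auto simp: r_def)
    have "norm (G q) \<le> C * y powr (- w / 2)"
    proof (rule maximum_modulus_frontier[of G "cball 0 r"])
      show "G holomorphic_on interior (cball 0 r)"
        by (rule holomorphic_on_subset[OF G(1)]) (use r in auto)
      show "continuous_on (closure (cball 0 r)) G"
        by (rule holomorphic_on_imp_continuous_on, rule holomorphic_on_subset[OF G(1)]) (use r in auto)
      show "q \<in> cball 0 r" using y by (simp add: q_def r_def)
      fix z assume "z \<in> frontier (cball (0::complex) r)"
      then have z: "norm z = r" using r by (simp add: sphere_def)
      then have "z \<noteq> 0" using r by auto
      define t where "t = 9 * Ln z / (2 * of_real pi * \<i>)"
      have "Im t = - 9 * ln r / (2 * pi)"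
        using \<open>z \<noteq> 0\<close> z by (simp add: t_def Im_divide power2_eq_square)
      then have t: "Im t = y" by (simp add: r_def)
      have "exp (2 * of_real pi * \<i> * t / of_real 9) = z" using \<open>z \<noteq> 0\<close> by (simp add: t_def)
      then have "G z = g t" using G(2)[of t] t y by simp
      then show "norm (G z) \<le> C * y powr (- w / 2)" using bound[of t] t y by simp
    qed auto
    then show ?thesis using G(2)[OF \<tau>] by (simp add: q_def)
  qed
  then have "eventually (\<lambda>y. norm (g \<tau>) \<le> C * y powr (- w / 2)) (at_right 0)"
    using \<tau> by (intro eventually_at_rightI[of 0 "Im \<tau>"]) auto
  moreover have "((\<lambda>y. C * y powr (- w / 2)) \<longlongrightarrow> C * 0) (at_right 0)"
    using w by (intro tendsto_mult tendsto_const) real_asymp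
  ultimately have "norm (g \<tau>) \<le> C * 0"
    by (intro tendsto_le[OF _ _ tendsto_const]) auto
  then show ?thesis by simp
qed

section \<open>Direct sums\<close>

lemma subspace_sum_least:
  assumes "0 \<in> W" "\<And>x y. x \<in> W \<Longrightarrow> y \<in> W \<Longrightarrow> x + y \<in> W" "\<And>i. i \<in> I \<Longrightarrow> V i \<subseteq> W"
  shows "subspace_sum I V \<subseteq> W"
proof -
  have "(\<Sum>i\<in>F. v i) \<in> W" if "finite F" "F \<subseteq> I" "\<forall>i\<in>F. v i \<in> V i" for F v
    using that by (induction F) (use assms in auto)
  then show ?thesis by (auto simp: subspace_sum_def)
qed

lemma subspace_sum_member: "i \<in> I \<Longrightarrow> x \<in> V i \<Longrightarrow> x \<in> subspace_sum I V"
  unfolding subspace_sum_def by (intro CollectI exI[of _ "{i}"] exI[of _ "\<lambda>_. x"]) auto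

lemma subspace_sum_0: "0 \<in> subspace_sum I V"
  unfolding subspace_sum_def by (intro CollectI exI[of _ "{}"]) auto

lemma subspace_sum_add:
  assumes "\<And>i. i \<in> I \<Longrightarrow> 0 \<in> V i" "\<And>i x y. i \<in> I \<Longrightarrow> x \<in> V i \<Longrightarrow> y \<in> V i \<Longrightarrow> x + y \<in> V i"
    and "x \<in> subspace_sum I V" "y \<in> subspace_sum I V"
  shows "x + y \<in> subspace_sum I V"
proof -
  obtain F v where F: "finite F" "F \<subseteq> I" "\<forall>i\<in>F. v i \<in> V i" "x = (\<Sum>i\<in>F. v i)"
    using assms(3) by (auto simp: subspace_sum_def)
  obtain G w where G: "finite G" "G \<subseteq> I" "\<forall>i\<in>G. w i \<in> V i" "y = (\<Sum>i\<in>G. w i)"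
    using assms(4) by (auto simp: subspace_sum_def)
  define v' where "v' i = (if i \<in> F then v i else 0)" for i
  define w' where "w' i = (if i \<in> G then w i else 0)" for i
  have "x = (\<Sum>i\<in>F \<union> G. v' i)" unfolding F(4) v'_def using F(1) G(1) by (intro sum.mono_neutral_cong_left) auto
  moreover have "y = (\<Sum>i\<in>F \<union> G. w' i)" unfolding G(4) w'_def using F(1) G(1) by (intro sum.mono_neutral_cong_left) auto
  ultimately have "x + y = (\<Sum>i\<in>F \<union> G. v' i + w' i)" by (simp add: sum.distrib)
  moreover have "v' i + w' i \<in> V i" if "i \<in> F \<union> G" for i
    using that F G assms(1,2) by (auto simp: v'_def w'_def subset_eq)
  ultimately show ?thesis unfolding subspace_sum_def using F G
    by (intro CollectI exI[of _ "F \<union> G"] exI[of _ "\<lambda>i. v' i + w' i"]) auto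
qed

lemma independent_subspacesD:
  assumes "independent_subspaces I V" "finite F" "F \<subseteq> I" "\<And>i. i \<in> F \<Longrightarrow> v i \<in> V i" "(\<Sum>i\<in>F. v i) = 0" "i \<in> F"
  shows "v i = 0"
  using assms unfolding independent_subspaces_def by blast

lemma independent_subspaces_mono:
  assumes "independent_subspaces I V" "\<And>i. i \<in> I \<Longrightarrow> U i \<subseteq> V i"
  shows "independent_subspaces I U"
  using assms unfolding independent_subspaces_def by (meson subset_iff)

text \<open>
  Grouping a vanishing sum by the first index gives a vanishing sum over the coarser family.
\<close>

lemma independent_subspaces_refine:
  assumes W: "independent_subspaces I W" and V: "\<And>i. i \<in> I \<Longrightarrow> independent_subspaces J (V i)"
    and sub: "\<And>i j. i \<in> I \<Longrightarrow> j \<in> J \<Longrightarrow> V i j \<subseteq> W i"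
    and W0: "\<And>i. i \<in> I \<Longrightarrow> 0 \<in> W i" and Wadd: "\<And>i x y. i \<in> I \<Longrightarrow> x \<in> W i \<Longrightarrow> y \<in> W i \<Longrightarrow> x + y \<in> W i"
  shows "independent_subspaces (I \<times> J) (\<lambda>(i, j). V i j)"
  unfolding independent_subspaces_def
proof (intro allI impI)
  fix F v
  assume F: "finite F" "F \<subseteq> I \<times> J" and v: "\<forall>p\<in>F. v p \<in> (case p of (i, j) \<Rightarrow> V i j)" and s: "(\<Sum>p\<in>F. v p) = 0"
  define Fi where "Fi i = {j. (i, j) \<in> F}" for i
  have Fi: "finite (Fi i)" "Fi i \<subseteq> J" for i
    using F finite_subset[of "Fi i" "snd ` F"] by (force simp: Fi_def)+
  have Fs: "F = Sigma (fst ` F) Fi" by (force simp: Fi_def)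
  define w where "w i = (\<Sum>j\<in>Fi i. v (i, j))" for i
  have wW: "w i \<in> W i" if "i \<in> fst ` F" for i
  proof -
    have i: "i \<in> I" using that F by auto
    have "(\<Sum>j\<in>K. v (i, j)) \<in> W i" if "finite K" "K \<subseteq> Fi i" for K
      using that
    proof (induction K)
      case empty
      show ?case using W0[OF i] by simp
    next
      case (insert j K)
      then have "(i, j) \<in> F" "j \<in> J" using Fi[of i] by (auto simp: Fi_def)
      then have "v (i, j) \<in> W i" using v sub[OF i] by blast
      with insert show ?case by (simp add: Wadd[OF i])
    qed
    then show ?thesis unfolding w_def using Fi by blast
  qed
  have "(\<Sum>i\<in>fst ` F. w i) = (\<Sum>p\<in>F. v p)"
    unfolding w_def by (subst (2) Fs, subst sum.Sigma) (use F Fi in auto)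
  then have sw: "(\<Sum>i\<in>fst ` F. w i) = 0" using s by simp
  have "finite (fst ` F)" "fst ` F \<subseteq> I" "\<forall>i\<in>fst ` F. w i \<in> W i" using F wW by auto
  then have w0: "\<forall>i\<in>fst ` F. w i = 0"
    using W sw unfolding independent_subspaces_def by blast
  have "v (i, j) = 0" if "(i, j) \<in> F" for i j
  proof -
    have "i \<in> fst ` F" using that by force
    then have i: "i \<in> I" "(\<Sum>j\<in>Fi i. v (i, j)) = 0" using F w0 by (auto simp: w_def)
    moreover have "\<forall>j\<in>Fi i. v (i, j) \<in> V i j" using v by (auto simp: Fi_def)
    ultimately show ?thesis
      using independent_subspacesD[OF V[OF i(1)] Fi, of i "\<lambda>j. v (i, j)" j] that by (simp add: Fi_def)
  qed
  then show "\<forall>p\<in>F. v p = 0" by auto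
qed

lemma independent_subspaces_coarsen:
  assumes ind: "independent_subspaces (K \<times> A) (\<lambda>(k, a). V k a)"
  shows "independent_subspaces A (\<lambda>a. subspace_sum K (\<lambda>k. V k a))"
  unfolding independent_subspaces_def
proof (intro allI impI)
  fix F w assume F: "finite F" "F \<subseteq> A" and w: "\<forall>a\<in>F. w a \<in> subspace_sum K (\<lambda>k. V k a)" and s: "(\<Sum>a\<in>F. w a) = 0"
  have "\<forall>a\<in>F. \<exists>E v. finite E \<and> E \<subseteq> K \<and> (\<forall>k\<in>E. v k \<in> V k a) \<and> w a = (\<Sum>k\<in>E. v k)"
    using w by (fastforce simp: subspace_sum_def)
  then obtain E v where E: "\<And>a. a \<in> F \<Longrightarrow> finite (E a) \<and> E a \<subseteq> K \<and> (\<forall>k\<in>E a. v a k \<in> V k a) \<and> w a = (\<Sum>k\<in>E a. v a k)"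
    by metis
  define S where "S = (\<lambda>(a, k). (k, a)) ` Sigma F E"
  have inj: "inj_on (\<lambda>(a, k). (k, a)) (Sigma F E)" by (auto simp: inj_on_def)
  have "(\<Sum>(k, a)\<in>S. v a k) = (\<Sum>(a, k)\<in>Sigma F E. v a k)"
    unfolding S_def by (subst sum.reindex[OF inj]) (auto intro!: sum.cong)
  also have "\<dots> = (\<Sum>a\<in>F. \<Sum>k\<in>E a. v a k)" by (rule sum.Sigma[symmetric]) (use F E in auto)
  also have "\<dots> = 0" using s E by simp
  finally have "(\<Sum>p\<in>S. (\<lambda>(k, a). v a k) p) = 0" .
  moreover have "finite S" "S \<subseteq> K \<times> A" using F E by (auto simp: S_def)
  moreover have "\<forall>p\<in>S. (\<lambda>(k, a). v a k) p \<in> (case p of (k, a) \<Rightarrow> V k a)" using E by (auto simp: S_def)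
  ultimately have "\<forall>p\<in>S. (\<lambda>(k, a). v a k) p = 0"
    using ind unfolding independent_subspaces_def by blast
  then have "v a k = 0" if "a \<in> F" "k \<in> E a" for a k using that by (force simp: S_def)
  then show "\<forall>a\<in>F. w a = 0" using E by simp
qed

lemma is_internal_direct_sum_cong:
  assumes "\<And>i. i \<in> I \<Longrightarrow> U i = V i"
  shows "is_internal_direct_sum W I U \<longleftrightarrow> is_internal_direct_sum W I V"
proof -
  have "(\<forall>i\<in>F. v i \<in> U i) \<longleftrightarrow> (\<forall>i\<in>F. v i \<in> V i)" if "F \<subseteq> I" for F v
    using assms that by (metis subsetD)
  then show ?thesis
    unfolding is_internal_direct_sum_def subspace_sum_def independent_subspaces_def
    by (simp cong: conj_cong imp_cong)
qed

lemma is_internal_direct_sum_trans: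
  assumes X: "is_internal_direct_sum X I W" and W: "\<And>i. i \<in> I \<Longrightarrow> is_internal_direct_sum (W i) J (V i)"
    and V0: "\<And>i j. 0 \<in> V i j" and Vadd: "\<And>i j x y. x \<in> V i j \<Longrightarrow> y \<in> V i j \<Longrightarrow> x + y \<in> V i j"
  shows "is_internal_direct_sum X (I \<times> J) (\<lambda>(i, j). V i j)"
  unfolding is_internal_direct_sum_def
proof
  have XW: "X = subspace_sum I W" "independent_subspaces I W" using X by (auto simp: is_internal_direct_sum_def)
  have WV: "W i = subspace_sum J (V i)" "independent_subspaces J (V i)" if "i \<in> I" for i
    using W[OF that] by (auto simp: is_internal_direct_sum_def)
  have W0: "0 \<in> W i" if "i \<in> I" for i unfolding WV(1)[OF that] by (rule subspace_sum_0)
  have Wadd: "x + y \<in> W i" if "i \<in> I" "x \<in> W i" "y \<in> W i" for i x y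
    using that(2,3) subspace_sum_add[of J "V i" x y] V0 Vadd unfolding WV(1)[OF that(1)] by simp
  have sub: "V i j \<subseteq> W i" if "i \<in> I" "j \<in> J" for i j
    unfolding WV(1)[OF that(1)] using that(2) by (auto intro: subspace_sum_member)
  show "independent_subspaces (I \<times> J) (\<lambda>(i, j). V i j)"
    by (rule independent_subspaces_refine[OF XW(2) WV(2) sub W0 Wadd])
  show "X = subspace_sum (I \<times> J) (\<lambda>(i, j). V i j)" (is "_ = ?R")
  proof
    have add: "x + y \<in> ?R" if "x \<in> ?R" "y \<in> ?R" for x y
      by (rule subspace_sum_add[OF _ _ that]) (auto simp: V0 Vadd)
    have "V i j \<subseteq> ?R" if "i \<in> I" "j \<in> J" for i j
      using that subspace_sum_member[of "(i, j)" "I \<times> J" _ "\<lambda>(i, j). V i j"] by auto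
    then have "W i \<subseteq> ?R" if "i \<in> I" for i
      unfolding WV(1)[OF that] by (intro subspace_sum_least[OF subspace_sum_0 add]) (use that in auto)
    then show "X \<subseteq> ?R" unfolding XW(1) by (intro subspace_sum_least[OF subspace_sum_0 add])
    have "W i \<subseteq> X" if "i \<in> I" for i
      unfolding XW(1) using that by (auto intro: subspace_sum_member)
    then have m: "V i j \<subseteq> X" if "i \<in> I" "j \<in> J" for i j using sub that by blast
    have "x + y \<in> X" if "x \<in> X" "y \<in> X" for x y
      using that subspace_sum_add[of I W x y] W0 Wadd unfolding XW(1) by simp
    moreover have "0 \<in> X" unfolding XW(1) by (rule subspace_sum_0)
    ultimately show "?R \<subseteq> X"
    proof (intro subspace_sum_least)
      show "(case p of (i, j) \<Rightarrow> V i j) \<subseteq> X" if "p \<in> I \<times> J" for p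
        using m that by (cases p) simp
    qed
  qed
qed

lemma is_internal_direct_sum_coarsen:
  assumes X: "is_internal_direct_sum X (K \<times> A) (\<lambda>(p, q). V p q)"
    and V0: "\<And>p q. 0 \<in> V p q" and Vadd: "\<And>p q x y. x \<in> V p q \<Longrightarrow> y \<in> V p q \<Longrightarrow> x + y \<in> V p q"
  shows "is_internal_direct_sum X A (\<lambda>q. subspace_sum K (\<lambda>p. V p q))"
  unfolding is_internal_direct_sum_def
proof
  have XV: "X = subspace_sum (K \<times> A) (\<lambda>(p, q). V p q)" "independent_subspaces (K \<times> A) (\<lambda>(p, q). V p q)"
    using X by (auto simp: is_internal_direct_sum_def)
  show "independent_subspaces A (\<lambda>q. subspace_sum K (\<lambda>p. V p q))"
    by (rule independent_subspaces_coarsen[OF XV(2)])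
  have Wadd: "x + y \<in> subspace_sum K (\<lambda>p. V p q)"
    if "x \<in> subspace_sum K (\<lambda>p. V p q)" "y \<in> subspace_sum K (\<lambda>p. V p q)" for q x y
    by (rule subspace_sum_add[OF _ _ that]) (auto simp: V0 Vadd)
  show "X = subspace_sum A (\<lambda>q. subspace_sum K (\<lambda>p. V p q))" (is "_ = ?R")
  proof
    have Radd: "x + y \<in> ?R" if "x \<in> ?R" "y \<in> ?R" for x y
      by (rule subspace_sum_add[OF _ _ that]) (auto simp: subspace_sum_0 Wadd)
    have "V p q \<subseteq> ?R" if "p \<in> K" "q \<in> A" for p q
    proof
      fix x assume "x \<in> V p q"
      then have "x \<in> subspace_sum K (\<lambda>p. V p q)" by (rule subspace_sum_member[OF that(1)])
      then show "x \<in> ?R" by (rule subspace_sum_member[OF that(2)])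
    qed
    then show "X \<subseteq> ?R" unfolding XV(1) by (intro subspace_sum_least[OF subspace_sum_0 Radd]) auto
    have Xadd: "x + y \<in> X" if "x \<in> X" "y \<in> X" for x y
      using that unfolding XV(1) by (intro subspace_sum_add) (auto simp: V0 Vadd)
    have "0 \<in> X" unfolding XV(1) by (rule subspace_sum_0)
    have "V p q \<subseteq> X" if "p \<in> K" "q \<in> A" for p q
      unfolding XV(1) using subspace_sum_member[of "(p, q)" "K \<times> A" _ "\<lambda>(p, q). V p q"] that by auto
    then have "subspace_sum K (\<lambda>p. V p q) \<subseteq> X" if "q \<in> A" for q
      by (intro subspace_sum_least \<open>0 \<in> X\<close> Xadd) (use that in auto)
    then show "?R \<subseteq> X" using subspace_sum_least[of X A "\<lambda>q. subspace_sum K (\<lambda>p. V p q)"] \<open>0 \<in> X\<close> Xadd by blast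
  qed
qed

section \<open>Forms with a multiplier\<close>

text \<open>
  Forms of weight \<open>k/3\<close> with the multiplier \<open>\<nu>\<close> measured against \<open>third_factor\<close>. In this normalization
  the characters of the various spaces are visible in \<open>\<nu>\<close> and products of forms multiply their
  multipliers.
\<close>

definition forms :: "mat2 set \<Rightarrow> nat \<Rightarrow> (mat2 \<Rightarrow> complex) \<Rightarrow> (complex \<Rightarrow> complex) set" where
  "forms G k \<nu> = {f. (\<forall>\<tau>. Im \<tau> \<le> 0 \<longrightarrow> f \<tau> = 0) \<and> f holomorphic_on \<H> \<and>
     (\<forall>\<gamma>\<in>G. \<forall>\<tau>. Im \<tau> > 0 \<longrightarrow> slash k f \<gamma> \<tau> = \<nu> \<gamma> * f \<tau>) \<and>
     (\<forall>\<gamma>\<in>SL2Z. Bfun (slash k f \<gamma>) at_i_infinity)}"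

lemma c9_b9_nonzero [simp]: "c9 \<gamma> \<noteq> 0" "b9 \<gamma> \<noteq> 0"
  by (simp_all add: c9_def b9_def)

lemma modular_forms_eq_forms:
  assumes "G \<subseteq> SL2Z"
  shows "modular_forms G k \<psi> = forms G k (\<lambda>\<gamma>. \<psi> \<gamma> / (c9 \<gamma> * b9 \<gamma>) ^ k)"
  by (auto simp: forms_def modular_forms_iff_slash[OF assms])

lemma forms_eq_modular_forms:
  assumes "G \<subseteq> SL2Z"
  shows "forms G k \<nu> = modular_forms G k (\<lambda>\<gamma>. \<nu> \<gamma> * (c9 \<gamma> * b9 \<gamma>) ^ k)"
  unfolding modular_forms_eq_forms[OF assms] by simp

lemma forms_0: "G \<subseteq> SL2Z \<Longrightarrow> 0 \<in> forms G k \<nu>"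
  by (simp add: forms_eq_modular_forms zero_in_modular_forms)

lemma forms_add: "G \<subseteq> SL2Z \<Longrightarrow> f \<in> forms G k \<nu> \<Longrightarrow> g \<in> forms G k \<nu> \<Longrightarrow> f + g \<in> forms G k \<nu>"
  by (simp add: forms_eq_modular_forms modular_forms_add)

lemma forms_restrict:
  assumes "f \<in> forms G k \<nu>" "H \<subseteq> G" "\<And>\<gamma>. \<gamma> \<in> H \<Longrightarrow> \<mu> \<gamma> = \<nu> \<gamma>"
  shows "f \<in> forms H k \<mu>"
  using assms by (auto simp: forms_def)

lemma forms_cong:
  assumes "\<And>\<gamma>. \<gamma> \<in> G \<Longrightarrow> \<mu> \<gamma> = \<nu> \<gamma>"
  shows "forms G k \<mu> = forms G k \<nu>"
  using assms by (auto simp: forms_def)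

lemma forms_slash_eq:
  assumes "f \<in> forms G k \<nu>" "\<gamma> \<in> G"
  shows "slash k f \<gamma> = (\<lambda>\<tau>. \<nu> \<gamma> * f \<tau>)"
proof
  fix \<tau> show "slash k f \<gamma> \<tau> = \<nu> \<gamma> * f \<tau>"
    using assms by (cases "Im \<tau> > 0") (auto simp: forms_def slash_def)
qed

lemma Bfun_scale: "Bfun f F \<Longrightarrow> Bfun (\<lambda>x. (c::complex) * f x) F"
  unfolding Bfun_def
proof (elim exE conjE)
  fix K assume K: "K > 0" "eventually (\<lambda>x. norm (f x) \<le> K) F"
  have "eventually (\<lambda>x. norm (c * f x) \<le> norm c * K + 1) F"
    using K(2)
  proof eventually_elim
    case (elim x)
    then have "norm c * norm (f x) \<le> norm c * K" by (intro mult_left_mono) auto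
    then show ?case by (simp add: norm_mult)
  qed
  moreover have "norm c * K + 1 > 0" using K(1) by (simp add: add_nonneg_pos)
  ultimately show "\<exists>K>0. eventually (\<lambda>x. norm (c * f x) \<le> K) F" by blast
qed

lemma Bfun_sum:
  fixes f :: "'i \<Rightarrow> 'a \<Rightarrow> complex"
  assumes "finite I" "\<And>i. i \<in> I \<Longrightarrow> Bfun (f i) F"
  shows "Bfun (\<lambda>x. \<Sum>i\<in>I. f i x) F"
  using assms
proof (induction I)
  case empty
  show ?case by (auto intro: BfunI[of _ 0])
next
  case (insert i I)
  obtain A where A: "eventually (\<lambda>x. norm (f i x) \<le> A) F" using insert.prems[of i] unfolding Bfun_def by auto
  obtain B where B: "eventually (\<lambda>x. norm (\<Sum>i\<in>I. f i x) \<le> B) F" using insert unfolding Bfun_def by auto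
  show ?case
  proof (rule BfunI)
    show "eventually (\<lambda>x. norm (\<Sum>i\<in>insert i I. f i x) \<le> A + B) F"
      using A B
    proof eventually_elim
      case (elim x)
      then show ?case using insert.hyps norm_triangle_ineq[of "f i x" "\<Sum>i\<in>I. f i x"] by simp
    qed
  qed
qed

section \<open>Eigenspaces and weights\<close>

text \<open>
  A polynomial of degree less than \<open>n\<close> with \<open>n\<close> roots vanishes; this replaces the inversion of a
  Vandermonde matrix.
\<close>

lemma coeff_eq_0_if_vanishes_on_roots_of_unity:
  fixes c :: "nat \<Rightarrow> complex"
  assumes "n > 0" "\<And>z. z ^ n = 1 \<Longrightarrow> (\<Sum>j<n. c j * z ^ j) = 0" "j < n"
  shows "c j = 0"
proof (rule ccontr)
  assume "c j \<noteq> 0"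
  have e: "{..<n} = {..n - 1}" using assms(1) by auto
  have "finite {z. (\<Sum>i\<le>n - 1. c i * z ^ i) = 0} \<and> card {z. (\<Sum>i\<le>n - 1. c i * z ^ i) = 0} \<le> n - 1"
    by (rule Transcendental.polyfun_rootbound[of c j]) (use \<open>c j \<noteq> 0\<close> assms(3) in auto)
  moreover have "{z::complex. z ^ n = 1} \<subseteq> {z. (\<Sum>i\<le>n - 1. c i * z ^ i) = 0}" using assms(2) unfolding e by auto
  ultimately have "card {z::complex. z ^ n = 1} \<le> n - 1" by (meson card_mono order_trans)
  then show False using card_roots_unity_eq[OF assms(1)] assms(1) by simp
qed

text \<open>
  The larger group \<open>G\<close> acts on the forms on the kernel of \<open>\<psi>\<close> through its cyclic image, up to \<open>\<nu>\<close>, and a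
  representation of a cyclic group of order \<open>n\<close> is the direct sum of its isotypic parts. The components
  are the usual averages \<open>\<Sum> z\<^sup>-\<^sup>j \<Phi> z / n\<close> over the \<open>n\<close>-th roots of unity \<open>z\<close>, where \<open>\<Phi> z\<close> is the
  action of an element of character value \<open>z\<close>.
\<close>

theorem cyclic_decomposition:
  assumes G: "G \<subseteq> SL2Z" "mat 1 \<in> G" "\<And>\<gamma> \<delta>. \<gamma> \<in> G \<Longrightarrow> \<delta> \<in> G \<Longrightarrow> \<gamma> ** \<delta> \<in> G" "\<And>\<gamma>. \<gamma> \<in> G \<Longrightarrow> adjugate \<gamma> \<in> G"
    and \<nu>: "\<And>\<gamma> \<delta>. \<gamma> \<in> G \<Longrightarrow> \<delta> \<in> G \<Longrightarrow> \<nu> (\<gamma> ** \<delta>) = \<nu> \<gamma> * \<nu> \<delta>" "\<And>\<gamma>. \<gamma> \<in> G \<Longrightarrow> \<nu> \<gamma> \<noteq> 0"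
    and \<psi>: "\<And>\<gamma> \<delta>. \<gamma> \<in> G \<Longrightarrow> \<delta> \<in> G \<Longrightarrow> \<psi> (\<gamma> ** \<delta>) = \<psi> \<gamma> * \<psi> \<delta>" "\<psi> ` G = {z::complex. z ^ n = 1}"
    and n: "n > 0"
  shows "is_internal_direct_sum (forms {\<gamma> \<in> G. \<psi> \<gamma> = 1} k \<nu>) {..<n} (\<lambda>j. forms G k (\<lambda>\<gamma>. \<nu> \<gamma> * \<psi> \<gamma> ^ j))"
proof -
  define N where "N = {\<gamma> \<in> G. \<psi> \<gamma> = 1}"
  define U where "U = {z::complex. z ^ n = 1}"
  have U: "finite U" "\<And>z. z \<in> U \<Longrightarrow> z \<noteq> 0" "1 \<in> U" using n finite_roots_unity[of n, where 'a = complex] by (auto simp: U_def power_0_left)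
  have N: "N \<subseteq> SL2Z" using G(1) by (auto simp: N_def)
  have \<psi>U: "\<psi> \<gamma> \<in> U" if "\<gamma> \<in> G" for \<gamma> using \<psi>(2) that by (auto simp: U_def)
  have inclusion: "forms G k (\<lambda>\<gamma>. \<nu> \<gamma> * \<psi> \<gamma> ^ j) \<subseteq> forms N k \<nu>" for j
    by (rule subsetI, erule forms_restrict) (auto simp: N_def)
  have "subspace_sum {..<n} (\<lambda>j. forms G k (\<lambda>\<gamma>. \<nu> \<gamma> * \<psi> \<gamma> ^ j)) \<subseteq> forms N k \<nu>"
    by (rule subspace_sum_least[OF forms_0[OF N] forms_add[OF N] inclusion])
  moreover have "f \<in> subspace_sum {..<n} (\<lambda>j. forms G k (\<lambda>\<gamma>. \<nu> \<gamma> * \<psi> \<gamma> ^ j))" if f: "f \<in> forms N k \<nu>" for f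
  proof -
    define rep where "rep z = (SOME \<gamma>. \<gamma> \<in> G \<and> \<psi> \<gamma> = z)" for z
    have rep: "rep z \<in> G" "\<psi> (rep z) = z" if "z \<in> U" for z
    proof -
      have "\<exists>\<gamma>. \<gamma> \<in> G \<and> \<psi> \<gamma> = z" using that \<psi>(2) unfolding U_def by (metis imageE)
      from someI_ex[OF this] show "rep z \<in> G" "\<psi> (rep z) = z" by (auto simp: rep_def)
    qed
    \<comment> \<open>Up to the factor \<open>\<nu> \<gamma>\<close>, slashing \<open>f\<close> by \<open>\<gamma>\<close> depends only on \<open>\<psi> \<gamma>\<close>.\<close>
    define \<Phi> where "\<Phi> z = (\<lambda>\<tau>. (1 / \<nu> (rep z)) * slash k f (rep z) \<tau>)" for z
    have \<Phi>_eq: "slash k f \<gamma> \<tau> = \<nu> \<gamma> * \<Phi> (\<psi> \<gamma>) \<tau>" if "\<gamma> \<in> G" for \<gamma> \<tau>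
    proof -
      define \<rho> where "\<rho> = rep (\<psi> \<gamma>)"
      have \<rho>: "\<rho> \<in> G" "\<psi> \<rho> = \<psi> \<gamma>" using rep \<psi>U[OF that] by (auto simp: \<rho>_def)
      define \<delta> where "\<delta> = \<gamma> ** adjugate \<rho>"
      have \<delta>: "\<delta> \<in> G" unfolding \<delta>_def using G \<rho> that by blast
      have \<gamma>: "\<gamma> = \<delta> ** \<rho>" unfolding \<delta>_def using mult_adjugate_cancel \<rho> G(1) by (metis subsetD)
      have "\<psi> \<gamma> = \<psi> \<delta> * \<psi> \<gamma>" using \<psi>(1)[OF \<delta> \<rho>(1)] \<rho>(2) unfolding \<gamma>[symmetric] by simp
      then have "\<delta> \<in> N" using \<delta> U(2)[OF \<psi>U[OF that]] by (simp add: N_def)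
      have "slash k f \<gamma> = slash k (slash k f \<delta>) \<rho>"
        unfolding \<gamma> by (rule slash_slash[symmetric]) (use \<delta> \<rho> G in auto)
      also have "slash k f \<delta> = (\<lambda>\<tau>. \<nu> \<delta> * f \<tau>)" by (rule forms_slash_eq[OF f \<open>\<delta> \<in> N\<close>])
      finally have "slash k f \<gamma> \<tau> = \<nu> \<delta> * slash k f \<rho> \<tau>" by (simp add: slash_scale)
      moreover have "\<nu> \<gamma> = \<nu> \<delta> * \<nu> \<rho>" unfolding \<gamma> by (rule \<nu>(1)[OF \<delta> \<rho>(1)])
      ultimately show ?thesis using \<nu>(2)[OF \<rho>(1)] by (simp add: \<Phi>_def \<rho>_def[symmetric])
    qed
    have \<Phi>_slash: "slash k (\<Phi> z) \<gamma> \<tau> = \<nu> \<gamma> * \<Phi> (z * \<psi> \<gamma>) \<tau>" if "z \<in> U" "\<gamma> \<in> G" for z \<gamma> \<tau>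
    proof -
      have "slash k (\<Phi> z) \<gamma> \<tau> = (1 / \<nu> (rep z)) * slash k (slash k f (rep z)) \<gamma> \<tau>"
        unfolding \<Phi>_def slash_scale ..
      also have "slash k (slash k f (rep z)) \<gamma> = slash k f (rep z ** \<gamma>)"
        by (rule slash_slash) (use rep[OF that(1)] that(2) G in auto)
      also have "\<dots> \<tau> = \<nu> (rep z ** \<gamma>) * \<Phi> (\<psi> (rep z ** \<gamma>)) \<tau>"
        by (rule \<Phi>_eq) (use rep[OF that(1)] that(2) G in auto)
      finally show ?thesis using rep[OF that(1)] that(2) \<nu> \<psi> by simp
    qed
    \<comment> \<open>The projection of \<open>f\<close> to the eigenspace of \<open>\<psi> ^ j\<close>.\<close>
    define v where "v j = (\<lambda>\<tau>. (1 / of_nat n) * (\<Sum>z\<in>U. inverse z ^ j * \<Phi> z \<tau>))" for j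
    have v: "v j \<in> forms G k (\<lambda>\<gamma>. \<nu> \<gamma> * \<psi> \<gamma> ^ j)" for j
      unfolding forms_def
    proof (intro CollectI conjI allI ballI impI)
      show "v j \<tau> = 0" if "Im \<tau> \<le> 0" for \<tau> using that by (simp add: v_def \<Phi>_def slash_def)
      have "slash k f (rep z) holomorphic_on \<H>" if "z \<in> U" for z
        by (rule holomorphic_slash) (use rep[OF that] G f in \<open>auto simp: forms_def\<close>)
      then show "v j holomorphic_on \<H>"
        unfolding v_def \<Phi>_def by (intro holomorphic_intros)
      show "slash k (v j) \<gamma> \<tau> = \<nu> \<gamma> * \<psi> \<gamma> ^ j * v j \<tau>" if "\<gamma> \<in> G" "Im \<tau> > 0" for \<gamma> \<tau>
      proof -
        have p: "\<psi> \<gamma> \<noteq> 0" using U(2) \<psi>U that by blast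
        have "slash k (v j) \<gamma> \<tau> = (1 / of_nat n) * (\<Sum>z\<in>U. inverse z ^ j * slash k (\<Phi> z) \<gamma> \<tau>)"
          by (simp only: v_def slash_scale slash_sum)
        also have "\<dots> = (1 / of_nat n) * (\<Sum>z\<in>U. \<nu> \<gamma> * \<psi> \<gamma> ^ j * (inverse (z * \<psi> \<gamma>) ^ j * \<Phi> (z * \<psi> \<gamma>) \<tau>))"
          using p by (intro arg_cong[where f = "(*) _"] sum.cong refl)
                     (simp add: \<Phi>_slash that power_mult_distrib power_inverse)
        also have "\<dots> = \<nu> \<gamma> * \<psi> \<gamma> ^ j * ((1 / of_nat n) * (\<Sum>z\<in>U. inverse (z * \<psi> \<gamma>) ^ j * \<Phi> (z * \<psi> \<gamma>) \<tau>))"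
          by (simp add: sum_distrib_left mult_ac)
        also have "(\<Sum>z\<in>U. inverse (z * \<psi> \<gamma>) ^ j * \<Phi> (z * \<psi> \<gamma>) \<tau>) = (\<Sum>z\<in>U. inverse z ^ j * \<Phi> z \<tau>)"
          by (rule sum.reindex_bij_witness[of _ "\<lambda>z. z / \<psi> \<gamma>" "\<lambda>z. z * \<psi> \<gamma>"])
             (use \<psi>U[OF that(1)] p in \<open>auto simp: U_def power_mult_distrib power_divide\<close>)
        finally show ?thesis by (simp add: v_def)
      qed
      show "Bfun (slash k (v j) \<gamma>) at_i_infinity" if "\<gamma> \<in> SL2Z" for \<gamma>
      proof -
        have "slash k (v j) \<gamma> = (\<lambda>\<tau>. (1 / of_nat n) * (\<Sum>z\<in>U. inverse z ^ j * ((1 / \<nu> (rep z)) * slash k f (rep z ** \<gamma>) \<tau>)))"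
        proof
          fix \<tau>
          have "slash k (slash k f (rep z)) \<gamma> = slash k f (rep z ** \<gamma>)" if "z \<in> U" for z
            by (rule slash_slash) (use rep[OF that] \<open>\<gamma> \<in> SL2Z\<close> G in auto)
          then show "slash k (v j) \<gamma> \<tau> = (1 / of_nat n) * (\<Sum>z\<in>U. inverse z ^ j * ((1 / \<nu> (rep z)) * slash k f (rep z ** \<gamma>) \<tau>))"
            by (simp only: v_def \<Phi>_def slash_scale slash_sum cong: sum.cong)
        qed
        moreover have "Bfun (slash k f (rep z ** \<gamma>)) at_i_infinity" if "z \<in> U" for z
          using f SL2Z_mult[of "rep z" \<gamma>] rep[OF that] \<open>\<gamma> \<in> SL2Z\<close> G(1) by (auto simp: forms_def)
        ultimately show ?thesis by (simp only:) (intro Bfun_scale Bfun_sum U)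
      qed
    qed
    have "f = (\<Sum>j<n. v j)"
    proof
      fix \<tau>
      have geom: "(\<Sum>j<n. inverse z ^ j) = (if z = 1 then of_nat n else 0)" if "z \<in> U" for z
      proof (cases "z = 1")
        case False
        then have "inverse z \<noteq> 1" by (metis inverse_1 inverse_inverse_eq)
        moreover have "inverse z ^ n = 1" using that by (simp add: U_def power_inverse)
        ultimately have "(\<Sum>j<n. inverse z ^ j) = 0" using geometric_sum[of "inverse z" n] by (simp only: diff_self div_0 simp_thms)
        then show ?thesis using False by (simp only: if_False)
      qed simp
      have "(\<Sum>j<n. v j) \<tau> = (1 / of_nat n) * (\<Sum>j<n. \<Sum>z\<in>U. inverse z ^ j * \<Phi> z \<tau>)"
        by (simp add: sum_fun_apply v_def sum_distrib_left)
      also have "(\<Sum>j<n. \<Sum>z\<in>U. inverse z ^ j * \<Phi> z \<tau>) = (\<Sum>z\<in>U. (\<Sum>j<n. inverse z ^ j) * \<Phi> z \<tau>)"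
        by (subst sum.swap) (simp add: sum_distrib_right)
      also have "\<dots> = (\<Sum>z\<in>U. if z = 1 then of_nat n * \<Phi> 1 \<tau> else 0)"
        by (intro sum.cong refl) (simp add: geom)
      also have "\<dots> = of_nat n * \<Phi> 1 \<tau>" using U by simp
      also have "(1 / of_nat n) * (of_nat n * \<Phi> 1 \<tau>) = \<Phi> 1 \<tau>" using n by simp
      also have "\<Phi> 1 \<tau> = f \<tau>"
      proof -
        have one: "\<nu> (mat 1) = 1" using \<nu>(1)[OF G(2,2)] \<nu>(2)[OF G(2)] by simp
        have \<psi>1: "\<psi> (mat 1) = 1" using \<psi>(1)[OF G(2,2)] U(2)[OF \<psi>U[OF G(2)]] by simp
        have "slash k f (mat 1) \<tau> = f \<tau>"
        proof (cases "Im \<tau> > 0")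
          case True
          then show ?thesis by (rule slash_mat_1)
        next
          case False
          then show ?thesis using f by (simp add: slash_def forms_def)
        qed
        then show ?thesis using \<Phi>_eq[OF G(2), of \<tau>] by (simp add: one \<psi>1)
      qed
      finally show "f \<tau> = (\<Sum>j<n. v j) \<tau>" by simp
    qed
    then show ?thesis unfolding subspace_sum_def using v
      by (intro CollectI exI[of _ "{..<n}"] exI[of _ v]) auto
  qed
  moreover have "independent_subspaces {..<n} (\<lambda>j. forms G k (\<lambda>\<gamma>. \<nu> \<gamma> * \<psi> \<gamma> ^ j))"
    unfolding independent_subspaces_def
  proof (intro allI impI)
    fix F and v :: "nat \<Rightarrow> complex \<Rightarrow> complex"
    assume F: "finite F" "F \<subseteq> {..<n}" and v: "\<forall>j\<in>F. v j \<in> forms G k (\<lambda>\<gamma>. \<nu> \<gamma> * \<psi> \<gamma> ^ j)" and s: "(\<Sum>j\<in>F. v j) = 0"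
    have "v j \<tau> = 0" if "j \<in> F" for j \<tau>
    proof -
      define c where "c i = (if i \<in> F then v i \<tau> else 0)" for i
      have "c j = 0"
      proof (rule coeff_eq_0_if_vanishes_on_roots_of_unity[OF n])
        show "j < n" using that F by auto
        fix z :: complex assume "z ^ n = 1"
        then have "z \<in> \<psi> ` G" using \<psi>(2) by simp
        then obtain \<gamma> where \<gamma>: "\<gamma> \<in> G" "\<psi> \<gamma> = z" by blast
        have s0: "(\<lambda>\<tau>. \<Sum>i\<in>F. v i \<tau>) = (\<lambda>\<tau>. 0)" using s by (simp add: fun_eq_iff flip: sum_fun_apply)
        have "0 = slash k (\<lambda>\<tau>. \<Sum>i\<in>F. v i \<tau>) \<gamma> \<tau>" unfolding s0 by (simp add: slash_def)
        also have "\<dots> = (\<Sum>i\<in>F. slash k (v i) \<gamma> \<tau>)" by (rule slash_sum)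
        also have "\<dots> = (\<Sum>i\<in>F. \<nu> \<gamma> * \<psi> \<gamma> ^ i * v i \<tau>)"
          by (intro sum.cong refl) (use forms_slash_eq v \<gamma> in auto)
        also have "\<dots> = \<nu> \<gamma> * (\<Sum>i\<in>F. v i \<tau> * z ^ i)" by (simp add: \<gamma> sum_distrib_left mult_ac)
        also have "(\<Sum>i\<in>F. v i \<tau> * z ^ i) = (\<Sum>i<n. c i * z ^ i)"
          unfolding c_def using F by (intro sum.mono_neutral_cong_left) auto
        finally show "(\<Sum>i<n. c i * z ^ i) = 0" using \<nu>(2)[OF \<gamma>(1)] by simp
      qed
      then show ?thesis using that by (simp add: c_def)
    qed
    then show "\<forall>j\<in>F. v j = 0" by (auto simp: fun_eq_iff)
  qed
  ultimately show ?thesis unfolding is_internal_direct_sum_def N_def by blast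
qed

text \<open>
  Evaluating a vanishing sum at \<open>\<gamma>\<tau>\<close> gives a polynomial relation in the value of the cocycle, with
  the values \<open>f\<^sub>k(\<tau>)\<close> as coefficients. The cocycle takes infinitely many values at \<open>\<tau>\<close> on \<open>\<Gamma>(9)\<close>, so all
  coefficients vanish.
\<close>

lemma independent_weights:
  "independent_subspaces UNIV (\<lambda>k. forms Gamma9 k (\<lambda>_. 1))"
  unfolding independent_subspaces_def
proof (intro allI impI)
  fix F and v :: "nat \<Rightarrow> complex \<Rightarrow> complex"
  assume F: "finite F" and v: "\<forall>j\<in>F. v j \<in> forms Gamma9 j (\<lambda>_. 1)" and s: "(\<Sum>j\<in>F. v j) = 0"
  have "v j \<tau> = 0" if j: "j \<in> F" and t: "Im \<tau> > 0" for j \<tau>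
  proof -
    define c where "c i = (if i \<in> F then v i \<tau> else 0)" for i
    define n where "n = Max F"
    have Fn: "F \<subseteq> {..n}" using F by (auto simp: n_def)
    \<comment> \<open>The denominators \<open>9 m \<tau> + 1\<close> are distinct, hence so are their cube roots.\<close>
    define \<gamma> where "\<gamma> m = mat22 1 0 (9 * int m) 1" for m
    have \<gamma>: "\<gamma> m \<in> Gamma9" "\<gamma> m \<in> Gamma3_diag" "\<gamma> m \<in> SL2Z" for m
      by (auto simp: \<gamma>_def Gamma9_iff residue9_def Gamma3_diag_iff)
    define x where "x m = third_factor (\<gamma> m) \<tau>" for m
    have "inj x"
    proof
      fix m m' assume "x m = x m'"
      then have "denom (\<gamma> m) \<tau> = denom (\<gamma> m') \<tau>" using third_factor_cubed[OF \<gamma>(2) t] unfolding x_def by metis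
      then have "of_int (9 * int m) * \<tau> = of_int (9 * int m') * \<tau>" by (simp add: denom_def \<gamma>_def)
      then show "m = m'" using t by auto
    qed
    have root: "(\<Sum>i\<le>n. c i * x m ^ i) = 0" for m
    proof -
      have "v i (act (\<gamma> m) \<tau>) = v i \<tau> * x m ^ i" if "i \<in> F" for i
      proof -
        have "v i \<in> forms Gamma9 i (\<lambda>_. 1)" using v that by blast
        from forms_slash_eq[OF this \<gamma>(1), of m] have "slash i (v i) (\<gamma> m) \<tau> = v i \<tau>" by simp
        then show ?thesis using t third_factor_nonzero[OF \<gamma>(3) t, of m] by (simp add: slash_def x_def field_simps)
      qed
      then have "(\<Sum>i\<in>F. v i \<tau> * x m ^ i) = (\<Sum>i\<in>F. v i) (act (\<gamma> m) \<tau>)" by (simp add: sum_fun_apply)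
      also have "\<dots> = 0" by (simp add: s)
      also have "(\<Sum>i\<in>F. v i \<tau> * x m ^ i) = (\<Sum>i\<le>n. c i * x m ^ i)"
        unfolding c_def using F Fn by (intro sum.mono_neutral_cong_left) auto
      finally show ?thesis .
    qed
    have "infinite (range x)" using \<open>inj x\<close> by (simp add: finite_image_iff)
    moreover have "range x \<subseteq> {z. (\<Sum>i\<le>n. c i * z ^ i) = 0}" using root by auto
    ultimately have "infinite {z. (\<Sum>i\<le>n. c i * z ^ i) = 0}" using finite_subset by blast
    then have "c j = 0" using Transcendental.polyfun_finite_roots[of c n] j Fn by auto
    then show ?thesis using j by (simp add: c_def)
  qed
  moreover have "v j \<tau> = 0" if "j \<in> F" "\<not> Im \<tau> > 0" for j \<tau> using v that by (auto simp: forms_def)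
  ultimately show "\<forall>j\<in>F. v j = 0" by (fastforce simp: fun_eq_iff)
qed

section \<open>Characters of the congruence subgroups\<close>

definition Gamma9_diag :: "mat2 set" where "Gamma9_diag = \<Gamma>\<^sub>0 9 \<inter> \<Gamma>\<^sup>0 9"

lemma Gamma9_diag_iff: "\<gamma> \<in> Gamma9_diag \<longleftrightarrow> \<gamma> \<in> SL2Z \<and> 9 dvd \<gamma>$1$2 \<and> 9 dvd \<gamma>$2$1"
  by (auto simp: Gamma9_diag_def Gamma_lower0_def Gamma_upper0_def)

lemma Gamma3_diag_mult: "\<gamma> \<in> Gamma3_diag \<Longrightarrow> \<delta> \<in> Gamma3_diag \<Longrightarrow> \<gamma> ** \<delta> \<in> Gamma3_diag"
  by (simp add: Gamma3_diag_iff SL2Z_mult mat2_mult_nth)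

lemma Gamma3_diag_adjugate: "\<gamma> \<in> Gamma3_diag \<Longrightarrow> adjugate \<gamma> \<in> Gamma3_diag"
  by (simp add: Gamma3_diag_iff adjugate_SL2Z)

lemma Gamma3_diag_one: "mat 1 \<in> Gamma3_diag"
  by (simp add: Gamma3_diag_iff)

text \<open>
  Modulo \<open>9\<close> the right column of \<open>\<gamma>\<delta>\<close> has the product \<open>a d b' d' + b d d'\<^sup>2\<close>. As \<open>b\<close> and \<open>b'\<close> are
  divisible by \<open>3\<close>, this is \<open>b' d' + b d\<close> because of \<open>a d \<equiv> 1\<close> and \<open>d'\<^sup>2 \<equiv> 1\<close> modulo \<open>3\<close>.
\<close>

lemma b9_mult:
  assumes "\<gamma> \<in> Gamma3_diag" "\<delta> \<in> Gamma3_diag"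
  shows "b9 (\<gamma> ** \<delta>) = b9 \<gamma> * b9 \<delta>"
proof -
  obtain \<beta> \<beta>' \<kappa> where e: "\<gamma>$1$2 = 3 * \<beta>" "\<delta>$1$2 = 3 * \<beta>'" "\<gamma>$2$1 = 3 * \<kappa>"
    using assms by (auto simp: Gamma3_diag_iff elim!: dvdE)
  define a d d' where "a = \<gamma>$1$1" and "d = \<gamma>$2$2" and "d' = \<delta>$2$2"
  have ad: "a * d = 1 + 9 * (\<beta> * \<kappa>)" using assms(1) by (simp add: Gamma3_diag_iff SL2Z_iff a_def d_def e)
  have "3 dvd d' * d' - 1" unfolding d'_def by (rule square_mod_3[OF Gamma3_diag_not_dvd[OF assms(2)]])
  then obtain r where r: "d' * d' = 1 + 3 * r" by (metis dvdE add.commute diff_add_cancel)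
  have b: "(\<gamma> ** \<delta>)$1$2 = 3 * (a * \<beta>' + \<beta> * d')" "(\<gamma> ** \<delta>)$2$2 = 9 * (\<kappa> * \<beta>') + d * d'"
    by (simp_all add: mat2_mult_nth e a_def d_def d'_def algebra_simps)
  have "b9 (\<gamma> ** \<delta>) = cis3 ((a * \<beta>' + \<beta> * d') * (9 * (\<kappa> * \<beta>') + d * d'))"
    by (simp add: b9_conv_cis3 b)
  also have "\<dots> = cis3 (\<beta> * d + \<beta>' * d')"
  proof (rule cis3_cong)
    have "(a * \<beta>' + \<beta> * d') * (9 * (\<kappa> * \<beta>') + d * d') - (\<beta> * d + \<beta>' * d') =
       9 * ((a * \<beta>' + \<beta> * d') * (\<kappa> * \<beta>')) + (a * d - 1) * (\<beta>' * d') + \<beta> * d * (d' * d' - 1)"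
      by (simp add: algebra_simps)
    also have "\<dots> = 3 * (3 * ((a * \<beta>' + \<beta> * d') * (\<kappa> * \<beta>')) + 3 * (\<beta> * \<kappa>) * (\<beta>' * d') + \<beta> * d * r)"
      unfolding ad r by (simp add: algebra_simps)
    finally show "3 dvd (a * \<beta>' + \<beta> * d') * (9 * (\<kappa> * \<beta>') + d * d') - (\<beta> * d + \<beta>' * d')" by simp
  qed
  also have "\<dots> = b9 \<gamma> * b9 \<delta>" by (simp add: cis3_add b9_conv_cis3 e d_def d'_def)
  finally show ?thesis .
qed

lemma c9_mult:
  assumes "\<gamma> \<in> Gamma3_diag" "\<delta> \<in> Gamma3_diag"
  shows "c9 (\<gamma> ** \<delta>) = c9 \<gamma> * c9 \<delta>"
proof -
  obtain \<kappa> \<kappa>' \<beta>' where e: "\<gamma>$2$1 = 3 * \<kappa>" "\<delta>$2$1 = 3 * \<kappa>'" "\<delta>$1$2 = 3 * \<beta>'"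
    using assms by (auto simp: Gamma3_diag_iff elim!: dvdE)
  define d a' d' where "d = \<gamma>$2$2" and "a' = \<delta>$1$1" and "d' = \<delta>$2$2"
  have ad: "a' * d' = 1 + 9 * (\<beta>' * \<kappa>')" using assms(2) by (simp add: Gamma3_diag_iff SL2Z_iff a'_def d'_def e)
  have "3 dvd d * d - 1" unfolding d_def by (rule square_mod_3[OF Gamma3_diag_not_dvd[OF assms(1)]])
  then obtain r where r: "d * d = 1 + 3 * r" by (metis dvdE add.commute diff_add_cancel)
  have b: "(\<gamma> ** \<delta>)$2$1 = 3 * (\<kappa> * a' + d * \<kappa>')" "(\<gamma> ** \<delta>)$2$2 = 9 * (\<kappa> * \<beta>') + d * d'"
    by (simp_all add: mat2_mult_nth e d_def a'_def d'_def algebra_simps)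
  have "c9 (\<gamma> ** \<delta>) = cis3 (- ((\<kappa> * a' + d * \<kappa>') * (9 * (\<kappa> * \<beta>') + d * d')))"
    by (simp add: c9_conv_cis3 b)
  also have "\<dots> = cis3 (- (\<kappa> * d) + - (\<kappa>' * d'))"
  proof (rule cis3_cong)
    have "- ((\<kappa> * a' + d * \<kappa>') * (9 * (\<kappa> * \<beta>') + d * d')) - (- (\<kappa> * d) + - (\<kappa>' * d')) =
       - (9 * ((\<kappa> * a' + d * \<kappa>') * (\<kappa> * \<beta>')) + (a' * d' - 1) * (\<kappa> * d) + \<kappa>' * d' * (d * d - 1))"
      by (simp add: algebra_simps)
    also have "\<dots> = 3 * (- (3 * ((\<kappa> * a' + d * \<kappa>') * (\<kappa> * \<beta>')) + 3 * (\<beta>' * \<kappa>') * (\<kappa> * d) + \<kappa>' * d' * r))"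
      unfolding ad r by (simp add: algebra_simps)
    finally show "3 dvd - ((\<kappa> * a' + d * \<kappa>') * (9 * (\<kappa> * \<beta>') + d * d')) - (- (\<kappa> * d) + - (\<kappa>' * d'))" by simp
  qed
  also have "\<dots> = c9 \<gamma> * c9 \<delta>" by (simp only: cis3_add) (simp add: c9_conv_cis3 e d_def d'_def)
  finally show ?thesis .
qed

lemma coprime_3_imp_coprime_9:
  assumes "\<not> 3 dvd (d::int)"
  shows "coprime d 9"
proof -
  have "coprime 3 d" using assms by (simp add: prime_imp_coprime)
  then have "coprime (3 * 3) d" by (simp only: coprime_mult_left_iff)
  then show ?thesis by (simp add: coprime_commute)
qed

lemma chi9_mult:
  assumes "\<gamma> \<in> Gamma3_diag" "\<delta> \<in> Gamma3_diag"
  shows "chi9 (\<gamma> ** \<delta>) = chi9 \<gamma> * chi9 \<delta>"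
proof -
  obtain \<kappa> \<beta>' where e: "\<gamma>$2$1 = 3 * \<kappa>" "\<delta>$1$2 = 3 * \<beta>'" using assms by (auto simp: Gamma3_diag_iff elim!: dvdE)
  have "[(\<gamma> ** \<delta>)$2$2 = \<gamma>$2$2 * \<delta>$2$2] (mod 9)"
    by (simp add: mat2_mult_nth e cong_iff_dvd_diff)
  from chi9_unit_cong[OF this] show ?thesis by (simp add: chi9_def chi9_unit_mult)
qed

definition zeta6 :: complex where "zeta6 = exp (2 * of_real pi * \<i> / 6)"

lemma zeta6_6: "zeta6 ^ 6 = 1"
proof -
  have "of_nat 6 * (2 * of_real pi * \<i> / 6) = 2 * of_real pi * (\<i>::complex)" by simp
  then show ?thesis unfolding zeta6_def exp_of_nat_mult[symmetric] by (simp only: exp_two_pi_i)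
qed

lemma chi9_unit_conv:
  assumes "\<not> 3 dvd d"
  obtains n where "[2 ^ n = d] (mod 9)" "chi9_unit d = zeta6 ^ n"
  using ex_pow2_cong_9[OF coprime_3_imp_coprime_9[OF assms]] chi9_unit_pow2 unfolding zeta6_def by blast

lemma chi9_unit_power_6:
  assumes "\<not> 3 dvd d"
  shows "chi9_unit d ^ 6 = 1"
proof -
  obtain n where "chi9_unit d = zeta6 ^ n" using chi9_unit_conv[OF assms] by blast
  then have "chi9_unit d ^ 6 = (zeta6 ^ 6) ^ n" by (simp only: power_mult[symmetric] mult.commute)
  then show ?thesis by (simp add: zeta6_6)
qed

lemma chi9_unit_1: "[d = 1] (mod 9) \<Longrightarrow> chi9_unit d = 1"
  using chi9_unit_pow2[of 0 d] by (simp add: cong_sym)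

lemma chi9_unit_eq_1_iff:
  assumes "\<not> 3 dvd d"
  shows "chi9_unit d = 1 \<longleftrightarrow> [d = 1] (mod 9)"
proof
  assume 1: "chi9_unit d = 1"
  obtain n where n: "[2 ^ n = d] (mod 9)" "chi9_unit d = zeta6 ^ n" using chi9_unit_conv[OF assms] by blast
  have "exp (of_nat n * (2 * of_real pi * \<i> / 6)) = (1::complex)"
    unfolding exp_of_nat_mult zeta6_def[symmetric] using 1 n(2) by simp
  then obtain m :: int where "real n * (2 * pi) / 6 = of_int (2 * m) * pi" unfolding exp_eq_1 by auto
  then have "real_of_int (int n) = real_of_int (6 * m)" using pi_neq_zero by (simp add: field_simps)
  then have "int n = 6 * m" by (simp only: of_int_eq_iff)
  then have "n mod 6 = 0 mod 6" by presburger
  then have "[(2::int) ^ n = 2 ^ 0] (mod 9)" by (simp only: pow2_cong_9_iff)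
  then have "[(2::int) ^ n = 1] (mod 9)" by simp
  then show "[d = 1] (mod 9)" using n(1) cong_sym cong_trans by blast
qed (rule chi9_unit_1)

text \<open>
  The sign in the multipliers of the eta quotients is therefore a power of \<open>\<chi>\<^sub>9\<close>, which permits the
  graded pieces to be indexed by powers of \<open>\<chi>\<^sub>9\<close> alone.
\<close>

lemma chi3_eq_chi9_cubed:
  assumes "\<not> 3 dvd d"
  shows "chi3 d = chi9_unit d ^ 3"
proof -
  obtain n where n: "[2 ^ n = d] (mod 9)" "chi9_unit d = zeta6 ^ n" using chi9_unit_conv[OF assms] by blast
  have z: "zeta6 ^ 3 = - 1"
  proof -
    have "zeta6 ^ 3 = exp (of_real pi * \<i>)" by (simp add: zeta6_def flip: exp_of_nat_mult)
    then show ?thesis by simp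
  qed
  have "[2 ^ n = d] (mod 3)" using n(1) by (rule cong_dvd_modulus) simp
  moreover have "chi3 (2 ^ n) = (- 1) ^ n"
  proof (induction n)
    case (Suc n)
    have "chi3 (2 ^ Suc n) = chi3 (- (2 ^ n))" by (rule chi3_cong) simp
    then show ?case by (simp add: chi3_minus Suc)
  qed (simp add: chi3_def)
  ultimately have "chi3 d = (- 1) ^ n"
    using chi3_cong[of "2 ^ n" d] by (simp add: cong_iff_dvd_diff)
  also have "\<dots> = (zeta6 ^ 3) ^ n" by (simp only: z)
  also have "\<dots> = chi9_unit d ^ 3" unfolding n(2) by (simp only: power_mult[symmetric] mult.commute)
  finally show ?thesis .
qed

lemma cis3_eq_1_iff: "cis3 n = 1 \<longleftrightarrow> 3 dvd n"
proof
  assume "cis3 n = 1"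
  then have "exp (2 * of_real pi * \<i> * of_int n / 3 :: complex) = 1" by (simp add: cis3_def)
  then obtain m :: int where "2 * pi * of_int n / 3 = of_int (2 * m) * pi" unfolding exp_eq_1 by auto
  then have "real_of_int n = real_of_int (3 * m)" using pi_neq_zero by (simp add: field_simps)
  then have "n = 3 * m" by (simp only: of_int_eq_iff)
  then show "3 dvd n" by simp
qed (rule cis3_dvd)

lemma dvd_9_iff:
  assumes "3 dvd b" "\<not> 3 dvd (d::int)"
  shows "3 dvd b div 3 * d \<longleftrightarrow> 9 dvd b"
proof -
  have "prime (3::int)" by simp
  then have "3 dvd b div 3 * d \<longleftrightarrow> 3 dvd b div 3" using assms(2) by (simp add: prime_dvd_mult_iff)
  also have "\<dots> \<longleftrightarrow> 9 dvd b" using assms(1) by presburger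
  finally show ?thesis .
qed

lemma Gamma9_diag_eq_kernel: "Gamma9_diag = {\<gamma> \<in> {\<gamma> \<in> Gamma3_diag. b9 \<gamma> = 1}. c9 \<gamma> = 1}"
proof (intro set_eqI iffI)
  fix \<gamma> assume "\<gamma> \<in> Gamma9_diag"
  then have s: "\<gamma> \<in> SL2Z" "9 dvd \<gamma>$1$2" "9 dvd \<gamma>$2$1" by (auto simp: Gamma9_diag_iff)
  have "(3::int) dvd 9" by simp
  then have \<gamma>: "\<gamma> \<in> Gamma3_diag" using s dvd_trans by (auto simp: Gamma3_diag_iff)
  then show "\<gamma> \<in> {\<gamma> \<in> {\<gamma> \<in> Gamma3_diag. b9 \<gamma> = 1}. c9 \<gamma> = 1}"
    using s dvd_9_iff[OF _ Gamma3_diag_not_dvd[OF \<gamma>]] by (auto simp: b9_conv_cis3 c9_conv_cis3 cis3_eq_1_iff Gamma3_diag_iff)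
next
  fix \<gamma> assume "\<gamma> \<in> {\<gamma> \<in> {\<gamma> \<in> Gamma3_diag. b9 \<gamma> = 1}. c9 \<gamma> = 1}"
  then have \<gamma>: "\<gamma> \<in> Gamma3_diag" "b9 \<gamma> = 1" "c9 \<gamma> = 1" by auto
  then show "\<gamma> \<in> Gamma9_diag"
    using dvd_9_iff[OF _ Gamma3_diag_not_dvd[OF \<gamma>(1)]]
    by (auto simp: b9_conv_cis3 c9_conv_cis3 cis3_eq_1_iff Gamma3_diag_iff Gamma9_diag_iff)
qed

lemma Gamma9_eq_kernel: "Gamma9 = {\<gamma> \<in> Gamma9_diag. chi9 \<gamma> = 1}"
proof (intro set_eqI iffI)
  fix \<gamma> assume "\<gamma> \<in> Gamma9"
  then show "\<gamma> \<in> {\<gamma> \<in> Gamma9_diag. chi9 \<gamma> = 1}"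
    by (auto simp: principal_congruence_subgroup_def Gamma9_diag_iff chi9_def chi9_unit_1 cong_0_iff)
next
  fix \<gamma> assume "\<gamma> \<in> {\<gamma> \<in> Gamma9_diag. chi9 \<gamma> = 1}"
  then have g: "\<gamma> \<in> Gamma9_diag" "chi9_unit (\<gamma>$2$2) = 1" by (auto simp: chi9_def)
  then have "\<gamma> \<in> Gamma3_diag" unfolding Gamma9_diag_eq_kernel by simp
  then have d: "[\<gamma>$2$2 = 1] (mod 9)" using g(2) chi9_unit_eq_1_iff[OF Gamma3_diag_not_dvd] by simp
  have "[\<gamma>$1$1 * 1 = \<gamma>$1$1 * \<gamma>$2$2] (mod 9)" by (intro cong_mult cong_refl cong_sym[OF d])
  also have "\<gamma>$1$1 * \<gamma>$2$2 = 1 + \<gamma>$1$2 * \<gamma>$2$1" using g by (simp add: Gamma9_diag_iff SL2Z_iff)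
  also have "[1 + \<gamma>$1$2 * \<gamma>$2$1 = 1] (mod 9)" using g by (simp add: cong_iff_dvd_diff Gamma9_diag_iff)
  finally have "[\<gamma>$1$1 = 1] (mod 9)" by simp
  then show "\<gamma> \<in> Gamma9"
    using d g by (auto simp: principal_congruence_subgroup_def Gamma9_diag_iff cong_0_iff)
qed

lemma Gamma9_diag_subset: "Gamma9_diag \<subseteq> Gamma3_diag" and Gamma9_subset: "Gamma9 \<subseteq> Gamma9_diag"
  unfolding Gamma9_diag_eq_kernel Gamma9_eq_kernel by auto

text \<open>
  One element whose value is a primitive root of unity is enough.
\<close>

lemma image_eq_roots_of_unity:
  fixes \<psi> :: "mat2 \<Rightarrow> complex"
  assumes G: "\<And>\<gamma> \<delta>. \<gamma> \<in> G \<Longrightarrow> \<delta> \<in> G \<Longrightarrow> \<gamma> ** \<delta> \<in> G" "mat 1 \<in> G"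
    and \<psi>: "\<And>\<gamma> \<delta>. \<gamma> \<in> G \<Longrightarrow> \<delta> \<in> G \<Longrightarrow> \<psi> (\<gamma> ** \<delta>) = \<psi> \<gamma> * \<psi> \<delta>" "\<psi> (mat 1) = 1"
    and n: "n > 0" "\<And>\<gamma>. \<gamma> \<in> G \<Longrightarrow> \<psi> \<gamma> ^ n = 1"
    and g: "g \<in> G" "\<psi> g = exp (2 * of_real pi * \<i> / of_nat n)"
  shows "\<psi> ` G = {z. z ^ n = 1}"
proof
  show "\<psi> ` G \<subseteq> {z. z ^ n = 1}" using n by auto
  have pow: "\<exists>\<gamma>\<in>G. \<psi> \<gamma> = \<psi> g ^ i" for i
  proof (induction i)
    case 0
    then show ?case using G(2) \<psi>(2) by auto
  next
    case (Suc i)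
    then obtain \<gamma> where "\<gamma> \<in> G" "\<psi> \<gamma> = \<psi> g ^ i" by blast
    then show ?case using G(1)[OF g(1)] \<psi>(1)[OF g(1)] by (intro bexI[of _ "g ** \<gamma>"]) auto
  qed
  show "{z. z ^ n = 1} \<subseteq> \<psi> ` G"
  proof
    fix z :: complex assume "z \<in> {z. z ^ n = 1}"
    then obtain i where "z = cis (2 * pi * real i / real n)"
      using bij_betw_imp_surj_on[OF Complex.bij_betw_roots_unity[OF n(1)]] by blast
    also have "\<dots> = \<psi> g ^ i"
      unfolding g(2) by (simp add: cis_conv_exp mult_ac flip: exp_of_nat_mult)
    finally show "z \<in> \<psi> ` G" using pow[of i] by (metis imageI)
  qed
qed

section \<open>Decomposition by characters\<close>

text \<open>
  The multiplier of the forms with character \<open>\<chi>\<^sub>9\<^sup>j\<close> relative to \<open>third_factor\<close>; the denominator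
  comes from the normalization of the automorphy factor.
\<close>

definition level_multiplier :: "nat \<Rightarrow> nat \<Rightarrow> mat2 \<Rightarrow> complex" where
  "level_multiplier k j \<gamma> = chi9 \<gamma> ^ j / (c9 \<gamma> * b9 \<gamma>) ^ k"

lemma chi9_nonzero: "\<gamma> \<in> Gamma3_diag \<Longrightarrow> chi9 \<gamma> \<noteq> 0"
  using chi9_unit_power_6[OF Gamma3_diag_not_dvd, of \<gamma>] by (auto simp: chi9_def)

lemma level_multiplier_mult:
  "\<gamma> \<in> Gamma3_diag \<Longrightarrow> \<delta> \<in> Gamma3_diag \<Longrightarrow> level_multiplier k j (\<gamma> ** \<delta>) = level_multiplier k j \<gamma> * level_multiplier k j \<delta>"
  by (simp add: level_multiplier_def chi9_mult c9_mult b9_mult power_mult_distrib)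

lemma level_multiplier_nonzero: "\<gamma> \<in> Gamma3_diag \<Longrightarrow> level_multiplier k j \<gamma> \<noteq> 0"
  by (simp add: level_multiplier_def chi9_nonzero)

lemma modular_forms_level_9: "modular_forms_level 9 k j = forms Gamma9_diag k (level_multiplier k j)"
  unfolding modular_forms_level_def Gamma9_diag_def[symmetric] level_multiplier_def[abs_def]
  using modular_forms_eq_forms[of Gamma9_diag k "chi9 ^ j"] Gamma9_diag_subset Gamma3_diag_subset_SL2Z
  by (auto simp: power_fun_apply)

lemma modular_forms_level_3: "modular_forms_level 3 k j = forms Gamma3_diag k (level_multiplier k j)"
  unfolding modular_forms_level_def Gamma3_diag_def[symmetric] level_multiplier_def[abs_def]
  using modular_forms_eq_forms[of Gamma3_diag k "chi9 ^ j"] Gamma3_diag_subset_SL2Z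
  by (auto simp: power_fun_apply)

lemma Gamma9_diag_trivial: "\<gamma> \<in> Gamma9_diag \<Longrightarrow> c9 \<gamma> = 1 \<and> b9 \<gamma> = 1"
  by (simp add: Gamma9_diag_eq_kernel)

lemma modular_forms_Gamma9: "modular_forms_triv Gamma9 k = forms Gamma9 k (\<lambda>_. 1)"
proof -
  from modular_forms_eq_forms[OF Gamma9_subset_SL2Z]
  have "modular_forms_triv Gamma9 k =
      forms Gamma9 k (\<lambda>\<gamma>. 1 / (c9 \<gamma> * b9 \<gamma>) ^ k)" .
  also have "\<dots> = forms Gamma9 k (\<lambda>_. 1)"
  proof (rule forms_cong)
    fix \<gamma> assume "\<gamma> \<in> Gamma9"
    then have "c9 \<gamma> = 1 \<and> b9 \<gamma> = 1" using Gamma9_subset Gamma9_diag_trivial by blast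
    then show "1 / (c9 \<gamma> * b9 \<gamma>) ^ k = 1" by simp
  qed
  finally show ?thesis .
qed

lemma Gamma3_diag_units: "\<gamma> \<in> Gamma3_diag \<Longrightarrow> b9 \<gamma> ^ 3 = 1 \<and> c9 \<gamma> ^ 3 = 1"
  by (simp add: Gamma3_diag_iff b9_conv_cis3 c9_conv_cis3 cis3_power cis3_dvd)

lemma characters_mat_1: "b9 (mat 1) = 1" "c9 (mat 1) = 1" "chi9 (mat 1) = 1"
  by (simp_all add: b9_def c9_def chi9_def chi9_unit_1)

lemma character_adjugate_eq_1:
  assumes "\<gamma> \<in> Gamma3_diag" "\<psi> \<gamma> = (1::complex)" "\<psi> (mat 1) = 1"
    "\<And>\<gamma> \<delta>. \<gamma> \<in> Gamma3_diag \<Longrightarrow> \<delta> \<in> Gamma3_diag \<Longrightarrow> \<psi> (\<gamma> ** \<delta>) = \<psi> \<gamma> * \<psi> \<delta>"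
  shows "\<psi> (adjugate \<gamma>) = 1"
proof -
  have "\<psi> (\<gamma> ** adjugate \<gamma>) = \<psi> \<gamma> * \<psi> (adjugate \<gamma>)" by (rule assms(4)[OF assms(1) Gamma3_diag_adjugate[OF assms(1)]])
  then show ?thesis using assms(2,3) adjugate_right[OF Gamma3_diag_SL2Z[OF assms(1)]] by simp
qed

text \<open>
  The first decomposition of the theorem: \<open>\<Gamma>(9)\<close> is the kernel of \<open>\<chi>\<^sub>9\<close> on \<open>\<Gamma>\<^sub>0(9) \<inter> \<Gamma>\<^sup>0(9)\<close>, where
  \<open>c9\<close> and \<open>b9\<close> are trivial.
\<close>

lemma decomposition_Gamma9:
  "is_internal_direct_sum (modular_forms_triv Gamma9 k) {0..5} (modular_forms_level 9 k)"
proof -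
  have I: "{0..5} = {..<6::nat}" by auto
  have im: "chi9 ` Gamma9_diag = {z. z ^ 6 = 1}"
  proof (rule image_eq_roots_of_unity)
    \<comment> \<open>A matrix of the group with lower right entry \<open>2\<close>, which generates the units modulo \<open>9\<close>.\<close>
    show "mat22 41 9 9 2 \<in> Gamma9_diag" by (simp add: Gamma9_diag_iff)
    show "chi9 (mat22 41 9 9 2) = exp (2 * of_real pi * \<i> / of_nat 6)" using chi9_unit_2 by (simp add: chi9_def)
    show "chi9 \<gamma> ^ 6 = 1" if "\<gamma> \<in> Gamma9_diag" for \<gamma>
      unfolding chi9_def using chi9_unit_power_6 Gamma3_diag_not_dvd Gamma9_diag_subset that by blast
    show "\<gamma> ** \<delta> \<in> Gamma9_diag" if "\<gamma> \<in> Gamma9_diag" "\<delta> \<in> Gamma9_diag" for \<gamma> \<delta>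
      using that by (simp add: Gamma9_diag_iff SL2Z_mult mat2_mult_nth)
    show "chi9 (\<gamma> ** \<delta>) = chi9 \<gamma> * chi9 \<delta>" if "\<gamma> \<in> Gamma9_diag" "\<delta> \<in> Gamma9_diag" for \<gamma> \<delta>
      using that chi9_mult Gamma9_diag_subset by blast
  qed (use characters_mat_1 in \<open>auto simp: Gamma9_diag_iff\<close>)
  have "is_internal_direct_sum (forms {\<gamma> \<in> Gamma9_diag. chi9 \<gamma> = 1} k (\<lambda>_. 1)) {..<6} (\<lambda>j. forms Gamma9_diag k (\<lambda>\<gamma>. 1 * chi9 \<gamma> ^ j))"
  proof (rule cyclic_decomposition[OF _ _ _ _ _ _ _ im])
    show "\<gamma> ** \<delta> \<in> Gamma9_diag" if "\<gamma> \<in> Gamma9_diag" "\<delta> \<in> Gamma9_diag" for \<gamma> \<delta>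
      using that by (simp add: Gamma9_diag_iff SL2Z_mult mat2_mult_nth)
    show "adjugate \<gamma> \<in> Gamma9_diag" if "\<gamma> \<in> Gamma9_diag" for \<gamma>
      using that by (simp add: Gamma9_diag_iff adjugate_SL2Z)
    show "chi9 (\<gamma> ** \<delta>) = chi9 \<gamma> * chi9 \<delta>" if "\<gamma> \<in> Gamma9_diag" "\<delta> \<in> Gamma9_diag" for \<gamma> \<delta>
      using that chi9_mult Gamma9_diag_subset by blast
  qed (auto simp: Gamma9_diag_iff)
  moreover have "forms Gamma9_diag k (\<lambda>\<gamma>. 1 * chi9 \<gamma> ^ j) = modular_forms_level 9 k j" for j
    unfolding modular_forms_level_9 by (rule forms_cong) (simp add: level_multiplier_def Gamma9_diag_trivial)
  ultimately show ?thesis unfolding I modular_forms_Gamma9 Gamma9_eq_kernel[symmetric] by simp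
qed

text \<open>
  The exponents are arranged so that the monomial with these exponents maps level \<open>3\<close> into the piece \<open>(a, b)\<close>:
  relative to the weight factor \<open>(c9 b9)\<^sup>-\<^sup>1\<close>, a multiplier \<open>1 / b9\<close> amounts to \<open>c9\<close>.
\<close>

definition character_forms :: "nat \<Rightarrow> nat \<Rightarrow> nat \<Rightarrow> nat \<Rightarrow> (complex \<Rightarrow> complex) set" where
  "character_forms k j a b = forms Gamma3_diag k (\<lambda>\<gamma>. level_multiplier k j \<gamma> * c9 \<gamma> ^ a * b9 \<gamma> ^ b)"

text \<open>
  Two steps with cyclic groups of order \<open>3\<close>, since \<open>\<Gamma>\<^sub>0(9) \<inter> \<Gamma>\<^sup>0(9)\<close> is the common kernel of \<open>c9\<close> and
  \<open>b9\<close>.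
\<close>

lemma decomposition_level_9:
  "is_internal_direct_sum (modular_forms_level 9 k j) ({0, 1, 2} \<times> {0, 1, 2}) (\<lambda>(a, b). character_forms k j a b)"
proof -
  have I: "{0, 1, 2} = {..<3::nat}" by auto
  \<comment> \<open>The intermediate group between the two levels: first \<open>c9\<close> is split off, then \<open>b9\<close>.\<close>
  define H where "H = {\<gamma> \<in> Gamma3_diag. b9 \<gamma> = 1}"
  have H: "H \<subseteq> Gamma3_diag" "\<And>\<gamma> \<delta>. \<gamma> \<in> H \<Longrightarrow> \<delta> \<in> H \<Longrightarrow> \<gamma> ** \<delta> \<in> H" "\<And>\<gamma>. \<gamma> \<in> H \<Longrightarrow> adjugate \<gamma> \<in> H" "mat 1 \<in> H"
    using character_adjugate_eq_1[of _ b9] by (auto simp: H_def Gamma3_diag_mult Gamma3_diag_adjugate Gamma3_diag_one b9_mult characters_mat_1)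
  have Hd: "\<gamma> \<in> Gamma3_diag" if "\<gamma> \<in> H" for \<gamma> using H(1) that by blast
  have c9H: "c9 (\<gamma> ** \<delta>) = c9 \<gamma> * c9 \<delta>" if "\<gamma> \<in> H" "\<delta> \<in> H" for \<gamma> \<delta>
    using that by (simp add: c9_mult Hd)
  have kjH: "level_multiplier k j (\<gamma> ** \<delta>) = level_multiplier k j \<gamma> * level_multiplier k j \<delta>" if "\<gamma> \<in> H" "\<delta> \<in> H" for \<gamma> \<delta>
    using that by (simp add: level_multiplier_mult Hd)
  have imc: "c9 ` H = {z. z ^ 3 = 1}"
  proof (rule image_eq_roots_of_unity[where g = "mat22 1 0 (-3) 1"])
    show "c9 (mat22 1 0 (-3) 1) = exp (2 * of_real pi * \<i> / of_nat 3)" by (simp add: c9_def mult_ac)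
    show "mat22 1 0 (-3) 1 \<in> H" by (simp add: H_def Gamma3_diag_iff b9_def)
  qed (simp_all add: H(2,4) c9H characters_mat_1 Gamma3_diag_units Hd)
  have imb: "b9 ` Gamma3_diag = {z. z ^ 3 = 1}"
  proof (rule image_eq_roots_of_unity[where g = "mat22 1 3 0 1"])
    show "b9 (mat22 1 3 0 1) = exp (2 * of_real pi * \<i> / of_nat 3)" by (simp add: b9_def mult_ac)
    show "mat22 1 3 0 1 \<in> Gamma3_diag" by (simp add: Gamma3_diag_iff)
  qed (simp_all add: Gamma3_diag_mult Gamma3_diag_one b9_mult Gamma3_diag_units characters_mat_1)
  define W where "W a = forms H k (\<lambda>\<gamma>. level_multiplier k j \<gamma> * c9 \<gamma> ^ a)" for a
  have HS: "H \<subseteq> SL2Z" using H Gamma3_diag_subset_SL2Z by blast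
  have "is_internal_direct_sum (forms {\<gamma> \<in> H. c9 \<gamma> = 1} k (level_multiplier k j)) {..<3} W"
    unfolding W_def[abs_def]
    by (rule cyclic_decomposition[OF HS H(4,2,3) kjH _ c9H imc]) (simp_all add: level_multiplier_nonzero Hd)
  moreover have "Gamma9_diag = {\<gamma> \<in> H. c9 \<gamma> = 1}" by (simp only: Gamma9_diag_eq_kernel H_def)
  ultimately have 1: "is_internal_direct_sum (modular_forms_level 9 k j) {..<3} W"
    by (simp only: modular_forms_level_9)
  have 2: "is_internal_direct_sum (W a) {..<3} (character_forms k j a)" for a
  proof -
    have "is_internal_direct_sum (forms {\<gamma> \<in> Gamma3_diag. b9 \<gamma> = 1} k (\<lambda>\<gamma>. level_multiplier k j \<gamma> * c9 \<gamma> ^ a)) {..<3}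
        (\<lambda>b. forms Gamma3_diag k (\<lambda>\<gamma>. level_multiplier k j \<gamma> * c9 \<gamma> ^ a * b9 \<gamma> ^ b))"
      by (rule cyclic_decomposition[OF Gamma3_diag_subset_SL2Z Gamma3_diag_one Gamma3_diag_mult Gamma3_diag_adjugate _ _ _ imb])
         (simp_all add: level_multiplier_mult level_multiplier_nonzero b9_mult c9_mult power_mult_distrib)
    then show ?thesis by (simp add: W_def H_def character_forms_def[abs_def])
  qed
  have "is_internal_direct_sum (modular_forms_level 9 k j) ({..<3} \<times> {..<3}) (\<lambda>(a, b). character_forms k j a b)"
    by (rule is_internal_direct_sum_trans[OF 1 2])
       (simp_all add: character_forms_def forms_0[OF Gamma3_diag_subset_SL2Z] forms_add[OF Gamma3_diag_subset_SL2Z])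
  then show ?thesis by (simp only: I)
qed

section \<open>Multiplication and division of forms\<close>

lemma forms_multiply:
  assumes f: "f \<in> forms G k \<nu>" and u: "u holomorphic_on \<H>"
    and inv: "\<And>\<gamma> \<tau>. \<gamma> \<in> G \<Longrightarrow> Im \<tau> > 0 \<Longrightarrow> slash l u \<gamma> \<tau> = \<mu> \<gamma> * u \<tau>"
    and bdd: "\<And>\<gamma>. \<gamma> \<in> SL2Z \<Longrightarrow> Bfun (slash l u \<gamma>) at_i_infinity"
  shows "(\<lambda>\<tau>. f \<tau> * u \<tau>) \<in> forms G (k + l) (\<lambda>\<gamma>. \<nu> \<gamma> * \<mu> \<gamma>)"
  unfolding forms_def
proof (intro CollectI conjI allI ballI impI)
  show "f \<tau> * u \<tau> = 0" if "Im \<tau> \<le> 0" for \<tau> using f that by (simp add: forms_def)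
  show "(\<lambda>\<tau>. f \<tau> * u \<tau>) holomorphic_on \<H>" using f u by (auto simp: forms_def intro!: holomorphic_intros)
  show "slash (k + l) (\<lambda>\<tau>. f \<tau> * u \<tau>) \<gamma> \<tau> = \<nu> \<gamma> * \<mu> \<gamma> * (f \<tau> * u \<tau>)" if "\<gamma> \<in> G" "Im \<tau> > 0" for \<gamma> \<tau>
    using f that inv[OF that] by (simp add: slash_mult forms_def)
  show "Bfun (slash (k + l) (\<lambda>\<tau>. f \<tau> * u \<tau>) \<gamma>) at_i_infinity" if \<gamma>: "\<gamma> \<in> SL2Z" for \<gamma>
  proof -
    obtain A where A: "A > 0" "eventually (\<lambda>\<tau>. norm (slash k f \<gamma> \<tau>) \<le> A) at_i_infinity"
      using f \<gamma> by (auto simp: forms_def Bfun_def)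
    obtain B where B: "B > 0" "eventually (\<lambda>\<tau>. norm (slash l u \<gamma> \<tau>) \<le> B) at_i_infinity"
      using bdd[OF \<gamma>] by (auto simp: Bfun_def)
    show ?thesis
    proof (rule BfunI)
      show "eventually (\<lambda>\<tau>. norm (slash (k + l) (\<lambda>\<tau>. f \<tau> * u \<tau>) \<gamma> \<tau>) \<le> A * B) at_i_infinity"
        using A(2) B(2) by eventually_elim (use A(1) in \<open>simp add: slash_mult norm_mult mult_mono\<close>)
    qed
  qed
qed

lemma slash_divide:
  assumes "l \<le> k" "\<gamma> \<in> SL2Z" "Im \<tau> > 0"
  shows "slash (k - l) (\<lambda>\<tau>. if Im \<tau> > 0 then f \<tau> / u \<tau> else 0) \<gamma> \<tau> = slash k f \<gamma> \<tau> / slash l u \<gamma> \<tau>"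
proof -
  have "third_factor \<gamma> \<tau> ^ k = third_factor \<gamma> \<tau> ^ (k - l) * third_factor \<gamma> \<tau> ^ l" using assms(1) by (simp flip: power_add)
  then show ?thesis
    using third_factor_nonzero[OF assms(2,3)] act_in_upper_half_plane[OF assms(2,3)] assms(3) by (simp add: slash_def)
qed

text \<open>
  The domination hypothesis says that \<open>f\<close> vanishes at every cusp at least to the order of \<open>u\<close>.
\<close>

lemma forms_divide:
  assumes f: "f \<in> forms G k \<nu>" and G: "G \<subseteq> SL2Z" and l: "l \<le> k"
    and u: "u holomorphic_on \<H>" "\<And>\<tau>. Im \<tau> > 0 \<Longrightarrow> u \<tau> \<noteq> 0"
    and inv: "\<And>\<gamma> \<tau>. \<gamma> \<in> G \<Longrightarrow> Im \<tau> > 0 \<Longrightarrow> slash l u \<gamma> \<tau> = \<mu> \<gamma> * u \<tau>"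
    and dom: "\<And>\<gamma>. \<gamma> \<in> SL2Z \<Longrightarrow> Bfun (\<lambda>\<tau>. norm (slash k f \<gamma> \<tau>) / norm (slash l u \<gamma> \<tau>)) at_i_infinity"
  shows "(\<lambda>\<tau>. if Im \<tau> > 0 then f \<tau> / u \<tau> else 0) \<in> forms G (k - l) (\<lambda>\<gamma>. \<nu> \<gamma> / \<mu> \<gamma>)" (is "?g \<in> _")
  unfolding forms_def
proof (intro CollectI conjI allI ballI impI)
  show "?g \<tau> = 0" if "Im \<tau> \<le> 0" for \<tau> using that by simp
  have "(\<lambda>\<tau>. f \<tau> / u \<tau>) holomorphic_on \<H>" using f u by (auto simp: forms_def intro!: holomorphic_intros)
  then show "?g holomorphic_on \<H>" by (rule holomorphic_transform) simp
  show "slash (k - l) ?g \<gamma> \<tau> = \<nu> \<gamma> / \<mu> \<gamma> * ?g \<tau>" if "\<gamma> \<in> G" "Im \<tau> > 0" for \<gamma> \<tau>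
    using f that G inv[OF that] by (simp add: slash_divide[OF l] forms_def subset_iff)
  show "Bfun (slash (k - l) ?g \<gamma>) at_i_infinity" if \<gamma>: "\<gamma> \<in> SL2Z" for \<gamma>
  proof -
    obtain B where B: "eventually (\<lambda>\<tau>. norm (norm (slash k f \<gamma> \<tau>) / norm (slash l u \<gamma> \<tau>)) \<le> B) at_i_infinity"
      using dom[OF \<gamma>] unfolding Bfun_def by blast
    show ?thesis
    proof (rule BfunI)
      show "eventually (\<lambda>\<tau>. norm (slash (k - l) ?g \<gamma> \<tau>) \<le> B) at_i_infinity"
        using B eventually_upper by eventually_elim (simp add: slash_divide[OF l \<gamma>] norm_divide)
    qed
  qed
qed

text \<open>
  The function slashed by \<open>\<gamma>\<close> sees the translation \<open>T\<^sup>n\<close> as the element \<open>\<gamma> T\<^sup>n \<gamma>\<^sup>-\<^sup>1\<close>, which is written out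
  here. The root of unity is the value of the cocycle at \<open>T\<^sup>n\<close>.
\<close>

lemma slash_translation:
  assumes f: "f \<in> forms G k \<nu>" and G: "G \<subseteq> SL2Z" and \<gamma>: "\<gamma> \<in> SL2Z" and \<tau>: "Im \<tau> > 0"
    and \<delta>: "mat22 (1 - int n * (\<gamma>$1$1 * \<gamma>$2$1)) (int n * (\<gamma>$1$1 * \<gamma>$1$1)) (- (int n * (\<gamma>$2$1 * \<gamma>$2$1))) (1 + int n * (\<gamma>$1$1 * \<gamma>$2$1)) \<in> G"
      (is "?\<delta> \<in> G")
  shows "slash k f \<gamma> (\<tau> + of_nat n) = exp (2 * of_real pi * \<i> * of_nat n / 9) ^ k * \<nu> ?\<delta> * slash k f \<gamma> \<tau>"
proof -
  define T where "T = mat22 1 (int n) 0 1"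
  have T: "T \<in> SL2Z" by (simp add: T_def)
  have "?\<delta> ** \<gamma> = \<gamma> ** T"
  proof -
    define a b c d where "a = \<gamma>$1$1" and "b = \<gamma>$1$2" and "c = \<gamma>$2$1" and "d = \<gamma>$2$2"
    have ad: "a * d = 1 + b * c" using \<gamma> by (simp add: SL2Z_iff a_def b_def c_def d_def)
    have "(1 - int n * (a * c)) * b + int n * (a * a) * d = a * int n + b"
    proof -
      have "(1 - int n * (a * c)) * b + int n * (a * a) * d = b - int n * a * (b * c) + int n * a * (a * d)"
        by (simp add: algebra_simps)
      then show ?thesis unfolding ad by (simp add: algebra_simps)
    qed
    moreover have "- (int n * (c * c)) * b + (1 + int n * (a * c)) * d = c * int n + d"
    proof -
      have "- (int n * (c * c)) * b + (1 + int n * (a * c)) * d = d - int n * c * (b * c) + int n * c * (a * d)"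
        by (simp add: algebra_simps)
      then show ?thesis unfolding ad by (simp add: algebra_simps)
    qed
    ultimately show ?thesis
      by (intro mat2_eqI) (simp_all add: mat2_mult_nth T_def algebra_simps flip: a_def b_def c_def d_def)
  qed
  moreover have "slash k (slash k f ?\<delta>) \<gamma> = slash k f (?\<delta> ** \<gamma>)"
    by (rule slash_slash[OF subsetD[OF G \<delta>] \<gamma>])
  moreover have "slash k (slash k f \<gamma>) T = slash k f (\<gamma> ** T)" by (rule slash_slash[OF \<gamma> T])
  ultimately have "slash k (slash k f ?\<delta>) \<gamma> \<tau> = slash k (slash k f \<gamma>) T \<tau>" by (simp only:)
  moreover have "slash k (slash k f ?\<delta>) \<gamma> \<tau> = \<nu> ?\<delta> * slash k f \<gamma> \<tau>"
    unfolding forms_slash_eq[OF f \<delta>] slash_scale ..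
  moreover have "slash k (slash k f \<gamma>) T \<tau> = slash k f \<gamma> (\<tau> + of_nat n) / exp (2 * of_real pi * \<i> * of_nat n / 9) ^ k"
  proof -
    have "act T \<tau> = \<tau> + of_nat n" by (simp add: act_def T_def)
    moreover have "third_factor T \<tau> = exp (2 * of_real pi * \<i> * of_nat n / 9)" unfolding T_def by (rule third_factor_translation)
    ultimately show ?thesis using \<tau> by (simp add: slash_def[of k "slash k f \<gamma>"])
  qed
  ultimately show ?thesis by (simp add: field_simps)
qed

lemma forms_Gamma9_periodic:
  assumes f: "f \<in> forms Gamma9 k (\<lambda>_. 1)" and \<gamma>: "\<gamma> \<in> SL2Z" and \<tau>: "Im \<tau> > 0"
  shows "slash k f \<gamma> (\<tau> + 9) = slash k f \<gamma> \<tau>"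
proof -
  note G = Gamma9_subset_SL2Z
  have "mat22 (1 - int 9 * (\<gamma>$1$1 * \<gamma>$2$1)) (int 9 * (\<gamma>$1$1 * \<gamma>$1$1)) (- (int 9 * (\<gamma>$2$1 * \<gamma>$2$1)))
     (1 + int 9 * (\<gamma>$1$1 * \<gamma>$2$1)) \<in> Gamma9"
    by (simp add: principal_congruence_subgroup_def cong_iff_dvd_diff algebra_simps)
  from slash_translation[OF f G \<gamma> \<tau> this]
  have "slash k f \<gamma> (\<tau> + of_nat 9) = exp (2 * of_real pi * \<i>) ^ k * slash k f \<gamma> \<tau>"
    by (simp add: mult_ac)
  then show ?thesis by (simp only: exp_two_pi_i) simp
qed

text \<open>
  The quotient would be a form of negative weight. As the weights of \<open>forms\<close> are natural numbers, it is handled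
  through its absolute value alone.
\<close>

lemma forms_divide_negative:
  assumes f: "f \<in> forms Gamma9 k (\<lambda>_. 1)" and l: "k < l"
    and u: "u holomorphic_on \<H>" "\<And>\<tau>. Im \<tau> > 0 \<Longrightarrow> u \<tau> \<noteq> 0"
    and inv: "\<And>\<gamma> \<tau>. \<gamma> \<in> Gamma9 \<Longrightarrow> Im \<tau> > 0 \<Longrightarrow> slash l u \<gamma> \<tau> = u \<tau>"
    and dom: "\<And>\<gamma>. \<gamma> \<in> SL2Z \<Longrightarrow> Bfun (\<lambda>\<tau>. norm (slash k f \<gamma> \<tau>) / norm (slash l u \<gamma> \<tau>)) at_i_infinity"
  shows "f = 0"
proof -
  define g where "g \<tau> = f \<tau> / u \<tau>" for \<tau>
  define w where "w = (real k - real l) / 3"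
  note G = Gamma9_subset_SL2Z
  have g: "norm (g (act \<gamma> \<tau>)) = norm (denom \<gamma> \<tau>) powr w * (norm (slash k f \<gamma> \<tau>) / norm (slash l u \<gamma> \<tau>))"
    if "\<gamma> \<in> SL2Z" "Im \<tau> > 0" for \<gamma> \<tau>
  proof -
    have D: "norm (denom \<gamma> \<tau>) > 0" using denom_nonzero[OF that] by simp
    have p: "norm (third_factor \<gamma> \<tau>) ^ i = norm (denom \<gamma> \<tau>) powr (real i / 3)" for i
      using D by (simp add: norm_third_factor[OF that] powr_realpow[symmetric] powr_powr)
    have "norm (denom \<gamma> \<tau>) powr w = norm (denom \<gamma> \<tau>) powr (real k / 3) / norm (denom \<gamma> \<tau>) powr (real l / 3)"
      by (simp add: w_def diff_divide_distrib powr_diff)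
    then have "norm (denom \<gamma> \<tau>) powr w = norm (third_factor \<gamma> \<tau>) ^ k / norm (third_factor \<gamma> \<tau>) ^ l" by (simp add: p)
    then show ?thesis using that third_factor_nonzero[OF that] by (simp add: g_def slash_def norm_divide norm_power)
  qed
  have "g \<tau> = 0" if \<tau>: "Im \<tau> > 0" for \<tau>
  proof (rule negative_weight_vanishes[where w = w and g = g and \<tau> = \<tau>])
    show "g holomorphic_on \<H>" unfolding g_def using f u by (auto simp: forms_def intro!: holomorphic_intros)
    show "w < 0" using l by (simp add: w_def)
    show "norm (g (act \<gamma> \<tau>)) = norm (denom \<gamma> \<tau>) powr w * norm (g \<tau>)"
      if "\<gamma> \<in> Gamma9" "Im \<tau> > 0" for \<gamma> \<tau>
    proof -
      have "slash k f \<gamma> \<tau> = f \<tau>" using forms_slash_eq[OF f that(1)] by simp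
      then show ?thesis using g[of \<gamma> \<tau>] that G inv[OF that] by (simp add: g_def norm_divide subset_iff)
    qed
    show "g (\<tau> + 9) = g \<tau>" if "Im \<tau> > 0" for \<tau>
    proof -
      define T where "T = mat22 1 (int 9) 0 1"
      have T: "T \<in> Gamma9"
        by (simp add: T_def principal_congruence_subgroup_def cong_iff_dvd_diff)
      have "2 * of_real pi * \<i> * of_nat 9 / 9 = 2 * of_real pi * \<i>" by simp
      then have j: "third_factor T \<tau> = 1" unfolding T_def third_factor_translation by (simp only: exp_two_pi_i)
      have a: "act T \<tau> = \<tau> + 9" by (simp add: T_def act_def)
      have "slash k f T \<tau> = f \<tau>" using forms_slash_eq[OF f T] by simp
      moreover have "slash l u T \<tau> = u \<tau>" by (rule inv[OF T that])
      ultimately show ?thesis using that by (simp add: slash_def j a g_def)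
    qed
    show "Bfun (\<lambda>\<tau>. norm (denom \<gamma> \<tau>) powr (- w) * norm (g (act \<gamma> \<tau>))) at_i_infinity" if \<gamma>: "\<gamma> \<in> SL2Z" for \<gamma>
    proof -
      have "norm (denom \<gamma> \<tau>) powr (- w) * norm (g (act \<gamma> \<tau>)) = norm (slash k f \<gamma> \<tau>) / norm (slash l u \<gamma> \<tau>)"
        if "Im \<tau> > 0" for \<tau>
      proof -
        have "norm (denom \<gamma> \<tau>) powr (- w) * norm (denom \<gamma> \<tau>) powr w = 1"
          using denom_nonzero[OF \<gamma> that] by (simp flip: powr_add)
        then show ?thesis unfolding g[OF \<gamma> that] by (simp flip: mult.assoc)
      qed
      then have "eventually (\<lambda>\<tau>. norm (denom \<gamma> \<tau>) powr (- w) * norm (g (act \<gamma> \<tau>)) = norm (slash k f \<gamma> \<tau>) / norm (slash l u \<gamma> \<tau>)) at_i_infinity"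
        using eventually_upper by (auto elim: eventually_mono)
      moreover obtain B where "eventually (\<lambda>\<tau>. norm (norm (slash k f \<gamma> \<tau>) / norm (slash l u \<gamma> \<tau>)) \<le> B) at_i_infinity"
        using dom[OF \<gamma>] unfolding Bfun_def by blast
      ultimately have "eventually (\<lambda>\<tau>. norm (norm (denom \<gamma> \<tau>) powr (- w) * norm (g (act \<gamma> \<tau>))) \<le> B) at_i_infinity"
        by eventually_elim simp
      then show ?thesis by (rule BfunI)
    qed
  qed (rule \<tau>)
  then have g0: "g \<tau> = 0" if "Im \<tau> > 0" for \<tau> using that .
  have "f \<tau> = 0" if "Im \<tau> > 0" for \<tau> using g0[OF that] u(2)[OF that] by (simp add: g_def)
  moreover have "f \<tau> = 0" if "\<not> Im \<tau> > 0" for \<tau> using f that by (simp add: forms_def)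
  ultimately show ?thesis by (auto simp: fun_eq_iff)
qed

section \<open>Monomials in the two cube roots\<close>

definition eta_monomial :: "nat \<Rightarrow> nat \<Rightarrow> complex \<Rightarrow> complex" where
  "eta_monomial a b \<tau> = cbrt_eta_bot \<tau> ^ a * cbrt_eta_top \<tau> ^ b"

lemma eta_monomial_nonzero: "Im \<tau> > 0 \<Longrightarrow> eta_monomial a b \<tau> \<noteq> 0"
  by (simp add: eta_monomial_def cbrt_eta_bot_conv cbrt_eta_top_conv)

lemma holomorphic_eta_monomial: "eta_monomial a b holomorphic_on \<H>"
proof -
  have "(\<lambda>\<tau>. log_eta (\<tau> / 3)) holomorphic_on \<H>" "(\<lambda>\<tau>. log_eta (3 * \<tau>)) holomorphic_on \<H>"
    by (rule holomorphic_compose_upper[OF holomorphic_log_eta]; auto intro!: holomorphic_intros)+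
  then have "(\<lambda>\<tau>. exp (log_eta (\<tau> / 3) - log_eta \<tau> / 3) ^ a * exp (log_eta (3 * \<tau>) - log_eta \<tau> / 3) ^ b) holomorphic_on \<H>"
    using holomorphic_log_eta by (intro holomorphic_intros) auto
  then show ?thesis
    by (rule holomorphic_transform) (simp add: eta_monomial_def cbrt_eta_bot_conv cbrt_eta_top_conv)
qed

lemma slash_eta_monomial:
  "Im \<tau> > 0 \<Longrightarrow> slash (a + b) (eta_monomial a b) \<gamma> \<tau> = slash 1 cbrt_eta_bot \<gamma> \<tau> ^ a * slash 1 cbrt_eta_top \<gamma> \<tau> ^ b"
  by (simp add: slash_def eta_monomial_def power_add power_divide)

text \<open>
  The multiplier is written as the twist \<open>c9\<^sup>a b9\<^sup>b\<close> times the normalization of weight \<open>(a + b)/3\<close>.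
\<close>

lemma slash_eta_monomial_Gamma3_diag:
  assumes "\<gamma> \<in> Gamma3_diag" "Im \<tau> > 0"
  shows "slash (a + b) (eta_monomial a b) \<gamma> \<tau> =
    chi9 \<gamma> ^ (3 * (a + b)) * c9 \<gamma> ^ a * b9 \<gamma> ^ b / (c9 \<gamma> * b9 \<gamma>) ^ (a + b) * eta_monomial a b \<tau>"
proof -
  have "slash (a + b) (eta_monomial a b) \<gamma> \<tau> =
      (chi9 \<gamma> ^ 3 / b9 \<gamma>) ^ a * (chi9 \<gamma> ^ 3 / c9 \<gamma>) ^ b * eta_monomial a b \<tau>"
    unfolding slash_eta_monomial[OF assms(2)] slash_cbrt_eta_bot[OF assms] slash_cbrt_eta_top[OF assms]
      chi3_eq_chi9_cubed[OF Gamma3_diag_not_dvd[OF assms(1)]] chi9_def[symmetric] eta_monomial_def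
    by (simp only: power_mult_distrib) (simp only: mult_ac)
  also have "(chi9 \<gamma> ^ 3 / b9 \<gamma>) ^ a * (chi9 \<gamma> ^ 3 / c9 \<gamma>) ^ b =
     chi9 \<gamma> ^ (3 * (a + b)) * c9 \<gamma> ^ a * b9 \<gamma> ^ b / (c9 \<gamma> * b9 \<gamma>) ^ (a + b)"
    by (simp add: power_divide power_mult_distrib power_add distrib_left power_mult)
  finally show ?thesis .
qed

lemma Bfun_slash_eta_monomial:
  assumes \<gamma>: "\<gamma> \<in> SL2Z"
  shows "Bfun (slash (a + b) (eta_monomial a b) \<gamma>) at_i_infinity"
proof -
  obtain C where C: "\<And>\<tau>. Im \<tau> \<ge> 3 \<Longrightarrow> norm (slash 1 cbrt_eta_bot \<gamma> \<tau>) * exp (of_bool (3 dvd \<gamma>$1$1) * (2 * pi / 9 * Im \<tau>)) \<le> exp C"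
    using slash_cbrt_eta_bot_growth[OF \<gamma>] by (metis atLeastAtMost_iff)
  obtain D where D: "\<And>\<tau>. Im \<tau> \<ge> 3 \<Longrightarrow> norm (slash 1 cbrt_eta_top \<gamma> \<tau>) * exp (of_bool (3 dvd \<gamma>$2$1) * (2 * pi / 9 * Im \<tau>)) \<le> exp D"
    using slash_cbrt_eta_top_growth[OF \<gamma>] by (metis atLeastAtMost_iff)
  have le: "x \<le> exp c" if "x * exp (of_bool p * y) \<le> exp c" "y \<ge> 0" "x \<ge> 0" for x y c :: real and p
  proof -
    have "x * 1 \<le> x * exp (of_bool p * y)" using that by (intro mult_left_mono) auto
    then show ?thesis using that by simp
  qed
  have "norm (slash (a + b) (eta_monomial a b) \<gamma> \<tau>) \<le> exp C ^ a * exp D ^ b" if t: "Im \<tau> \<ge> 3" for \<tau>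
  proof -
    have "norm (slash 1 cbrt_eta_bot \<gamma> \<tau>) \<le> exp C" "norm (slash 1 cbrt_eta_top \<gamma> \<tau>) \<le> exp D"
      using le[OF C[OF t]] le[OF D[OF t]] t by auto
    then show ?thesis using t
      by (simp add: slash_eta_monomial norm_mult norm_power) (intro mult_mono power_mono; simp)
  qed
  then show ?thesis by (intro BfunI[of _ "exp C ^ a * exp D ^ b"]) (auto simp: eventually_at_i_infinity)
qed

text \<open>
  Let \<open>\<delta> = \<gamma> T\<^sup>3 \<gamma>\<^sup>-\<^sup>1\<close>, an element of the group of level \<open>3\<close>. If \<open>3\<close> divides the upper left
  entry of \<open>\<gamma>\<close>, then \<open>b9 \<delta> = 1\<close> and \<open>c9 \<delta>\<close> is the cubic root of unity \<open>cis3 1\<close>; if \<open>3\<close> divides the lower left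
  entry, the roles are exchanged. In both cases the normalization \<open>(c9 b9)\<^sup>-\<^sup>k\<close> cancels the value of the cocycle at
  \<open>T\<^sup>3\<close>, and the twist makes the slashed function quasi-periodic of period \<open>3\<close> with phase \<open>a/3\<close> or
  \<open>b/3\<close>. Its order is then at least \<open>a/9\<close> or \<open>b/9\<close>, which is the order of the monomial.
\<close>

lemma character_forms_decay:
  assumes f: "f \<in> character_forms k j a b" and ab: "a \<le> 2" "b \<le> 2" and \<gamma>: "\<gamma> \<in> SL2Z"
  shows "Bfun (\<lambda>\<tau>. norm (slash k f \<gamma> \<tau>) *
      exp ((of_bool (3 dvd \<gamma>$1$1) * real a + of_bool (3 dvd \<gamma>$2$1) * real b) * (2 * pi / 9 * Im \<tau>))) at_i_infinity"
proof -
  have hol: "slash k f \<gamma> holomorphic_on \<H>"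
    by (rule holomorphic_slash[OF \<gamma>]) (use f in \<open>auto simp: character_forms_def forms_def\<close>)
  have bdd: "Bfun (slash k f \<gamma>) at_i_infinity" using f \<gamma> by (auto simp: character_forms_def forms_def)
  define A C where "A = \<gamma>$1$1" and "C = \<gamma>$2$1"
  have AC: "\<not> (3 dvd A \<and> 3 dvd C)"
  proof
    assume "3 dvd A \<and> 3 dvd C"
    then have "3 dvd A * \<gamma>$2$2 - \<gamma>$1$2 * C" by (intro dvd_diff dvd_mult dvd_mult2) auto
    then show False using \<gamma> by (simp add: SL2Z_iff A_def C_def)
  qed
  \<comment> \<open>This is \<open>\<gamma> T\<^sup>3 \<gamma>\<^sup>-\<^sup>1\<close> for the unit translation \<open>T\<close>.\<close>
  define \<delta> where "\<delta> = mat22 (1 - int 3 * (A * C)) (int 3 * (A * A)) (- (int 3 * (C * C))) (1 + int 3 * (A * C))"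
  have \<delta>: "\<delta> \<in> Gamma3_diag" by (simp add: \<delta>_def Gamma3_diag_iff algebra_simps)
  have decay: "Bfun (\<lambda>\<tau>. norm (slash k f \<gamma> \<tau>) * exp (real m * (2 * pi / 9 * Im \<tau>))) at_i_infinity"
    if m: "m \<le> 2" and v: "chi9 \<delta> = 1" "c9 \<delta> * b9 \<delta> = cis3 1" "c9 \<delta> ^ a * b9 \<delta> ^ b = cis3 (int m)" for m
  proof -
    have per: "slash k f \<gamma> (\<tau> + of_real 3) = exp (2 * of_real pi * \<i> * of_real (real m / 3)) * slash k f \<gamma> \<tau>"
      if t: "Im \<tau> > 0" for \<tau>
    proof -
      have "slash k f \<gamma> (\<tau> + of_nat 3) = exp (2 * of_real pi * \<i> * of_nat 3 / 9) ^ k *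
          (level_multiplier k j \<delta> * c9 \<delta> ^ a * b9 \<delta> ^ b) * slash k f \<gamma> \<tau>"
        unfolding \<delta>_def A_def C_def
        by (rule slash_translation[OF f[unfolded character_forms_def] Gamma3_diag_subset_SL2Z \<gamma> t])
           (use \<delta> in \<open>simp only: \<delta>_def A_def C_def\<close>)
      also have "exp (2 * of_real pi * \<i> * of_nat 3 / 9) = cis3 1" by (simp add: cis3_def mult_ac)
      also have "level_multiplier k j \<delta> * c9 \<delta> ^ a * b9 \<delta> ^ b = cis3 (int m) / cis3 1 ^ k"
        using v by (simp add: level_multiplier_def mult.assoc)
      finally show ?thesis by (simp add: cis3_def mult_ac)
    qed
    from quasi_periodic_decay[OF hol _ _ per bdd] m
    show ?thesis by (simp add: mult_ac)
  qed
  have sq: "3 dvd x * x - 1" if "\<not> 3 dvd x" for x :: int by (rule square_mod_3[OF that])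
  have b9: "b9 \<delta> = cis3 (A * A * (1 + 3 * (A * C)))" and c9: "c9 \<delta> = cis3 (- (- (C * C) * (1 + 3 * (A * C))))"
  proof -
    have "\<delta>$1$2 div 3 = A * A" "\<delta>$2$1 div 3 = - (C * C)"
    proof -
      have "\<delta>$2$1 = 3 * (- (C * C))" by (simp add: \<delta>_def)
      then show "\<delta>$2$1 div 3 = - (C * C)" by (metis nonzero_mult_div_cancel_left zero_neq_numeral)
    qed (simp add: \<delta>_def)
    then show "b9 \<delta> = cis3 (A * A * (1 + 3 * (A * C)))" "c9 \<delta> = cis3 (- (- (C * C) * (1 + 3 * (A * C))))"
      using \<delta> by (simp_all add: b9_conv_cis3 c9_conv_cis3 Gamma3_diag_iff) (simp_all add: \<delta>_def)
  qed
  have chi: "chi9 \<delta> = 1" if dv: "3 dvd A * C"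
  proof -
    obtain r where r: "A * C = 3 * r" using dv by (elim dvdE)
    have "[1 + 3 * (A * C) = 1] (mod 9)" unfolding r by (simp add: cong_iff_dvd_diff)
    then show ?thesis by (simp add: chi9_def \<delta>_def chi9_unit_1)
  qed
  consider "3 dvd A" "\<not> 3 dvd C" | "3 dvd C" "\<not> 3 dvd A" | "\<not> 3 dvd A" "\<not> 3 dvd C" using AC by blast
  then show ?thesis unfolding A_def[symmetric] C_def[symmetric]
  proof cases
    case 1
    have "b9 \<delta> = 1" unfolding b9 using 1 by (intro cis3_dvd) auto
    moreover have "c9 \<delta> = cis3 1" unfolding c9
    proof (rule cis3_cong)
      have e: "- (- (C * C) * (1 + 3 * (A * C))) - 1 = (C * C - 1) + 3 * (C * C * (A * C))" by (simp add: algebra_simps)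
      show "3 dvd - (- (C * C) * (1 + 3 * (A * C))) - 1" unfolding e by (rule dvd_add[OF sq[OF 1(2)] dvd_triv_left])
    qed
    ultimately have "Bfun (\<lambda>\<tau>. norm (slash k f \<gamma> \<tau>) * exp (real a * (2 * pi / 9 * Im \<tau>))) at_i_infinity"
      using decay[OF ab(1)] chi 1 by (simp add: cis3_power)
    then show "Bfun (\<lambda>\<tau>. norm (slash k f \<gamma> \<tau>) *
      exp ((of_bool (3 dvd A) * real a + of_bool (3 dvd C) * real b) * (2 * pi / 9 * Im \<tau>))) at_i_infinity" using 1 by simp
  next
    case 2
    have "c9 \<delta> = 1" unfolding c9 using 2 by (intro cis3_dvd) auto
    moreover have "b9 \<delta> = cis3 1" unfolding b9
    proof (rule cis3_cong)
      have e: "A * A * (1 + 3 * (A * C)) - 1 = (A * A - 1) + 3 * (A * A * (A * C))" by (simp add: algebra_simps)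
      show "3 dvd A * A * (1 + 3 * (A * C)) - 1" unfolding e by (rule dvd_add[OF sq[OF 2(2)] dvd_triv_left])
    qed
    ultimately have "Bfun (\<lambda>\<tau>. norm (slash k f \<gamma> \<tau>) * exp (real b * (2 * pi / 9 * Im \<tau>))) at_i_infinity"
      using decay[OF ab(2)] chi 2 by (simp add: cis3_power)
    then show "Bfun (\<lambda>\<tau>. norm (slash k f \<gamma> \<tau>) *
      exp ((of_bool (3 dvd A) * real a + of_bool (3 dvd C) * real b) * (2 * pi / 9 * Im \<tau>))) at_i_infinity" using 2 by simp
  next
    case 3
    then show "Bfun (\<lambda>\<tau>. norm (slash k f \<gamma> \<tau>) *
      exp ((of_bool (3 dvd A) * real a + of_bool (3 dvd C) * real b) * (2 * pi / 9 * Im \<tau>))) at_i_infinity"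
      using bdd by (simp add: Bfun_def)
  qed
qed

lemma character_forms_dominated:
  assumes f: "f \<in> character_forms k j a b" and ab: "a \<le> 2" "b \<le> 2" and \<gamma>: "\<gamma> \<in> SL2Z"
  shows "Bfun (\<lambda>\<tau>. norm (slash k f \<gamma> \<tau>) / norm (slash (a + b) (eta_monomial a b) \<gamma> \<tau>)) at_i_infinity"
proof -
  define p q :: real where "p = of_bool (3 dvd \<gamma>$1$1)" and "q = of_bool (3 dvd \<gamma>$2$1)"
  obtain C where C: "\<And>\<tau>. Im \<tau> \<ge> 3 \<Longrightarrow> exp (- C) \<le> norm (slash 1 cbrt_eta_bot \<gamma> \<tau>) * exp (p * (2 * pi / 9 * Im \<tau>))"
    using slash_cbrt_eta_bot_growth[OF \<gamma>] unfolding p_def by (metis atLeastAtMost_iff)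
  obtain D where D: "\<And>\<tau>. Im \<tau> \<ge> 3 \<Longrightarrow> exp (- D) \<le> norm (slash 1 cbrt_eta_top \<gamma> \<tau>) * exp (q * (2 * pi / 9 * Im \<tau>))"
    using slash_cbrt_eta_top_growth[OF \<gamma>] unfolding q_def by (metis atLeastAtMost_iff)
  define K where "K = exp (- C) ^ a * exp (- D) ^ b"
  have K: "K > 0" by (simp add: K_def)
  obtain B where B: "eventually (\<lambda>\<tau>. norm (norm (slash k f \<gamma> \<tau>) * exp ((p * real a + q * real b) * (2 * pi / 9 * Im \<tau>))) \<le> B) at_i_infinity"
    using character_forms_decay[OF assms] unfolding Bfun_def p_def q_def by blast
  have big: "eventually (\<lambda>\<tau>. Im \<tau> \<ge> 3) at_i_infinity" by (auto simp: eventually_at_i_infinity)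
  show ?thesis
  proof (rule BfunI)
    show "eventually (\<lambda>\<tau>. norm (norm (slash k f \<gamma> \<tau>) / norm (slash (a + b) (eta_monomial a b) \<gamma> \<tau>)) \<le> B / K) at_i_infinity"
      using B big
    proof eventually_elim
      case (elim \<tau>)
      define y where "y = 2 * pi / 9 * Im \<tau>"
      define X Y where "X = norm (slash 1 cbrt_eta_bot \<gamma> \<tau>)" and "Y = norm (slash 1 cbrt_eta_top \<gamma> \<tau>)"
      have "K \<le> (X * exp (p * y)) ^ a * (Y * exp (q * y)) ^ b"
        unfolding K_def X_def Y_def y_def using C[OF elim(2)] D[OF elim(2)] by (intro mult_mono power_mono) auto
      also have "\<dots> = (X ^ a * Y ^ b) * exp ((p * real a + q * real b) * y)"
      proof -
        have "exp (p * y) ^ a * exp (q * y) ^ b = exp ((p * real a + q * real b) * y)"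
          unfolding exp_of_nat_mult[symmetric] exp_add[symmetric] by (simp add: algebra_simps)
        then show ?thesis by (simp only: power_mult_distrib) (simp only: mult_ac)
      qed
      also have "X ^ a * Y ^ b = norm (slash (a + b) (eta_monomial a b) \<gamma> \<tau>)"
        using elim(2) by (simp add: slash_eta_monomial X_def Y_def norm_mult norm_power)
      finally have le: "K \<le> norm (slash (a + b) (eta_monomial a b) \<gamma> \<tau>) * exp ((p * real a + q * real b) * y)" .
      then have pos: "norm (slash (a + b) (eta_monomial a b) \<gamma> \<tau>) > 0" using K
        by (metis exp_gt_zero less_le_trans zero_less_mult_pos2)
      have "norm (slash k f \<gamma> \<tau>) * K \<le> norm (slash k f \<gamma> \<tau>) * (norm (slash (a + b) (eta_monomial a b) \<gamma> \<tau>) * exp ((p * real a + q * real b) * y))"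
        by (intro mult_left_mono le) auto
      also have "\<dots> = (norm (slash k f \<gamma> \<tau>) * exp ((p * real a + q * real b) * y)) * norm (slash (a + b) (eta_monomial a b) \<gamma> \<tau>)"
        by (simp only: mult_ac)
      also have "\<dots> \<le> B * norm (slash (a + b) (eta_monomial a b) \<gamma> \<tau>)"
        by (rule mult_right_mono) (use elim(1) in \<open>simp_all add: y_def abs_mult\<close>)
      finally have "norm (slash k f \<gamma> \<tau>) / norm (slash (a + b) (eta_monomial a b) \<gamma> \<tau>) \<le> B / K"
        using pos K by (simp add: field_simps)
      then show ?case by simp
    qed
  qed
qed

lemma Gamma9_characters_trivial: "\<gamma> \<in> Gamma9 \<Longrightarrow> chi9 \<gamma> = 1 \<and> c9 \<gamma> = 1 \<and> b9 \<gamma> = 1 \<and> \<gamma> \<in> Gamma3_diag"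
  using Gamma9_subset Gamma9_diag_subset Gamma9_diag_trivial unfolding Gamma9_eq_kernel by blast

lemma character_forms_subset_Gamma9: "character_forms k j a b \<subseteq> forms Gamma9 k (\<lambda>_. 1)"
  unfolding character_forms_def using Gamma9_characters_trivial
  by (auto elim!: forms_restrict simp: level_multiplier_def)

lemma chi9_power_mod_6:
  assumes "\<gamma> \<in> Gamma3_diag"
  shows "chi9 \<gamma> ^ (n mod 6) = chi9 \<gamma> ^ n"
proof -
  have 6: "chi9 \<gamma> ^ 6 = 1" unfolding chi9_def by (rule chi9_unit_power_6[OF Gamma3_diag_not_dvd[OF assms]])
  have "chi9 \<gamma> ^ n = chi9 \<gamma> ^ (6 * (n div 6) + n mod 6)" by simp
  also have "\<dots> = (chi9 \<gamma> ^ 6) ^ (n div 6) * chi9 \<gamma> ^ (n mod 6)" by (simp only: power_add power_mult)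
  finally show ?thesis by (simp add: 6)
qed

text \<open>
  The monomial contributes \<open>\<chi>\<^sub>9\<^sup>3\<^sup>(\<^sup>a\<^sup>+\<^sup>b\<^sup>)\<close>, so the exponent of \<open>\<chi>\<^sub>9\<close> changes; it is reduced to the range
  of indices.
\<close>

lemma eta_monomial_multiplies:
  assumes "f \<in> modular_forms_level 3 k j"
  shows "f * cbrt_eta_bot ^ a * cbrt_eta_top ^ b \<in> character_forms (k + (a + b)) ((j + 3 * (a + b)) mod 6) a b"
proof -
  have "(\<lambda>\<tau>. f \<tau> * eta_monomial a b \<tau>) \<in> forms Gamma3_diag (k + (a + b)) (\<lambda>\<gamma>. level_multiplier k j \<gamma> *
     (chi9 \<gamma> ^ (3 * (a + b)) * c9 \<gamma> ^ a * b9 \<gamma> ^ b / (c9 \<gamma> * b9 \<gamma>) ^ (a + b)))"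
    by (rule forms_multiply[OF assms[unfolded modular_forms_level_3] holomorphic_eta_monomial
          slash_eta_monomial_Gamma3_diag Bfun_slash_eta_monomial])
  also have "\<dots> = character_forms (k + (a + b)) ((j + 3 * (a + b)) mod 6) a b"
    unfolding character_forms_def by (rule forms_cong) (simp add: level_multiplier_def chi9_power_mod_6 power_add)
  also have "(\<lambda>\<tau>. f \<tau> * eta_monomial a b \<tau>) = f * cbrt_eta_bot ^ a * cbrt_eta_top ^ b"
    by (simp add: fun_eq_iff power_fun_apply eta_monomial_def)
  finally show ?thesis .
qed

text \<open>
  The weight and the exponent of \<open>\<chi>\<^sub>9\<close> of the quotient matter only for its membership in the graded
  space, hence the existential form. If the quotient would have negative weight, then \<open>f = 0\<close>.
\<close>

lemma eta_monomial_divides: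
  assumes f: "f \<in> character_forms k j a b" and ab: "a \<le> 2" "b \<le> 2" and j: "j \<le> 5"
  shows "\<exists>k' j' g. j' \<le> 5 \<and> g \<in> modular_forms_level 3 k' j' \<and> f = g * cbrt_eta_bot ^ a * cbrt_eta_top ^ b"
proof (cases "a + b \<le> k")
  case True
  define g where "g = (\<lambda>\<tau>. if Im \<tau> > 0 then f \<tau> / eta_monomial a b \<tau> else 0)"
  define j' where "j' = (j + 3 * (a + b)) mod 6"
  have "g \<in> forms Gamma3_diag (k - (a + b)) (\<lambda>\<gamma>. (level_multiplier k j \<gamma> * c9 \<gamma> ^ a * b9 \<gamma> ^ b) /
     (chi9 \<gamma> ^ (3 * (a + b)) * c9 \<gamma> ^ a * b9 \<gamma> ^ b / (c9 \<gamma> * b9 \<gamma>) ^ (a + b)))"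
    unfolding g_def
    by (rule forms_divide[OF f[unfolded character_forms_def] Gamma3_diag_subset_SL2Z True holomorphic_eta_monomial
          eta_monomial_nonzero slash_eta_monomial_Gamma3_diag character_forms_dominated[OF f ab]])
  also have "\<dots> = modular_forms_level 3 (k - (a + b)) j'"
    unfolding modular_forms_level_3
  proof (rule forms_cong)
    fix \<gamma> assume \<gamma>: "\<gamma> \<in> Gamma3_diag"
    have 6: "chi9 \<gamma> ^ (3 * (a + b)) * chi9 \<gamma> ^ (3 * (a + b)) = 1"
    proof -
      have "chi9 \<gamma> ^ (3 * (a + b)) * chi9 \<gamma> ^ (3 * (a + b)) = (chi9 \<gamma> ^ 6) ^ (a + b)"
        by (simp flip: power_add power_mult)
      also have "chi9 \<gamma> ^ 6 = 1" unfolding chi9_def by (rule chi9_unit_power_6[OF Gamma3_diag_not_dvd[OF \<gamma>]])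
      finally show ?thesis by simp
    qed
    define C where "C = chi9 \<gamma> ^ (3 * (a + b))"
    have CC: "1 / C = C" using inverse_unique[OF 6] by (simp add: C_def divide_inverse)
    have k: "(c9 \<gamma> * b9 \<gamma>) ^ k = (c9 \<gamma> * b9 \<gamma>) ^ (k - (a + b)) * (c9 \<gamma> * b9 \<gamma>) ^ (a + b)"
      using True by (simp flip: power_add)
    have "level_multiplier k j \<gamma> * c9 \<gamma> ^ a * b9 \<gamma> ^ b / (C * c9 \<gamma> ^ a * b9 \<gamma> ^ b / (c9 \<gamma> * b9 \<gamma>) ^ (a + b)) =
      (1 / C) * (chi9 \<gamma> ^ j / (c9 \<gamma> * b9 \<gamma>) ^ (k - (a + b)))"
      unfolding level_multiplier_def k by simp
    also have "\<dots> = C * (chi9 \<gamma> ^ j / (c9 \<gamma> * b9 \<gamma>) ^ (k - (a + b)))" by (simp only: CC)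
    also have "\<dots> = level_multiplier (k - (a + b)) j' \<gamma>"
      unfolding level_multiplier_def j'_def chi9_power_mod_6[OF \<gamma>] C_def power_add[of _ j] by simp
    finally show "level_multiplier k j \<gamma> * c9 \<gamma> ^ a * b9 \<gamma> ^ b /
      (chi9 \<gamma> ^ (3 * (a + b)) * c9 \<gamma> ^ a * b9 \<gamma> ^ b / (c9 \<gamma> * b9 \<gamma>) ^ (a + b)) = level_multiplier (k - (a + b)) j' \<gamma>"
      unfolding C_def .
  qed
  finally have "g \<in> modular_forms_level 3 (k - (a + b)) j'" .
  moreover have "f = g * cbrt_eta_bot ^ a * cbrt_eta_top ^ b"
  proof
    fix \<tau>
    have "f \<tau> = g \<tau> * eta_monomial a b \<tau>"
      using f eta_monomial_nonzero[of \<tau> a b] by (auto simp: g_def character_forms_def forms_def)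
    then show "f \<tau> = (g * cbrt_eta_bot ^ a * cbrt_eta_top ^ b) \<tau>" by (simp add: power_fun_apply eta_monomial_def mult.assoc)
  qed
  moreover have "j' \<le> 5" by (simp add: j'_def flip: less_Suc_eq_le)
  ultimately show ?thesis by blast
next
  case False
  have "f = 0"
  proof (rule forms_divide_negative[where u = "eta_monomial a b" and l = "a + b"])
    show "f \<in> forms Gamma9 k (\<lambda>_. 1)" using f character_forms_subset_Gamma9 by blast
    show "slash (a + b) (eta_monomial a b) \<gamma> \<tau> = eta_monomial a b \<tau>"
      if "\<gamma> \<in> Gamma9" "Im \<tau> > 0" for \<gamma> \<tau>
      using slash_eta_monomial_Gamma3_diag[of \<gamma> \<tau> a b] Gamma9_characters_trivial[OF that(1)] that(2) by simp
  qed (use False holomorphic_eta_monomial eta_monomial_nonzero character_forms_dominated[OF f ab] in auto)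
  then have "f = 0 * cbrt_eta_bot ^ a * cbrt_eta_top ^ b" by simp
  moreover have "0 \<in> modular_forms_level 3 0 0" unfolding modular_forms_level_def by (rule zero_in_modular_forms)
  ultimately show ?thesis by blast
qed

lemma level_3_subset_level_9: "modular_forms_level 3 k j \<subseteq> modular_forms_level 9 k j"
  unfolding modular_forms_level_3 modular_forms_level_9 using Gamma9_diag_subset by (auto elim: forms_restrict)

text \<open>
  Multiplication by the monomial is additive, sends each graded piece into another one, and reaches
  every form of the target; so the statements for single forms pass to the sums.
\<close>

lemma eta_monomial_image:
  assumes ab: "a \<le> 2" "b \<le> 2"
  shows "(\<lambda>f. f * cbrt_eta_bot ^ a * cbrt_eta_top ^ b) ` graded_modular_forms_level 3 =
    subspace_sum (UNIV \<times> {0..5}) (\<lambda>(k, j). character_forms k j a b)" (is "?m ` _ = ?R")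
proof
  have add: "x + y \<in> ?R" if "x \<in> ?R" "y \<in> ?R" for x y
    by (rule subspace_sum_add[OF _ _ that])
       (auto simp: character_forms_def forms_0[OF Gamma3_diag_subset_SL2Z] forms_add[OF Gamma3_diag_subset_SL2Z])
  have gadd: "x + y \<in> graded_modular_forms_level 3"
    if "x \<in> graded_modular_forms_level 3" "y \<in> graded_modular_forms_level 3" for x y
    using that unfolding graded_modular_forms_level_def
    by (intro subspace_sum_add) (auto simp: modular_forms_level_def zero_in_modular_forms modular_forms_add)
  have "graded_modular_forms_level 3 \<subseteq> {f. ?m f \<in> ?R}"
    unfolding graded_modular_forms_level_def
  proof (rule subspace_sum_least)
    show "0 \<in> {f. ?m f \<in> ?R}" by (simp add: subspace_sum_0)
    show "x + y \<in> {f. ?m f \<in> ?R}" if "x \<in> {f. ?m f \<in> ?R}" "y \<in> {f. ?m f \<in> ?R}" for x y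
      using add[of "?m x" "?m y"] that by (simp add: distrib_right)
    show "(case p of (k, j) \<Rightarrow> modular_forms_level 3 k j) \<subseteq> {f. ?m f \<in> ?R}" if "p \<in> UNIV \<times> {0..5}" for p
    proof (cases p)
      case (Pair k j)
      have "?m f \<in> ?R" if "f \<in> modular_forms_level 3 k j" for f
        using eta_monomial_multiplies[OF that, of a b]
          subspace_sum_member[of "(k + (a + b), (j + 3 * (a + b)) mod 6)" "UNIV \<times> {0..5}" "?m f" "\<lambda>(k, j). character_forms k j a b"]
        by (simp flip: less_Suc_eq_le)
      then show ?thesis using Pair by auto
    qed
  qed
  then show "?m ` graded_modular_forms_level 3 \<subseteq> ?R" by auto
  show "?R \<subseteq> ?m ` graded_modular_forms_level 3"
  proof (rule subspace_sum_least)
    have "?m 0 \<in> ?m ` graded_modular_forms_level 3"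
      unfolding graded_modular_forms_level_def by (intro imageI subspace_sum_0)
    then show "0 \<in> ?m ` graded_modular_forms_level 3" by simp
    show "x + y \<in> ?m ` graded_modular_forms_level 3"
      if "x \<in> ?m ` graded_modular_forms_level 3" "y \<in> ?m ` graded_modular_forms_level 3" for x y
    proof -
      obtain f g where fg: "f \<in> graded_modular_forms_level 3" "g \<in> graded_modular_forms_level 3" "x = ?m f" "y = ?m g"
        using \<open>x \<in> _\<close> \<open>y \<in> _\<close> by blast
      then have "x + y = ?m (f + g)" by (simp add: distrib_right)
      then show ?thesis using gadd[OF fg(1,2)] by blast
    qed
    show "(case p of (k, j) \<Rightarrow> character_forms k j a b) \<subseteq> ?m ` graded_modular_forms_level 3" if p: "p \<in> UNIV \<times> {0..5}" for p
    proof (cases p)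
      case (Pair k j)
      have "f \<in> ?m ` graded_modular_forms_level 3" if f: "f \<in> character_forms k j a b" for f
      proof -
        obtain k' j' g where g: "j' \<le> 5" "g \<in> modular_forms_level 3 k' j'" "f = ?m g"
          using eta_monomial_divides[OF f ab] p Pair by auto
        have "g \<in> graded_modular_forms_level 3"
          unfolding graded_modular_forms_level_def
          using subspace_sum_member[of "(k', j')" "UNIV \<times> {0..5}" g "\<lambda>(k, j). modular_forms_level 3 k j"] g by simp
        then show ?thesis using g(3) by blast
      qed
      then show ?thesis using Pair by auto
    qed
  qed
qed

section \<open>Cusp forms\<close>

lemma holomorphic_eta_pow: "eta_pow r holomorphic_on \<H>"
proof -
  have "(\<lambda>\<tau>. exp (of_real r * log_eta \<tau>)) holomorphic_on \<H>"
    by (intro holomorphic_intros holomorphic_log_eta)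
  then show ?thesis by (rule holomorphic_transform) (simp add: eta_pow_conv_log_eta)
qed

lemma slash_eta_pow_Gamma9:
  assumes "\<gamma> \<in> Gamma9" "Im \<tau> > 0"
  shows "slash 4 (eta_pow (8/3)) \<gamma> \<tau> = 1 * eta_pow (8/3) \<tau>"
proof -
  have \<gamma>: "\<gamma> \<in> Gamma3_diag" using Gamma9_characters_trivial[OF assms(1)] by blast
  have "denom \<gamma> \<tau> \<noteq> 0" by (rule denom_nonzero[OF Gamma3_diag_SL2Z[OF \<gamma>] assms(2)])
  then show ?thesis unfolding slash_eta_pow[OF Gamma3_diag_SL2Z[OF \<gamma>] assms(2)] third_factor_cubed[OF \<gamma> assms(2)] by simp
qed

text \<open>
  The absolute value of \<open>\<eta>\<^sup>8\<^sup>/\<^sup>3\<close> is invariant under the slash operation of weight \<open>4/3\<close>, hence it decays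
  in the same way at all cusps.
\<close>

lemma slash_eta_pow_tendsto:
  assumes \<gamma>: "\<gamma> \<in> SL2Z"
  shows "(slash 4 (eta_pow (8/3)) \<gamma> \<longlongrightarrow> 0) at_i_infinity"
proof -
  obtain C where C: "\<And>\<tau>. Im \<tau> \<ge> 1 \<Longrightarrow> norm (eta_pow (8/3) \<tau>) * exp (2 * pi / 9 * Im \<tau>) \<le> exp C"
    using eta_pow_growth by (metis atLeastAtMost_iff)
  show ?thesis
  proof (rule Lim_null_comparison)
    have "norm (slash 4 (eta_pow (8/3)) \<gamma> \<tau>) \<le> exp C * exp (- (2 * pi / 9) * Im \<tau>)" if "Im \<tau> \<ge> 1" for \<tau>
      using C[OF that] that by (simp add: norm_slash_eta_pow[OF \<gamma>] exp_minus field_simps)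
    then show "eventually (\<lambda>\<tau>. norm (slash 4 (eta_pow (8/3)) \<gamma> \<tau>) \<le> exp C * exp (- (2 * pi / 9) * Im \<tau>)) at_i_infinity"
      by (auto simp: eventually_at_i_infinity)
    show "((\<lambda>\<tau>. exp C * exp (- (2 * pi / 9) * Im \<tau>)) \<longlongrightarrow> 0) at_i_infinity"
      using tendsto_mult_left[OF tendsto_exp_minus_Im[of "2 * pi / 9"], of "exp C"] by simp
  qed
qed

lemma tendsto_0_imp_Bfun:
  fixes f :: "'a \<Rightarrow> 'b::real_normed_vector"
  assumes "(f \<longlongrightarrow> 0) F"
  shows "Bfun f F"
  by (rule BfunI[of _ 1]) (use tendstoD[OF assms zero_less_one] in eventually_elim, simp)

lemma eta_pow_multiplies:
  assumes f: "f \<in> modular_forms_triv Gamma9 k"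
  shows "f * eta_pow (8/3) \<in> cusp_forms_triv Gamma9 (k + 4)"
proof -
  have f': "f \<in> forms Gamma9 k (\<lambda>_. 1)" using f modular_forms_Gamma9 by blast
  have e: "f * eta_pow (8/3) = (\<lambda>\<tau>. f \<tau> * eta_pow (8/3) \<tau>)" by (simp add: fun_eq_iff)
  have "(\<lambda>\<tau>. f \<tau> * eta_pow (8/3) \<tau>) \<in> forms Gamma9 (k + 4) (\<lambda>_. 1 * 1)"
    by (rule forms_multiply[OF f' holomorphic_eta_pow slash_eta_pow_Gamma9])
       (auto intro: tendsto_0_imp_Bfun slash_eta_pow_tendsto)
  then have M: "f * eta_pow (8/3) \<in> modular_forms_triv Gamma9 (k + 4)"
    unfolding e modular_forms_Gamma9 by simp
  moreover have "(cusp_growth (k + 4) (f * eta_pow (8/3)) \<gamma> \<longlongrightarrow> 0) at_i_infinity" if \<gamma>: "\<gamma> \<in> SL2Z" for \<gamma>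
  proof -
    obtain B where B: "eventually (\<lambda>\<tau>. norm (slash k f \<gamma> \<tau>) \<le> B) at_i_infinity"
      using f' \<gamma> by (auto simp: forms_def Bfun_def)
    have "(slash (k + 4) (\<lambda>\<tau>. f \<tau> * eta_pow (8/3) \<tau>) \<gamma> \<longlongrightarrow> 0) at_i_infinity"
    proof (rule Lim_null_comparison)
      show "eventually (\<lambda>\<tau>. norm (slash (k + 4) (\<lambda>\<tau>. f \<tau> * eta_pow (8/3) \<tau>) \<gamma> \<tau>) \<le> B * norm (slash 4 (eta_pow (8/3)) \<gamma> \<tau>)) at_i_infinity"
        using B by eventually_elim (simp add: slash_mult norm_mult mult_right_mono)
      show "((\<lambda>\<tau>. B * norm (slash 4 (eta_pow (8/3)) \<gamma> \<tau>)) \<longlongrightarrow> 0) at_i_infinity"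
        using tendsto_mult_left[OF tendsto_norm_zero[OF slash_eta_pow_tendsto[OF \<gamma>]], of B] by simp
    qed
    then show ?thesis unfolding tendsto_cusp_growth_iff[OF \<gamma>] e .
  qed
  ultimately show ?thesis by (simp add: cusp_forms_def)
qed

text \<open>
  A slashed cusp form has period \<open>9\<close> and tends to \<open>0\<close>, so its order is at least \<open>1/9\<close>, the order
  of \<open>\<eta>\<^sup>8\<^sup>/\<^sup>3\<close> at every cusp.
\<close>

lemma eta_pow_divides:
  assumes f: "f \<in> cusp_forms_triv Gamma9 k"
  shows "\<exists>k' g. g \<in> modular_forms_triv Gamma9 k' \<and> f = g * eta_pow (8/3)"
proof -
  have f': "f \<in> forms Gamma9 k (\<lambda>_. 1)"
    using f by (simp add: cusp_forms_def modular_forms_Gamma9)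
  have nz: "eta_pow (8/3) \<tau> \<noteq> 0" if "Im \<tau> > 0" for \<tau> using that by (simp add: eta_pow_conv_log_eta)
  have dom: "Bfun (\<lambda>\<tau>. norm (slash k f \<gamma> \<tau>) / norm (slash 4 (eta_pow (8/3)) \<gamma> \<tau>)) at_i_infinity" if \<gamma>: "\<gamma> \<in> SL2Z" for \<gamma>
  proof -
    have "slash k f \<gamma> holomorphic_on \<H>" by (rule holomorphic_slash[OF \<gamma>]) (use f' in \<open>simp add: forms_def\<close>)
    moreover have "(slash k f \<gamma> \<longlongrightarrow> 0) at_i_infinity"
    proof -
      have "(cusp_growth k f \<gamma> \<longlongrightarrow> 0) at_i_infinity" using f \<gamma> unfolding cusp_forms_def by blast
      then show ?thesis by (simp only: tendsto_cusp_growth_iff[OF \<gamma>])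
    qed
    ultimately have "Bfun (\<lambda>\<tau>. norm (slash k f \<gamma> \<tau>) * exp (2 * pi / 9 * Im \<tau>)) at_i_infinity"
      using periodic_vanishing_decay[of "slash k f \<gamma>" 9] forms_Gamma9_periodic[OF f' \<gamma>] by simp
    then obtain B where B: "eventually (\<lambda>\<tau>. norm (norm (slash k f \<gamma> \<tau>) * exp (2 * pi / 9 * Im \<tau>)) \<le> B) at_i_infinity"
      unfolding Bfun_def by blast
    obtain C where C: "\<And>\<tau>. Im \<tau> \<ge> 1 \<Longrightarrow> exp (- C) \<le> norm (eta_pow (8/3) \<tau>) * exp (2 * pi / 9 * Im \<tau>)"
      using eta_pow_growth by (metis atLeastAtMost_iff)
    have big: "eventually (\<lambda>\<tau>. Im \<tau> \<ge> 1) at_i_infinity" by (auto simp: eventually_at_i_infinity)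
    show ?thesis
    proof (rule BfunI)
      show "eventually (\<lambda>\<tau>. norm (norm (slash k f \<gamma> \<tau>) / norm (slash 4 (eta_pow (8/3)) \<gamma> \<tau>)) \<le> B / exp (- C)) at_i_infinity"
        using B big
      proof eventually_elim
        case (elim \<tau>)
        have t: "Im \<tau> > 0" using elim by simp
        define E where "E = norm (eta_pow (8/3) \<tau>)"
        have E: "E > 0" using nz[OF t] by (simp add: E_def)
        define x where "x = exp (2 * pi / 9 * Im \<tau>)"
        have x: "x > 0" by (simp add: x_def)
        have "norm (slash k f \<gamma> \<tau>) * exp (- C) \<le> norm (slash k f \<gamma> \<tau>) * (E * x)"
          using C[OF elim(2)] by (intro mult_left_mono) (simp_all add: E_def x_def)
        also have "\<dots> = (norm (slash k f \<gamma> \<tau>) * x) * E" by (simp only: mult_ac)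
        also have "\<dots> \<le> B * E" by (rule mult_right_mono) (use elim(1) E in \<open>simp_all add: x_def abs_mult\<close>)
        finally have "norm (slash k f \<gamma> \<tau>) / E \<le> B / exp (- C)" using E by (simp add: field_simps)
        then show ?case by (simp add: norm_slash_eta_pow[OF \<gamma> t] E_def)
      qed
    qed
  qed
  note G = Gamma9_subset_SL2Z
  show ?thesis
  proof (cases "4 \<le> k")
    case True
    define g where "g = (\<lambda>\<tau>. if Im \<tau> > 0 then f \<tau> / eta_pow (8/3) \<tau> else 0)"
    have "g \<in> forms Gamma9 (k - 4) (\<lambda>_. 1 / 1)"
      unfolding g_def by (rule forms_divide[OF f' G True holomorphic_eta_pow nz slash_eta_pow_Gamma9 dom])
    then have "g \<in> modular_forms_triv Gamma9 (k - 4)" by (simp add: modular_forms_Gamma9)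
    moreover have "f = g * eta_pow (8/3)"
      using f' nz by (auto simp: fun_eq_iff g_def forms_def)
    ultimately show ?thesis by blast
  next
    case False
    have "f = 0"
      by (rule forms_divide_negative[where l = 4, OF f' _ holomorphic_eta_pow nz _ dom])
         (use False slash_eta_pow_Gamma9 in auto)
    then have "f = 0 * eta_pow (8/3)" by simp
    then show ?thesis using zero_in_modular_forms by blast
  qed
qed

lemma graded_cusp_forms_eq:
  "graded_cusp_forms Gamma9 =
     (\<lambda>f. f * eta_pow (8/3)) ` graded_modular_forms Gamma9" (is "?S = ?m ` ?M")
proof
  have Sadd: "x + y \<in> ?S" if "x \<in> ?S" "y \<in> ?S" for x y
    using that unfolding graded_cusp_forms_def by (intro subspace_sum_add zero_in_cusp_forms cusp_forms_add)
  have Madd: "x + y \<in> ?M" if "x \<in> ?M" "y \<in> ?M" for x y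
    using that unfolding graded_modular_forms_def by (intro subspace_sum_add zero_in_modular_forms modular_forms_add)
  have "0 \<in> ?S" "0 \<in> ?M" by (simp_all add: graded_cusp_forms_def graded_modular_forms_def subspace_sum_0)
  show "?S \<subseteq> ?m ` ?M"
    unfolding graded_cusp_forms_def
  proof (rule subspace_sum_least)
    have "?m 0 \<in> ?m ` ?M" using \<open>0 \<in> ?M\<close> by (rule imageI)
    then show "0 \<in> ?m ` ?M" by simp
    show "x + y \<in> ?m ` ?M" if "x \<in> ?m ` ?M" "y \<in> ?m ` ?M" for x y
    proof -
      obtain f g where "f \<in> ?M" "g \<in> ?M" "x = ?m f" "y = ?m g" using \<open>x \<in> _\<close> \<open>y \<in> _\<close> by blast
      then have "x + y = ?m (f + g)" "f + g \<in> ?M" by (simp_all add: distrib_right Madd)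
      then show ?thesis by blast
    qed
    show "cusp_forms_triv Gamma9 k \<subseteq> ?m ` ?M" for k
    proof
      fix f assume "f \<in> cusp_forms_triv Gamma9 k"
      from eta_pow_divides[OF this] obtain k' g
        where g: "g \<in> modular_forms_triv Gamma9 k'" "f = g * eta_pow (8/3)" by blast
      have "g \<in> ?M" unfolding graded_modular_forms_def by (rule subspace_sum_member[where V = "modular_forms_triv Gamma9", OF UNIV_I g(1)])
      then show "f \<in> ?m ` ?M" unfolding g(2) by (rule imageI)
    qed
  qed
  have "?M \<subseteq> {f. ?m f \<in> ?S}"
    unfolding graded_modular_forms_def
  proof (rule subspace_sum_least)
    show "0 \<in> {f. ?m f \<in> ?S}" using \<open>0 \<in> ?S\<close> by simp
    show "x + y \<in> {f. ?m f \<in> ?S}" if "x \<in> {f. ?m f \<in> ?S}" "y \<in> {f. ?m f \<in> ?S}" for x y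
      using Sadd[of "?m x" "?m y"] that by (simp add: distrib_right)
    show "modular_forms_triv Gamma9 k \<subseteq> {f. ?m f \<in> ?S}" for k
      unfolding graded_cusp_forms_def
      using subspace_sum_member[where i = "k + 4" and V = "cusp_forms_triv Gamma9", OF UNIV_I eta_pow_multiplies]
      by blast
  qed
  then show "?m ` ?M \<subseteq> ?S" by auto
qed

theorem theorem33:
  shows "(\<forall>k. is_internal_direct_sum
                (modular_forms_triv (principal_congruence_subgroup 9) k) {0..5}
                (modular_forms_level 9 k))
    \<and> independent_subspaces UNIV (modular_forms_triv (principal_congruence_subgroup 9))
    \<and> independent_subspaces UNIV (cusp_forms_triv (principal_congruence_subgroup 9))
    \<and> independent_subspaces (UNIV \<times> {0..5}) (\<lambda>(k, j). modular_forms_level 9 k j)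
    \<and> independent_subspaces (UNIV \<times> {0..5}) (\<lambda>(k, j). modular_forms_level 3 k j)
    \<and> graded_modular_forms (principal_congruence_subgroup 9) = graded_modular_forms_level 9
    \<and> is_internal_direct_sum (graded_modular_forms_level 9) ({0, 1, 2} \<times> {0, 1, 2})
         (\<lambda>(a, b). (\<lambda>f. f * cbrt_eta_bot ^ a * cbrt_eta_top ^ b) ` graded_modular_forms_level 3)
    \<and> graded_cusp_forms (principal_congruence_subgroup 9) =
         (\<lambda>f. f * eta_pow (8/3)) ` graded_modular_forms (principal_congruence_subgroup 9)"
proof -
  have indep: "independent_subspaces UNIV (modular_forms_triv Gamma9)"
    using independent_weights unfolding modular_forms_Gamma9[abs_def] .
  have graded: "is_internal_direct_sum (graded_modular_forms Gamma9) UNIV (modular_forms_triv Gamma9)"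
    using indep by (simp add: is_internal_direct_sum_def graded_modular_forms_def)
  have level9: "is_internal_direct_sum (graded_modular_forms Gamma9) (UNIV \<times> {0..5}) (\<lambda>(k, j). modular_forms_level 9 k j)"
  proof (rule is_internal_direct_sum_trans[OF graded])
    show "is_internal_direct_sum (modular_forms_triv Gamma9 k) {0..5} (modular_forms_level 9 k)" for k
      by (rule decomposition_Gamma9)
  qed (simp_all add: modular_forms_level_def zero_in_modular_forms modular_forms_add)
  then have eq: "graded_modular_forms Gamma9 = graded_modular_forms_level 9"
    by (simp add: is_internal_direct_sum_def graded_modular_forms_level_def)
  have fine: "is_internal_direct_sum (graded_modular_forms_level 9) ((UNIV \<times> {0..5}) \<times> ({0, 1, 2} \<times> {0, 1, 2}))
      (\<lambda>(p, q). case p of (k, j) \<Rightarrow> case q of (a, b) \<Rightarrow> character_forms k j a b)"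
  proof (rule is_internal_direct_sum_trans[OF level9[unfolded eq]])
    show "is_internal_direct_sum (case p of (k, j) \<Rightarrow> modular_forms_level 9 k j) ({0, 1, 2} \<times> {0, 1, 2})
       (\<lambda>q. case p of (k, j) \<Rightarrow> case q of (a, b) \<Rightarrow> character_forms k j a b)" for p
      by (cases p) (use decomposition_level_9 in simp)
  qed (auto simp: character_forms_def forms_0[OF Gamma3_diag_subset_SL2Z] forms_add[OF Gamma3_diag_subset_SL2Z] split: prod.splits)
  have "is_internal_direct_sum (graded_modular_forms_level 9) ({0, 1, 2} \<times> {0, 1, 2})
         (\<lambda>(a, b). (\<lambda>f. f * cbrt_eta_bot ^ a * cbrt_eta_top ^ b) ` graded_modular_forms_level 3)"
  proof (rule is_internal_direct_sum_cong[THEN iffD1, OF _ is_internal_direct_sum_coarsen[OF fine]])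
    fix q :: "nat \<times> nat" assume "q \<in> {0, 1, 2} \<times> {0, 1, 2}"
    then obtain a b where q: "q = (a, b)" "a \<le> 2" "b \<le> 2" by auto
    show "subspace_sum (UNIV \<times> {0..5}) (\<lambda>p. case p of (k, j) \<Rightarrow> case q of (a, b) \<Rightarrow> character_forms k j a b) =
       (case q of (a, b) \<Rightarrow> (\<lambda>f. f * cbrt_eta_bot ^ a * cbrt_eta_top ^ b) ` graded_modular_forms_level 3)"
      using eta_monomial_image[OF q(2,3)] by (simp add: q(1))
  qed (auto simp: character_forms_def forms_0[OF Gamma3_diag_subset_SL2Z] forms_add[OF Gamma3_diag_subset_SL2Z] split: prod.splits)
  moreover have "independent_subspaces UNIV (cusp_forms_triv Gamma9)"
    by (rule independent_subspaces_mono[OF indep]) (auto simp: cusp_forms_def)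
  moreover have "independent_subspaces (UNIV \<times> {0..5}) (\<lambda>(k, j). modular_forms_level 9 k j)"
    using level9 by (simp add: is_internal_direct_sum_def)
  moreover from this have "independent_subspaces (UNIV \<times> {0..5}) (\<lambda>(k, j). modular_forms_level 3 k j)"
    by (rule independent_subspaces_mono) (use level_3_subset_level_9 in auto)
  moreover have "graded_cusp_forms Gamma9 = (\<lambda>f. f * eta_pow (8/3)) ` graded_modular_forms Gamma9"
    by (rule graded_cusp_forms_eq)
  ultimately show ?thesis using decomposition_Gamma9 indep eq by blast
qed

end
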